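(* Let $k$ be a field of characteristic $p>2$, let $\mathfrak g$ be a restricted Lie superalgebra over $k$, let $K,N$ be restricted $\mathfrak g$-modules, and let $M=\underline{\mathrm{Hom}}_k(N,K)$ be the superspace of all $k$-linear maps $N\to K$ with $\mathfrak g$-action $(x\cdot m)(a)=x\cdot m(a)-(-1)^{|x||m|}m(x\cdot a)$. Then there is a canonical isomorphism $F_*:\mathrm{Ext}_*(K,N)\to\mathrm H^1_*(\mathfrak g,M)$ such that $$i_1\circ F_*=F\circ i_2,$$ where $i_2:\mathrm{Ext}_*(K,N)\to\mathrm{Ext}(K,N)$, $i_1:\mathrm H^1_*(\mathfrak g,M)\to\mathrm H^1(\mathfrak g,M)$ and the isomorphism $F:\mathrm{Ext}(K,N)\to\mathrm H^1(\mathfrak g,M)$ are the canonical maps defined in the context.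
   Context: Conventions. All vector spaces and modules are $\mathbb Z_2$-graded, linear maps are even unless stated otherwise, $|v|$ is the degree of a homogeneous element. A restricted Lie superalgebra is a Lie superalgebra $\mathfrak g=\mathfrak g_{\bar 0}\oplus\mathfrak g_{\bar 1}$ with a map $x\mapsto x^{[p]}$, $\mathfrak g_{\bar 0}\to\mathfrak g_{\bar 0}$, such that (a) $(cx)^{[p]}=c^px^{[p]}$; (b) $[x^{[p]},y]=(\mathrm{ad}\,x)^p(y)$ for $x\in\mathfrak g_{\bar 0}$, $y\in\mathfrak g$; (c) $(x+y)^{[p]}=x^{[p]}+y^{[p]}+\sum_{i=1}^{p-1}s_i(x,y)$, where $i\,s_i(x,y)$ is the coefficient of $\lambda^{i-1}$ in $(\mathrm{ad}(\lambda x+y))^{p-1}(x)$. A $\mathfrak g$-module $V$ is restricted if $x^p\cdot v=x^{[p]}\cdot v$ for $x\in\mathfrak g_{\bar 0}$, $v\in V$. $\mathbf u(\mathfrak g)=U(\mathfrak g)/(x^p-x^{[p]}:x\in\mathfrak g_{\bar 0})$ and $\mathbf u(\mathfrak g)^+$ is its ideal generated by $\mathfrak g$. The superspace $\underline{\mathrm{Hom}}_k(N,K)$ has even part the even maps and odd part the odd maps; with the given action it is a restricted $\mathfrak g$-module. An extension of $K$ by $N$ is a pair $(E,\phi)$ with $E$ a $\mathfrak g$-module containing $K$ and $\phi:E\to N$ a surjective (even) $\mathfrak g$-homomorphism with kernel $K$. Two are equivalent if there is a $\mathfrak g$-isomorphism $\alpha:E\to E'$ fixing $K$ pointwise with $\phi'\alpha=\phi$.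 An extension is restricted if $E$ is a restricted $\mathfrak g$-module. $\mathrm{Ext}(K,N)$ (resp. $\mathrm{Ext}_*(K,N)$) is the $k$-vector space (usual Baer structure) of equivalence classes of extensions (resp. restricted extensions); $i_2$ is the natural inclusion. $\mathrm H^1(\mathfrak g,M)$ is the space of even linear maps $f:\mathfrak g\to M$ with $f([x_1,x_2])=x_1\cdot f(x_2)-(-1)^{|x_1||x_2|}x_2\cdot f(x_1)$, modulo the maps $x\mapsto x\cdot m$, $m\in M_{\bar 0}$. $\mathrm H^1_*(\mathfrak g,M)$ is the space of even linear maps $f:\mathbf u(\mathfrak g)^+\to M$ with $f(uv)=u\cdot f(v)$ for $u,v\in\mathbf u(\mathfrak g)^+$, modulo the maps $u\mapsto u\cdot m$, $m\in M_{\bar 0}$. The canonical injection $i_1$ is induced by restricting $f$ to (the image of) $\mathfrak g$. The isomorphism $F$ sends the class of $(E,\phi)$ to the class of $f$, $f(x)(a)=x\cdot\varphi(a)-\varphi(x\cdot a)$ ($x\in\mathfrak g$, $a\in N$), where $\varphi:N\to E$ is any even linear map with $\phi\varphi=\mathrm{id}_N$. *)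

theory Defs
  imports
    "HOL-Library.Z2"
    "HOL-Library.Poly_Mapping"
    "HOL-Algebra.QuotRing"
    "HOL-Algebra.Module"
    "HOL-Algebra.Algebraic_Closure_Type"
begin

section \<open>Superspaces\<close>

text \<open>
  Degrees live in the type \<^typ>\<open>bit\<close>, i.e. in the integers modulo 2.
  Vector spaces are \<^locale>\<open>module\<close>s over the ground field; their \<open>mult\<close> and
  \<open>one\<close> fields are meaningful only where the space is also an algebra.
\<close>

abbreviation scalars :: "'k::field ring"
  where "scalars \<equiv> ring_of_type_algebra"

definition koszul :: "bit \<Rightarrow> bit \<Rightarrow> 'k::field"
  where "koszul i j = (if i = 1 \<and> j = 1 then - 1 else 1)"

record ('k, 'v) superspace = "('k, 'v) module" +
  part :: "bit \<Rightarrow> 'v set"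

locale superspace = module "scalars :: 'k ring" V
  for V :: "('k::field, 'v, 'z) superspace_scheme" (structure) +
  assumes part_submodule: "submodule (part V i) (scalars :: 'k ring) V"
    and part_direct_sum: "v \<in> carrier V \<Longrightarrow>
      \<exists>!ab. fst ab \<in> part V 0 \<and> snd ab \<in> part V 1 \<and> v = fst ab \<oplus> snd ab"

definition component :: "('k::field, 'v, 'z) superspace_scheme \<Rightarrow> bit \<Rightarrow> 'v \<Rightarrow> 'v"
  where "component V i v = (THE a. a \<in> part V i \<and> (\<exists>b \<in> part V (i + 1). v = a \<oplus>\<^bsub>V\<^esub> b))"

definition lin_maps ::
    "('k::field, 'v, 'y) module_scheme \<Rightarrow> ('k, 'w, 'z) module_scheme \<Rightarrow> ('v \<Rightarrow> 'w) set"
  where "lin_maps V W = {f \<in> carrier V \<rightarrow>\<^sub>E carrier W.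
    (\<forall>x \<in> carrier V. \<forall>y \<in> carrier V. f (x \<oplus>\<^bsub>V\<^esub> y) = f x \<oplus>\<^bsub>W\<^esub> f y) \<and>
    (\<forall>c. \<forall>x \<in> carrier V. f (c \<odot>\<^bsub>V\<^esub> x) = c \<odot>\<^bsub>W\<^esub> f x)}"

definition lin_isos ::
    "('k::field, 'v, 'y) module_scheme \<Rightarrow> ('k, 'w, 'z) module_scheme \<Rightarrow> ('v \<Rightarrow> 'w) set"
  where "lin_isos V W = {f \<in> lin_maps V W. bij_betw f (carrier V) (carrier W)}"

definition lin_maps_deg ::
    "('k::field, 'v, 'y) superspace_scheme \<Rightarrow> ('k, 'w, 'z) superspace_scheme \<Rightarrow> bit \<Rightarrow> ('v \<Rightarrow> 'w) set"
  where "lin_maps_deg V W d = {f \<in> lin_maps V W. \<forall>i. f ` part V i \<subseteq> part W (d + i)}"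

definition hom_space ::
    "('k::field, 'v, 'y) superspace_scheme \<Rightarrow> ('k, 'w, 'z) superspace_scheme \<Rightarrow> ('k, 'v \<Rightarrow> 'w) superspace"
  where "hom_space V W =
    \<lparr>carrier = lin_maps V W, monoid.mult = undefined, one = undefined,
     zero = (\<lambda>a\<in>carrier V. \<zero>\<^bsub>W\<^esub>),
     add = (\<lambda>f g. \<lambda>a\<in>carrier V. f a \<oplus>\<^bsub>W\<^esub> g a),
     module.smult = (\<lambda>c f. \<lambda>a\<in>carrier V. c \<odot>\<^bsub>W\<^esub> f a),
     part = lin_maps_deg V W\<rparr>"

definition sub_superspace ::
    "('k::field, 'v, 'z) superspace_scheme \<Rightarrow> 'v set \<Rightarrow> ('k, 'v, 'z) superspace_scheme"
  where "sub_superspace V S = V\<lparr>carrier := S, part := \<lambda>i. part V i \<inter> S\<rparr>"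

definition quot_module :: "('k::field, 'v, 'z) module_scheme \<Rightarrow> 'v set \<Rightarrow> ('k, 'v set) module"
  where "quot_module V D =
    ring.extend (V Quot D) (module.fields (\<lambda>c A. \<Union>a\<in>A. D +>\<^bsub>V\<^esub> (c \<odot>\<^bsub>V\<^esub> a)))"

definition quot_superspace ::
    "('k::field, 'v, 'z) superspace_scheme \<Rightarrow> 'v set \<Rightarrow> ('k, 'v set) superspace"
  where "quot_superspace V D =
    module.extend (quot_module V D) (superspace.fields (\<lambda>i. (\<lambda>v. D +>\<^bsub>V\<^esub> v) ` part V i))"


section \<open>Restricted Lie superalgebras and their modules\<close>

record ('k, 'g) lie_super = "('k, 'g) superspace" +
  bracket :: "'g \<Rightarrow> 'g \<Rightarrow> 'g"

text \<open>
  In characteristic 3 one often also demands \<open>[x,[x,x]] = 0\<close> for odd \<open>x\<close>.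
  This is not imposed, so both conventions are covered.
\<close>

locale lie_superalgebra = superspace G
  for G :: "('k::field, 'g, 'z) lie_super_scheme" (structure) +
  assumes bracket_add_left: "\<lbrakk>x \<in> carrier G; y \<in> carrier G; z \<in> carrier G\<rbrakk> \<Longrightarrow>
      bracket G (x \<oplus> y) z = bracket G x z \<oplus> bracket G y z"
    and bracket_add_right: "\<lbrakk>x \<in> carrier G; y \<in> carrier G; z \<in> carrier G\<rbrakk> \<Longrightarrow>
      bracket G x (y \<oplus> z) = bracket G x y \<oplus> bracket G x z"
    and bracket_smult_left: "\<lbrakk>x \<in> carrier G; y \<in> carrier G\<rbrakk> \<Longrightarrow>
      bracket G (c \<odot> x) y = c \<odot> bracket G x y"
    and bracket_smult_right: "\<lbrakk>x \<in> carrier G; y \<in> carrier G\<rbrakk> \<Longrightarrow>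
      bracket G x (c \<odot> y) = c \<odot> bracket G x y"
    and bracket_part: "\<lbrakk>x \<in> part G i; y \<in> part G j\<rbrakk> \<Longrightarrow> bracket G x y \<in> part G (i + j)"
    and bracket_skew: "\<lbrakk>x \<in> part G i; y \<in> part G j\<rbrakk> \<Longrightarrow>
      bracket G x y = \<ominus> (koszul i j \<odot> bracket G y x)"
    and bracket_jacobi: "\<lbrakk>x \<in> part G i; y \<in> part G j; z \<in> part G l\<rbrakk> \<Longrightarrow>
      bracket G x (bracket G y z) =
        bracket G (bracket G x y) z \<oplus> koszul i j \<odot> bracket G y (bracket G x z)"

text \<open>
  \<open>ad_coeff G x y n j\<close> is the coefficient of \<open>\<lambda>\<^sup>j\<close> in \<open>(ad (\<lambda>x + y))\<^sup>n (x)\<close>,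
  computed in the polynomials in \<open>\<lambda>\<close> with coefficients in \<open>G\<close>.
\<close>

primrec ad_coeff ::
    "('k::field, 'g, 'z) lie_super_scheme \<Rightarrow> 'g \<Rightarrow> 'g \<Rightarrow> nat \<Rightarrow> nat \<Rightarrow> 'g"
  where
    "ad_coeff G x y 0 = (\<lambda>j. if j = 0 then x else \<zero>\<^bsub>G\<^esub>)"
  | "ad_coeff G x y (Suc n) = (\<lambda>j. bracket G y (ad_coeff G x y n j) \<oplus>\<^bsub>G\<^esub>
       (if j = 0 then \<zero>\<^bsub>G\<^esub> else bracket G x (ad_coeff G x y n (j - 1))))"

definition jacobson_term ::
    "('k::field, 'g, 'z) lie_super_scheme \<Rightarrow> nat \<Rightarrow> 'g \<Rightarrow> 'g \<Rightarrow> 'g"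
  where "jacobson_term G i x y =
    inverse (of_nat i) \<odot>\<^bsub>G\<^esub> ad_coeff G x y (CHAR('k) - 1) (i - 1)"

record ('k, 'g) restricted_lie_super = "('k, 'g) lie_super" +
  ppow :: "'g \<Rightarrow> 'g"

locale restricted_lie_superalgebra = lie_superalgebra G
  for G :: "('k::field, 'g, 'z) restricted_lie_super_scheme" (structure) +
  assumes ppow_closed: "x \<in> part G 0 \<Longrightarrow> ppow G x \<in> part G 0"
    and ppow_smult: "x \<in> part G 0 \<Longrightarrow> ppow G (c \<odot> x) = (c ^ CHAR('k)) \<odot> ppow G x"
    and ppow_ad: "\<lbrakk>x \<in> part G 0; y \<in> carrier G\<rbrakk> \<Longrightarrow>
      bracket G (ppow G x) y = (bracket G x ^^ CHAR('k)) y"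
    and ppow_add: "\<lbrakk>x \<in> part G 0; y \<in> part G 0\<rbrakk> \<Longrightarrow>
      ppow G (x \<oplus> y) =
        ppow G x \<oplus> ppow G y \<oplus> (\<Oplus>i\<in>{1..CHAR('k) - 1}. jacobson_term G i x y)"

record ('k, 'g, 'v) gmodule = "('k, 'v) superspace" +
  act :: "'g \<Rightarrow> 'v \<Rightarrow> 'v"

locale gmodule = G: lie_superalgebra G + V: superspace V
  for G :: "('k::field, 'g, 'y) lie_super_scheme"
    and V :: "('k, 'g, 'v, 'z) gmodule_scheme" +
  assumes act_add_left: "\<lbrakk>x \<in> carrier G; y \<in> carrier G; v \<in> carrier V\<rbrakk> \<Longrightarrow>
      act V (x \<oplus>\<^bsub>G\<^esub> y) v = act V x v \<oplus>\<^bsub>V\<^esub> act V y v"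
    and act_add_right: "\<lbrakk>x \<in> carrier G; v \<in> carrier V; w \<in> carrier V\<rbrakk> \<Longrightarrow>
      act V x (v \<oplus>\<^bsub>V\<^esub> w) = act V x v \<oplus>\<^bsub>V\<^esub> act V x w"
    and act_smult_left: "\<lbrakk>x \<in> carrier G; v \<in> carrier V\<rbrakk> \<Longrightarrow>
      act V (c \<odot>\<^bsub>G\<^esub> x) v = c \<odot>\<^bsub>V\<^esub> act V x v"
    and act_smult_right: "\<lbrakk>x \<in> carrier G; v \<in> carrier V\<rbrakk> \<Longrightarrow>
      act V x (c \<odot>\<^bsub>V\<^esub> v) = c \<odot>\<^bsub>V\<^esub> act V x v"
    and act_part: "\<lbrakk>x \<in> part G i; v \<in> part V j\<rbrakk> \<Longrightarrow> act V x v \<in> part V (i + j)"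
    and act_bracket: "\<lbrakk>x \<in> part G i; y \<in> part G j; v \<in> carrier V\<rbrakk> \<Longrightarrow>
      act V (bracket G x y) v =
        act V x (act V y v) \<ominus>\<^bsub>V\<^esub> koszul i j \<odot>\<^bsub>V\<^esub> act V y (act V x v)"

locale restricted_gmodule = gmodule G V
  for G :: "('k::field, 'g, 'y) restricted_lie_super_scheme"
    and V :: "('k, 'g, 'v, 'z) gmodule_scheme" +
  assumes act_ppow: "\<lbrakk>x \<in> part G 0; v \<in> carrier V\<rbrakk> \<Longrightarrow>
      (act V x ^^ CHAR('k)) v = act V (ppow G x) v"

definition gmod_homs ::
    "('k::field, 'g, 'x) lie_super_scheme \<Rightarrow> ('k, 'g, 'v, 'y) gmodule_scheme \<Rightarrow>
     ('k, 'g, 'w, 'z) gmodule_scheme \<Rightarrow> ('v \<Rightarrow> 'w) set"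
  where "gmod_homs G V W = {f \<in> lin_maps_deg V W 0.
    \<forall>x \<in> carrier G. \<forall>v \<in> carrier V. f (act V x v) = act W x (f v)}"

text \<open>
  The formula \<open>(x\<cdot>m)(a) = x\<cdot>m(a) - (-1)^(|x||m|) m(x\<cdot>a)\<close> is prescribed for homogeneous
  \<open>x\<close> and \<open>m\<close>; the double sum over the homogeneous components extends it bilinearly.
\<close>

definition hom_gmodule ::
    "('k::field, 'g, 'x) lie_super_scheme \<Rightarrow> ('k, 'g, 'w, 'y) gmodule_scheme \<Rightarrow>
     ('k, 'g, 'v, 'z) gmodule_scheme \<Rightarrow> ('k, 'g, 'w \<Rightarrow> 'v) gmodule"
  where "hom_gmodule G N K = superspace.extend (hom_space N K) (gmodule.fields
    (\<lambda>x m. \<lambda>a\<in>carrier N. \<Oplus>\<^bsub>K\<^esub>i\<in>UNIV. \<Oplus>\<^bsub>K\<^esub>j\<in>UNIV.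
       act K (component G i x) (component (hom_space N K) j m a) \<ominus>\<^bsub>K\<^esub>
       koszul i j \<odot>\<^bsub>K\<^esub> component (hom_space N K) j m (act N (component G i x) a)))"

definition direct_sum ::
    "('k::field, 'g, 'v, 'y) gmodule_scheme \<Rightarrow> ('k, 'g, 'w, 'z) gmodule_scheme \<Rightarrow>
     ('k, 'g, 'v \<times> 'w) gmodule"
  where "direct_sum V W =
    \<lparr>carrier = carrier V \<times> carrier W, monoid.mult = undefined, one = undefined,
     zero = (\<zero>\<^bsub>V\<^esub>, \<zero>\<^bsub>W\<^esub>),
     add = (\<lambda>(a, b) (a', b'). (a \<oplus>\<^bsub>V\<^esub> a', b \<oplus>\<^bsub>W\<^esub> b')),
     module.smult = (\<lambda>c (a, b). (c \<odot>\<^bsub>V\<^esub> a, c \<odot>\<^bsub>W\<^esub> b)),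
     part = (\<lambda>i. part V i \<times> part W i),
     act = (\<lambda>x (a, b). (act V x a, act W x b))\<rparr>"

definition quot_gmodule ::
    "('k::field, 'g, 'v, 'z) gmodule_scheme \<Rightarrow> 'v set \<Rightarrow> ('k, 'g, 'v set) gmodule"
  where "quot_gmodule V D = superspace.extend (quot_superspace V D)
    (gmodule.fields (\<lambda>x A. \<Union>a\<in>A. D +>\<^bsub>V\<^esub> act V x a))"


section \<open>Enveloping algebras\<close>

datatype 'g free_word = Word (letters: "'g list")

instantiation free_word :: (type) monoid_add
begin

definition "0 = Word []"
definition "v + w = Word (letters v @ letters w)"

instance
  by standard (simp_all add: zero_free_word_def plus_free_word_def)

end

type_synonym ('k, 'g) free_poly = "'g free_word \<Rightarrow>\<^sub>0 'k"

definition word_degree :: "('k::field, 'g, 'z) lie_super_scheme \<Rightarrow> 'g free_word \<Rightarrow> bit \<Rightarrow> bool"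
  where "word_degree G w i \<longleftrightarrow>
    (\<exists>ds. list_all2 (\<lambda>x d. x \<in> part G d) (letters w) ds \<and> sum_list ds = i)"

text \<open>
  The free associative unital algebra on the underlying set of \<open>G\<close>. As inhomogeneous
  elements of \<open>G\<close> are letters too, the spans of the homogeneous words recorded as
  \<^const>\<open>part\<close> become a grading only in \<open>env_alg\<close> below, where the linear relations
  of \<open>G\<close> hold.
\<close>

definition free_alg :: "('k::field, 'g, 'z) lie_super_scheme \<Rightarrow> ('k, ('k, 'g) free_poly) superspace"
  where "free_alg G =
    \<lparr>carrier = {t. \<forall>w \<in> Poly_Mapping.keys t. set (letters w) \<subseteq> carrier G},
     monoid.mult = (*), one = 1, zero = 0, add = (+),
     module.smult = (\<lambda>c t. Poly_Mapping.single 0 c * t),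
     part = (\<lambda>i. {t. \<forall>w \<in> Poly_Mapping.keys t. set (letters w) \<subseteq> carrier G \<and> word_degree G w i})\<rparr>"

definition letter :: "'g \<Rightarrow> ('k::field, 'g) free_poly"
  where "letter x = Poly_Mapping.single (Word [x]) 1"

definition env_relations :: "('k::field, 'g, 'z) lie_super_scheme \<Rightarrow> ('k, 'g) free_poly set"
  where "env_relations G =
    {letter (x \<oplus>\<^bsub>G\<^esub> y) - letter x - letter y | x y. x \<in> carrier G \<and> y \<in> carrier G} \<union>
    {letter (c \<odot>\<^bsub>G\<^esub> x) - Poly_Mapping.single 0 c * letter x | c x. x \<in> carrier G} \<union>
    {letter x * letter y - Poly_Mapping.single 0 (koszul i j) * letter y * letter x
       - letter (bracket G x y) | i j x y. x \<in> part G i \<and> y \<in> part G j}"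

definition env_ideal :: "('k::field, 'g, 'z) lie_super_scheme \<Rightarrow> ('k, 'g) free_poly set"
  where "env_ideal G = Idl\<^bsub>free_alg G\<^esub> (env_relations G)"

definition env_alg ::
    "('k::field, 'g, 'z) lie_super_scheme \<Rightarrow> ('k, ('k, 'g) free_poly set) superspace"
  where "env_alg G = quot_superspace (free_alg G) (env_ideal G)"

definition env_incl :: "('k::field, 'g, 'z) lie_super_scheme \<Rightarrow> 'g \<Rightarrow> ('k, 'g) free_poly set"
  where "env_incl G x = env_ideal G +>\<^bsub>free_alg G\<^esub> letter x"

definition renv_ideal ::
    "('k::field, 'g, 'z) restricted_lie_super_scheme \<Rightarrow> ('k, 'g) free_poly set set"
  where "renv_ideal G = Idl\<^bsub>env_alg G\<^esub>
    {env_incl G x [^]\<^bsub>env_alg G\<^esub> CHAR('k) \<ominus>\<^bsub>env_alg G\<^esub> env_incl G (ppow G x) | x. x \<in> part G 0}"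

definition renv_alg ::
    "('k::field, 'g, 'z) restricted_lie_super_scheme \<Rightarrow> ('k, ('k, 'g) free_poly set set) superspace"
  where "renv_alg G = quot_superspace (env_alg G) (renv_ideal G)"

definition renv_incl ::
    "('k::field, 'g, 'z) restricted_lie_super_scheme \<Rightarrow> 'g \<Rightarrow> ('k, 'g) free_poly set set"
  where "renv_incl G x = renv_ideal G +>\<^bsub>env_alg G\<^esub> env_incl G x"

definition renv_plus ::
    "('k::field, 'g, 'z) restricted_lie_super_scheme \<Rightarrow> ('k, ('k, 'g) free_poly set set) superspace"
  where "renv_plus G =
    sub_superspace (renv_alg G) (Idl\<^bsub>renv_alg G\<^esub> (renv_incl G ` carrier G))"

text \<open>
  The action on a \<open>G\<close>-module of the free algebra, of \<open>env_alg G\<close> and, if the module is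
  restricted, of \<open>renv_alg G\<close>. An element of a quotient acts as any of its
  representatives does.
\<close>

definition free_act ::
    "('k::field, 'g, 'v, 'z) gmodule_scheme \<Rightarrow> ('k, 'g) free_poly \<Rightarrow> 'v \<Rightarrow> 'v"
  where "free_act V t v =
    (\<Oplus>\<^bsub>V\<^esub>w\<in>Poly_Mapping.keys t. Poly_Mapping.lookup t w \<odot>\<^bsub>V\<^esub> foldr (act V) (letters w) v)"

definition env_act ::
    "('k::field, 'g, 'v, 'z) gmodule_scheme \<Rightarrow> ('k, 'g) free_poly set \<Rightarrow> 'v \<Rightarrow> 'v"
  where "env_act V A v = the_elem ((\<lambda>t. free_act V t v) ` A)"

definition renv_act ::
    "('k::field, 'g, 'v, 'z) gmodule_scheme \<Rightarrow> ('k, 'g) free_poly set set \<Rightarrow> 'v \<Rightarrow> 'v"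
  where "renv_act V u v = the_elem ((\<lambda>A. env_act V A v) ` u)"


section \<open>First cohomology\<close>

definition Z1 ::
    "('k::field, 'g, 'y) lie_super_scheme \<Rightarrow> ('k, 'g, 'm, 'z) gmodule_scheme \<Rightarrow> ('g \<Rightarrow> 'm) set"
  where "Z1 G M = {f \<in> lin_maps_deg G M 0. \<forall>i j. \<forall>x \<in> part G i. \<forall>y \<in> part G j.
    f (bracket G x y) = act M x (f y) \<ominus>\<^bsub>M\<^esub> koszul i j \<odot>\<^bsub>M\<^esub> act M y (f x)}"

definition B1 ::
    "('k::field, 'g, 'y) lie_super_scheme \<Rightarrow> ('k, 'g, 'm, 'z) gmodule_scheme \<Rightarrow> ('g \<Rightarrow> 'm) set"
  where "B1 G M = {\<lambda>x\<in>carrier G. act M x m | m. m \<in> part M 0}"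

definition H1 ::
    "('k::field, 'g, 'y) lie_super_scheme \<Rightarrow> ('k, 'g, 'm, 'z) gmodule_scheme \<Rightarrow>
     ('k, ('g \<Rightarrow> 'm) set) module"
  where "H1 G M = quot_module ((hom_space G M)\<lparr>carrier := Z1 G M\<rparr>) (B1 G M)"

definition Z1_res ::
    "('k::field, 'g, 'y) restricted_lie_super_scheme \<Rightarrow> ('k, 'g, 'm, 'z) gmodule_scheme \<Rightarrow>
     (('k, 'g) free_poly set set \<Rightarrow> 'm) set"
  where "Z1_res G M = {f \<in> lin_maps_deg (renv_plus G) M 0.
    \<forall>u \<in> carrier (renv_plus G). \<forall>v \<in> carrier (renv_plus G).
      f (u \<otimes>\<^bsub>renv_plus G\<^esub> v) = renv_act M u (f v)}"

definition B1_res ::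
    "('k::field, 'g, 'y) restricted_lie_super_scheme \<Rightarrow> ('k, 'g, 'm, 'z) gmodule_scheme \<Rightarrow>
     (('k, 'g) free_poly set set \<Rightarrow> 'm) set"
  where "B1_res G M = {\<lambda>u\<in>carrier (renv_plus G). renv_act M u m | m. m \<in> part M 0}"

definition H1_res ::
    "('k::field, 'g, 'y) restricted_lie_super_scheme \<Rightarrow> ('k, 'g, 'm, 'z) gmodule_scheme \<Rightarrow>
     ('k, (('k, 'g) free_poly set set \<Rightarrow> 'm) set) module"
  where "H1_res G M =
    quot_module ((hom_space (renv_plus G) M)\<lparr>carrier := Z1_res G M\<rparr>) (B1_res G M)"

definition i1 ::
    "('k::field, 'g, 'y) restricted_lie_super_scheme \<Rightarrow> ('k, 'g, 'm, 'z) gmodule_scheme \<Rightarrow>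
     (('k, 'g) free_poly set set \<Rightarrow> 'm) set \<Rightarrow> ('g \<Rightarrow> 'm) set"
  where "i1 G M C =
    (\<Union>f\<in>C. B1 G M +>\<^bsub>hom_space G M\<^esub> (\<lambda>x\<in>carrier G. f (renv_incl G x)))"


section \<open>Extensions\<close>

text \<open>
  An extension of \<open>K\<close> by \<open>N\<close> is a triple \<open>(E, \<iota>, \<phi>)\<close>. As \<open>K\<close> and \<open>E\<close> have different
  element types, the inclusion of \<open>K\<close> in \<open>E\<close> is the injective homomorphism \<open>\<iota>\<close>.
  The elements of \<open>E\<close> are taken from an arbitrary type \<^typ>\<open>'e\<close>. Since \<open>E\<close> is equipotent
  to \<open>carrier K \<times> carrier N\<close>, a type into which this set embeds contains a
  representative of every equivalence class.
\<close>

type_synonym ('k, 'g, 'v, 'w, 'e) extension =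
  "('k, 'g, 'e) gmodule \<times> ('v \<Rightarrow> 'e) \<times> ('e \<Rightarrow> 'w)"

definition extensions ::
    "('k::field, 'g, 'x) lie_super_scheme \<Rightarrow> ('k, 'g, 'v) gmodule \<Rightarrow> ('k, 'g, 'w) gmodule \<Rightarrow>
     ('k, 'g, 'v, 'w, 'e) extension set"
  where "extensions G K N = {(E, \<iota>, \<phi>). gmodule G E \<and>
    \<iota> \<in> gmod_homs G K E \<and> inj_on \<iota> (carrier K) \<and>
    \<phi> \<in> gmod_homs G E N \<and> \<phi> ` carrier E = carrier N \<and>
    \<iota> ` carrier K = {e \<in> carrier E. \<phi> e = \<zero>\<^bsub>N\<^esub>}}"

definition res_extensions ::
    "('k::field, 'g, 'x) restricted_lie_super_scheme \<Rightarrow> ('k, 'g, 'v) gmodule \<Rightarrow>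
     ('k, 'g, 'w) gmodule \<Rightarrow> ('k, 'g, 'v, 'w, 'e) extension set"
  where "res_extensions G K N = {(E, \<iota>, \<phi>) \<in> extensions G K N. restricted_gmodule G E}"

fun ext_equiv ::
    "('k::field, 'g, 'x) lie_super_scheme \<Rightarrow> ('k, 'g, 'v) gmodule \<Rightarrow>
     ('k, 'g, 'v, 'w, 'e) extension \<Rightarrow> ('k, 'g, 'v, 'w, 'f) extension \<Rightarrow> bool"
  where "ext_equiv G K (E, \<iota>, \<phi>) (E', \<iota>', \<phi>') \<longleftrightarrow>
    (\<exists>\<alpha> \<in> gmod_homs G E E'. bij_betw \<alpha> (carrier E) (carrier E') \<and>
       (\<forall>a \<in> carrier K. \<alpha> (\<iota> a) = \<iota>' a) \<and> (\<forall>e \<in> carrier E. \<phi>' (\<alpha> e) = \<phi> e))"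

definition ext_rel ::
    "('k::field, 'g, 'x) lie_super_scheme \<Rightarrow> ('k, 'g, 'v) gmodule \<Rightarrow>
     ('k, 'g, 'v, 'w, 'e) extension set \<Rightarrow>
     (('k, 'g, 'v, 'w, 'e) extension \<times> ('k, 'g, 'v, 'w, 'e) extension) set"
  where "ext_rel G K S = {(\<xi>, \<eta>). \<xi> \<in> S \<and> \<eta> \<in> S \<and> ext_equiv G K \<xi> \<eta>}"

definition split_ext ::
    "('k::field, 'g, 'v) gmodule \<Rightarrow> ('k, 'g, 'w) gmodule \<Rightarrow> ('k, 'g, 'v, 'w, 'v \<times> 'w) extension"
  where "split_ext K N =
    (direct_sum K N, (\<lambda>a\<in>carrier K. (a, \<zero>\<^bsub>N\<^esub>)), (\<lambda>e\<in>carrier (direct_sum K N). snd e))"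

text \<open>
  The Baer sum is the fibre product of the two extensions over \<open>N\<close> divided by the
  antidiagonal copy of \<open>K\<close>.
\<close>

definition fibre_product ::
    "('k::field, 'g, 'e) gmodule \<Rightarrow> ('e \<Rightarrow> 'w) \<Rightarrow> ('k, 'g, 'f) gmodule \<Rightarrow> ('f \<Rightarrow> 'w) \<Rightarrow>
     ('k, 'g, 'e \<times> 'f) gmodule"
  where "fibre_product E \<phi> F \<psi> =
    sub_superspace (direct_sum E F) {(a, b). a \<in> carrier E \<and> b \<in> carrier F \<and> \<phi> a = \<psi> b}"

fun baer_sum ::
    "('k::field, 'g, 'v) gmodule \<Rightarrow> ('k, 'g, 'v, 'w, 'e) extension \<Rightarrow>
     ('k, 'g, 'v, 'w, 'e) extension \<Rightarrow> ('k, 'g, 'v, 'w, ('e \<times> 'e) set) extension"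
  where "baer_sum K (E\<^sub>1, \<iota>\<^sub>1, \<phi>\<^sub>1) (E\<^sub>2, \<iota>\<^sub>2, \<phi>\<^sub>2) =
    (let P = fibre_product E\<^sub>1 \<phi>\<^sub>1 E\<^sub>2 \<phi>\<^sub>2;
         D = (\<lambda>a. (\<iota>\<^sub>1 a, \<ominus>\<^bsub>E\<^sub>2\<^esub> \<iota>\<^sub>2 a)) ` carrier K;
         E = quot_gmodule P D
     in (E, (\<lambda>a\<in>carrier K. D +>\<^bsub>P\<^esub> (\<iota>\<^sub>1 a, \<zero>\<^bsub>E\<^sub>2\<^esub>)),
         (\<lambda>A\<in>carrier E. the_elem ((\<lambda>e. \<phi>\<^sub>1 (fst e)) ` A))))"

text \<open>
  The multiple of an extension by \<open>c\<close> is its pullback along \<open>c\<cdot>id\<^sub>N\<close>, which is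
  equivalent to its pushout along \<open>c\<cdot>id\<^sub>K\<close>.
\<close>

fun scale_ext ::
    "('k::field, 'g, 'v) gmodule \<Rightarrow> ('k, 'g, 'w) gmodule \<Rightarrow> 'k \<Rightarrow>
     ('k, 'g, 'v, 'w, 'e) extension \<Rightarrow> ('k, 'g, 'v, 'w, 'w \<times> 'e) extension"
  where "scale_ext K N c (E, \<iota>, \<phi>) =
    (let P = fibre_product N (\<lambda>b. c \<odot>\<^bsub>N\<^esub> b) E \<phi>
     in (P, (\<lambda>a\<in>carrier K. (\<zero>\<^bsub>N\<^esub>, \<iota> a)), (\<lambda>e\<in>carrier P. fst e)))"

text \<open>
  The constructions above change the element type, so the class of the result consists
  of those extensions in \<open>S\<close> that are equivalent to it.
\<close>

definition ext_space ::
    "('k::field, 'g, 'x) lie_super_scheme \<Rightarrow> ('k, 'g, 'v) gmodule \<Rightarrow> ('k, 'g, 'w) gmodule \<Rightarrow>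
     ('k, 'g, 'v, 'w, 'e) extension set \<Rightarrow> ('k, ('k, 'g, 'v, 'w, 'e) extension set) module"
  where "ext_space G K N S =
    \<lparr>carrier = S // ext_rel G K S, monoid.mult = undefined, one = undefined,
     zero = {\<xi> \<in> S. ext_equiv G K \<xi> (split_ext K N)},
     add = (\<lambda>C D. {\<xi> \<in> S. \<exists>\<eta> \<in> C. \<exists>\<zeta> \<in> D. ext_equiv G K \<xi> (baer_sum K \<eta> \<zeta>)}),
     module.smult = (\<lambda>c C. {\<xi> \<in> S. \<exists>\<eta> \<in> C. ext_equiv G K \<xi> (scale_ext K N c \<eta>)})\<rparr>"

definition Ext ::
    "('k::field, 'g, 'x) lie_super_scheme \<Rightarrow> ('k, 'g, 'v) gmodule \<Rightarrow> ('k, 'g, 'w) gmodule \<Rightarrow>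
     ('k, ('k, 'g, 'v, 'w, 'e) extension set) module"
  where "Ext G K N = ext_space G K N (extensions G K N)"

definition Ext_res ::
    "('k::field, 'g, 'x) restricted_lie_super_scheme \<Rightarrow> ('k, 'g, 'v) gmodule \<Rightarrow>
     ('k, 'g, 'w) gmodule \<Rightarrow> ('k, ('k, 'g, 'v, 'w, 'e) extension set) module"
  where "Ext_res G K N = ext_space G K N (res_extensions G K N)"

definition i2 ::
    "('k::field, 'g, 'x) lie_super_scheme \<Rightarrow> ('k, 'g, 'v) gmodule \<Rightarrow> ('k, 'g, 'w) gmodule \<Rightarrow>
     ('k, 'g, 'v, 'w, 'e) extension set \<Rightarrow> ('k, 'g, 'v, 'w, 'e) extension set"
  where "i2 G K N C = ext_rel G K (extensions G K N) `` C"

definition even_sections ::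
    "('k::field, 'g, 'w) gmodule \<Rightarrow> ('k, 'g, 'v, 'w, 'e) extension \<Rightarrow> ('w \<Rightarrow> 'e) set"
  where "even_sections N \<xi> = (case \<xi> of (E, \<iota>, \<phi>) \<Rightarrow>
    {\<sigma> \<in> lin_maps_deg N E 0. \<forall>a \<in> carrier N. \<phi> (\<sigma> a) = a})"

definition ext_cocycle ::
    "('k::field, 'g, 'x) lie_super_scheme \<Rightarrow> ('k, 'g, 'v) gmodule \<Rightarrow> ('k, 'g, 'w) gmodule \<Rightarrow>
     ('k, 'g, 'v, 'w, 'e) extension \<Rightarrow> ('w \<Rightarrow> 'e) \<Rightarrow> 'g \<Rightarrow> 'w \<Rightarrow> 'v"
  where "ext_cocycle G K N \<xi> \<sigma> = (case \<xi> of (E, \<iota>, \<phi>) \<Rightarrow>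
    \<lambda>x\<in>carrier G. \<lambda>a\<in>carrier N.
      inv_into (carrier K) \<iota> (act E x (\<sigma> a) \<ominus>\<^bsub>E\<^esub> \<sigma> (act N x a)))"

text \<open>
  The union ranges over all representatives \<open>\<xi>\<close> and all even sections \<open>\<sigma>\<close>; the cocycles
  so obtained are all cohomologous, so it is a single cohomology class.
\<close>

definition F_map ::
    "('k::field, 'g, 'x) lie_super_scheme \<Rightarrow> ('k, 'g, 'v) gmodule \<Rightarrow> ('k, 'g, 'w) gmodule \<Rightarrow>
     ('k, 'g, 'v, 'w, 'e) extension set \<Rightarrow> ('g \<Rightarrow> 'w \<Rightarrow> 'v) set"
  where "F_map G K N C = (let M = hom_gmodule G N K in
    \<Union>\<xi>\<in>C. \<Union>\<sigma>\<in>even_sections N \<xi>. B1 G M +>\<^bsub>hom_space G M\<^esub> ext_cocycle G K N \<xi> \<sigma>)"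

end

theory Submission
  imports Defs
begin

text \<open>
  Choosing an even section \<open>\<sigma>\<close> identifies the extensions with the cocycles \<open>f\<close> on \<open>\<gg>\<close>, up to
  equivalence on one side and coboundaries on the other. In \<open>Hom(N, E)\<close> one has
  \<open>x\<cdot>\<sigma> = \<iota> f(x)\<close>; for even \<open>x\<close> the action on this space is \<open>L - R\<close> with commuting \<open>L\<close> and \<open>R\<close>, so
  that in characteristic \<open>p\<close> its \<open>p\<close>-th power is \<open>L\<^sup>p - R\<^sup>p\<close>. Evaluated at \<open>\<sigma>\<close>, this shows that
  \<open>E\<close> is restricted iff \<open>f(x\<^bsup>[p]\<^esup>) = x\<^bsup>p-1\<^esup>\<cdot>f(x)\<close> for all even \<open>x\<close>. Precisely these cocycles extend, and
  then uniquely, to cocycles on the augmentation ideal of \<open>u(\<gg>)\<close>: the condition says that the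
  extension of \<open>k\<close> by \<open>M\<close> given by \<open>x\<cdot>(m, c) = (x\<cdot>m + c f(x), 0)\<close> is restricted, and the
  extended cocycle sends \<open>u\<close> to the first component of \<open>u\<cdot>(0, 1)\<close>.
\<close>


section \<open>Superspaces and modules\<close>

text \<open>The formula f(x_1 ... x_n) = x_1 ... x_(n-1) . f(x_n) extends a cocycle to words, but
  says nothing about the relations of \<open>renv_alg G\<close>. Reading the extended cocycle off
  from a module removes the question: the enveloping algebra acts on every restricted module, so all
  relations are respected at once, and the formula is only needed for uniqueness. The exponent p - 1
  arises because one of the p factors x is spent on turning \<sigma> into \<iota> f(x). The other
  obstacle is the element types: Baer sums and multiples leave the type of the given extensions, and
  \<open>F_map\<close> and \<open>i1\<close> are unions over representatives. All comparisons
  therefore go through \<open>cocycles\<close>, the set of cocycles for all sections, whose type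
  does not mention E. It is a full coset of \<open>B1\<close> and determines the equivalence class,
  so a class of extensions becomes one set of functions. The Baer structure is then never analysed
  by itself: it suffices that some section of the sum, or of the multiple, has the sum, or the
  multiple, as its cocycle.\<close>

lemma scalars_simps [simp]:
  "carrier scalars = UNIV" "monoid.mult scalars a b = a * b" "one scalars = 1"
  "ring.zero scalars = 0" "add scalars a b = a + b"
  by (simp_all add: ring_of_type_algebra_def)

lemma a_inv_scalars [simp]: "a_inv scalars a = - (a :: 'k::field)"
proof -
  interpret cring "scalars :: 'k ring" by (rule cring_from_type_algebra)
  show ?thesis
    using minus_equality[of "- a" a] by simp
qed

lemma bit_cases: "i = 0 \<or> i = (1::bit)"
  by (cases i) auto

lemma bit_UNIV: "(UNIV :: bit set) = {0, 1}"
  using bit_cases by auto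

text \<open>Degrees are computed by the laws of addition, which rewriting sums to \<open>XOR\<close>
  would hide.\<close>

declare add_bit_eq_xor [simp del]

lemma bit_one_one [simp]: "1 + 1 = (0::bit)" "i + i = (0::bit)"
  by (cases i; simp add: add_bit_eq_xor)+

lemma bit_add_add [simp]: "i + (i + j) = (j::bit)" "i + j + j = i"
  by (cases i; cases j; simp add: add_bit_eq_xor)+

lemma koszul_zero [simp]: "koszul 0 j = 1" "koszul i 0 = 1"
  by (simp_all add: koszul_def)

section \<open>Differences and cosets in abelian groups\<close>

context abelian_group
begin

text \<open>A counterpart of \<open>algebra_simps\<close> for groups with a carrier: differences are
  pulled outwards and cleared from equations, which leaves equations between sums, decided by
  associativity and commutativity.\<close>

lemma group_simps:
  "\<lbrakk>x \<in> carrier G; y \<in> carrier G; z \<in> carrier G\<rbrakk> \<Longrightarrow> x \<oplus> (y \<ominus> z) = (x \<oplus> y) \<ominus> z"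
  "\<lbrakk>x \<in> carrier G; y \<in> carrier G; z \<in> carrier G\<rbrakk> \<Longrightarrow> (x \<ominus> z) \<oplus> y = (x \<oplus> y) \<ominus> z"
  "\<lbrakk>x \<in> carrier G; y \<in> carrier G; z \<in> carrier G\<rbrakk> \<Longrightarrow> x \<ominus> (y \<ominus> z) = (x \<oplus> z) \<ominus> y"
  "\<lbrakk>x \<in> carrier G; y \<in> carrier G; z \<in> carrier G\<rbrakk> \<Longrightarrow> (x \<ominus> y) \<ominus> z = x \<ominus> (y \<oplus> z)"
  "\<lbrakk>x \<in> carrier G; y \<in> carrier G; z \<in> carrier G\<rbrakk> \<Longrightarrow> x \<ominus> y = z \<longleftrightarrow> x = z \<oplus> y"
  "\<lbrakk>x \<in> carrier G; y \<in> carrier G; z \<in> carrier G\<rbrakk> \<Longrightarrow> z = x \<ominus> y \<longleftrightarrow> z \<oplus> y = x"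
  "\<lbrakk>x \<in> carrier G; y \<in> carrier G\<rbrakk> \<Longrightarrow> \<ominus> x \<oplus> y = y \<ominus> x"
  "\<lbrakk>x \<in> carrier G; y \<in> carrier G\<rbrakk> \<Longrightarrow> x \<oplus> \<ominus> y = x \<ominus> y"
  "\<lbrakk>x \<in> carrier G; y \<in> carrier G\<rbrakk> \<Longrightarrow> x \<ominus> \<ominus> y = x \<oplus> y"
  "\<lbrakk>x \<in> carrier G; y \<in> carrier G\<rbrakk> \<Longrightarrow> \<ominus> (x \<oplus> y) = \<ominus> x \<ominus> y"
  "\<lbrakk>x \<in> carrier G; y \<in> carrier G\<rbrakk> \<Longrightarrow> \<ominus> (x \<ominus> y) = y \<ominus> x"
  "\<lbrakk>x \<in> carrier G; y \<in> carrier G; z \<in> carrier G\<rbrakk> \<Longrightarrow> x \<oplus> y \<oplus> z = x \<oplus> (y \<oplus> z)"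
  "\<lbrakk>x \<in> carrier G; y \<in> carrier G\<rbrakk> \<Longrightarrow> x \<oplus> y = y \<oplus> x"
  "\<lbrakk>x \<in> carrier G; y \<in> carrier G; z \<in> carrier G\<rbrakk> \<Longrightarrow> x \<oplus> (y \<oplus> z) = y \<oplus> (x \<oplus> z)"
proof -
  show "\<lbrakk>x \<in> carrier G; y \<in> carrier G; z \<in> carrier G\<rbrakk> \<Longrightarrow> x \<ominus> y = z \<longleftrightarrow> x = z \<oplus> y"
    "\<lbrakk>x \<in> carrier G; y \<in> carrier G; z \<in> carrier G\<rbrakk> \<Longrightarrow> z = x \<ominus> y \<longleftrightarrow> z \<oplus> y = x"
    by (auto simp: a_minus_def a_assoc l_neg r_neg)
qed (simp_all add: a_minus_def minus_add a_ac)

lemma minus_self [simp]: "x \<in> carrier G \<Longrightarrow> x \<ominus> x = \<zero>"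
  "x \<in> carrier G \<Longrightarrow> x \<ominus> \<zero> = x"
  by (simp_all add: a_minus_def r_neg)

lemma minus_eq_zero_iff: "\<lbrakk>x \<in> carrier G; y \<in> carrier G\<rbrakk> \<Longrightarrow> x \<ominus> y = \<zero> \<longleftrightarrow> x = y"
  by (simp add: group_simps)

end

context abelian_subgroup
begin

lemma rcos_eq_iff:
  assumes "a \<in> carrier G" "b \<in> carrier G"
  shows "H +> a = H +> b \<longleftrightarrow> a \<ominus> b \<in> H"
proof
  assume "H +> a = H +> b"
  then have "a \<in> H +> b" using a_rcos_self[OF assms(1)] by simp
  then obtain h where h: "h \<in> H" "a = h \<oplus> b" by (auto simp: a_r_coset_def')
  then have "a \<ominus> b = h" using assms a_Hcarr by (simp add: group_simps)
  with h show "a \<ominus> b \<in> H" by simp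
next
  assume d: "a \<ominus> b \<in> H"
  have "a = (a \<ominus> b) \<oplus> b" using assms by (simp add: group_simps)
  with d have "a \<in> H +> b" by (auto simp: a_r_coset_def')
  then show "H +> a = H +> b" using a_repr_independence' assms by simp
qed

text \<open>Scalars and elements of the Lie superalgebra act on a quotient by a union over all
  representatives. As \<open>g\<close> preserves \<open>H\<close>, all members of such a union are
  the same coset.\<close>

lemma UN_rcos_map:
  assumes g: "\<And>a b. \<lbrakk>a \<in> carrier G; b \<in> carrier G\<rbrakk> \<Longrightarrow> g (a \<oplus> b) = g a \<oplus> g b"
    and closed: "\<And>a. a \<in> carrier G \<Longrightarrow> g a \<in> carrier G" "\<And>a. a \<in> H \<Longrightarrow> g a \<in> H" and e: "e \<in> carrier G"
  shows "(\<Union>a\<in>H +> e. H +> g a) = H +> g e"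
proof -
  have "H +> g a = H +> g e" if a: "a \<in> H +> e" for a
  proof -
    obtain h where h: "h \<in> H" "a = h \<oplus> e" using a by (auto simp: a_r_coset_def')
    have c: "h \<in> carrier G" "g h \<in> H" "g h \<in> carrier G" using h a_Hcarr closed by auto
    then have "g a \<ominus> g e = g h" using h e closed by (simp add: g group_simps)
    then show ?thesis using c h e closed by (simp add: rcos_eq_iff)
  qed
  then have "(\<Union>a\<in>H +> e. H +> g a) = (\<Union>a\<in>H +> e. H +> g e)" by (intro SUP_cong refl)
  also have "\<dots> = H +> g e" using a_rcos_self[OF e] by blast
  finally show ?thesis .
qed

end

section \<open>Homogeneous components\<close>

context superspace
begin

lemma smultC [simp, intro]: "x \<in> carrier V \<Longrightarrow> c \<odot> x \<in> carrier V"
  using smult_closed[of c x] by simp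

lemma smult_simps:
  "x \<in> carrier V \<Longrightarrow> (a + b) \<odot> x = a \<odot> x \<oplus> b \<odot> x"
  "\<lbrakk>x \<in> carrier V; y \<in> carrier V\<rbrakk> \<Longrightarrow> a \<odot> (x \<oplus> y) = a \<odot> x \<oplus> a \<odot> y"
  "x \<in> carrier V \<Longrightarrow> (a * b) \<odot> x = a \<odot> (b \<odot> x)"
  "x \<in> carrier V \<Longrightarrow> a \<odot> (\<ominus> x) = \<ominus> (a \<odot> x)"
  "\<lbrakk>x \<in> carrier V; y \<in> carrier V\<rbrakk> \<Longrightarrow> a \<odot> (x \<ominus> y) = a \<odot> x \<ominus> a \<odot> y"
  using smult_l_distr[of a b x] smult_r_distr[of a x y] smult_assoc1[of a b x]
    smult_r_minus[of a x] smult_r_minus[of a y] smult_r_distr[of a x "\<ominus> y"] by (auto simp: a_minus_def)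

lemma smult_consts [simp]:
  "x \<in> carrier V \<Longrightarrow> 1 \<odot> x = x"
  "x \<in> carrier V \<Longrightarrow> 0 \<odot> x = \<zero>"
  "x \<in> carrier V \<Longrightarrow> (- a) \<odot> x = \<ominus> (a \<odot> x)"
  "a \<odot> \<zero> = \<zero>"
  using smult_one[of x] smult_l_null[of x] smult_r_null[of a] smult_l_minus[of a x] by auto

lemma neg_zero [simp]: "\<ominus> \<zero> = \<zero>"
  by (rule minus_equality) simp_all

lemma smult_left_commute:
  "x \<in> carrier V \<Longrightarrow> a \<odot> (b \<odot> x) = b \<odot> (a \<odot> x)"
  by (metis smult_simps(3) mult.commute)

lemma part_carrier: "x \<in> part V i \<Longrightarrow> x \<in> carrier V"
  using submoduleE(1)[OF part_submodule] by auto

lemma part_closed [simp, intro]: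
  "\<lbrakk>x \<in> part V i; y \<in> part V i\<rbrakk> \<Longrightarrow> x \<oplus> y \<in> part V i"
  "x \<in> part V i \<Longrightarrow> c \<odot> x \<in> part V i"
  "x \<in> part V i \<Longrightarrow> \<ominus> x \<in> part V i"
  "\<lbrakk>x \<in> part V i; y \<in> part V i\<rbrakk> \<Longrightarrow> x \<ominus> y \<in> part V i"
  "\<zero> \<in> part V i"
proof -
  note E = submoduleE[OF part_submodule[of i]]
  show 1: "\<And>x y. \<lbrakk>x \<in> part V i; y \<in> part V i\<rbrakk> \<Longrightarrow> x \<oplus> y \<in> part V i"
    and 2: "x \<in> part V i \<Longrightarrow> c \<odot> x \<in> part V i"
    and 3: "\<And>x. x \<in> part V i \<Longrightarrow> \<ominus> x \<in> part V i"
    using E by auto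
  show "\<lbrakk>x \<in> part V i; y \<in> part V i\<rbrakk> \<Longrightarrow> x \<ominus> y \<in> part V i"
    using 1 3 by (simp add: a_minus_def)
  show "\<zero> \<in> part V i"
    using E(2) 1 3 part_carrier by (metis ex_in_conv r_neg)
qed

text \<open>Both x + 0 and 0 + x decompose x, and the decomposition is unique.\<close>

lemma part_disjoint:
  assumes "x \<in> part V i" "x \<in> part V j" "i \<noteq> j"
  shows "x = \<zero>"
proof -
  have x: "x \<in> part V 0" "x \<in> part V 1" using assms bit_cases[of i] bit_cases[of j] by auto
  have "x \<in> carrier V" using x part_carrier by auto
  then show ?thesis
    using part_direct_sum[of x] x by (metis fst_conv snd_conv part_closed(5) l_zero r_zero)
qed

lemma decompose:
  assumes "v \<in> carrier V"
  obtains a b where "a \<in> part V i" "b \<in> part V (i + 1)" "v = a \<oplus> b"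
proof -
  obtain ab where ab: "fst ab \<in> part V 0" "snd ab \<in> part V 1" "v = fst ab \<oplus> snd ab"
    using part_direct_sum[OF assms] by auto
  then have "v = snd ab \<oplus> fst ab" using part_carrier a_comm by metis
  with ab that show thesis using bit_cases[of i] by auto
qed

text \<open>Two decompositions of the same vector differ by an element of both parts, which is zero.
  This evaluates the definite description in \<open>component\<close>.\<close>

lemma component_eqI:
  assumes "a \<in> part V i" "b \<in> part V (i + 1)"
  shows "component V i (a \<oplus> b) = a"
  unfolding component_def
proof (rule the_equality)
  show "a \<in> part V i \<and> (\<exists>b'\<in>part V (i + 1). a \<oplus> b = a \<oplus> b')" using assms by auto
next
  fix a' assume "a' \<in> part V i \<and> (\<exists>b'\<in>part V (i + 1). a \<oplus> b = a' \<oplus> b')"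
  then obtain b' where b: "a' \<in> part V i" "b' \<in> part V (i + 1)" "a \<oplus> b = a' \<oplus> b'" by auto
  note c = part_carrier[OF b(1)] part_carrier[OF b(2)] part_carrier[OF assms(1)] part_carrier[OF assms(2)]
  have "a' \<ominus> a = b \<ominus> b'" using b(3) c by (simp add: group_simps)
  then have "a' \<ominus> a = \<zero>"
    using assms b part_closed(4) part_disjoint[of _ i "i + 1"]
    by (metis add_cancel_left_right zero_neq_one)
  then show "a' = a" using c by (simp add: minus_eq_zero_iff)
qed

lemma component_in_part [simp, intro]: "v \<in> carrier V \<Longrightarrow> component V i v \<in> part V i"
  using component_eqI by (metis decompose)

lemma component_in_carrier [simp, intro]: "v \<in> carrier V \<Longrightarrow> component V i v \<in> carrier V"
  using part_carrier by blast

lemma component_sum: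
  assumes "v \<in> carrier V" shows "component V i v \<oplus> component V (i + 1) v = v"
proof -
  obtain a b where ab: "a \<in> part V i" "b \<in> part V (i + 1)" "v = a \<oplus> b" using decompose assms by blast
  then have "v = b \<oplus> a" using part_carrier a_comm by metis
  with ab show ?thesis
    using component_eqI[of a i b] component_eqI[of b "i + 1" a] by (metis bit_add_add(2))
qed

lemma component_part: "v \<in> part V i \<Longrightarrow> component V j v = (if i = j then v else \<zero>)"
  using component_eqI[of v i \<zero>] component_eqI[of \<zero> j v] part_carrier bit_cases[of i] bit_cases[of j]
  by auto

lemma component_zero [simp]: "component V i \<zero> = \<zero>"
  using component_part[of \<zero> i i] by simp

lemma component_add:
  assumes "v \<in> carrier V" "w \<in> carrier V"
  shows "component V i (v \<oplus> w) = component V i v \<oplus> component V i w"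
proof -
  have "v \<oplus> w = (component V i v \<oplus> component V (i + 1) v) \<oplus> (component V i w \<oplus> component V (i + 1) w)"
    using assms component_sum by simp
  also have "\<dots> = (component V i v \<oplus> component V i w) \<oplus> (component V (i + 1) v \<oplus> component V (i + 1) w)"
    using assms by (simp add: group_simps)
  finally show ?thesis using assms component_eqI by simp
qed

lemma component_smult:
  assumes "v \<in> carrier V"
  shows "component V i (c \<odot> v) = c \<odot> component V i v"
proof -
  have "c \<odot> v = c \<odot> (component V i v \<oplus> component V (i + 1) v)"
    using assms component_sum by simp
  also have "\<dots> = c \<odot> component V i v \<oplus> c \<odot> component V (i + 1) v"
    using assms by (simp add: smult_simps)
  finally show ?thesis using assms component_eqI by simp
qed

end

text \<open>All superspaces constructed below are verified by this criterion. It mentions no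
  negatives, since these are supplied by the scalar -1, and it replaces the uniqueness of
  decompositions by a trivial intersection of the two parts.\<close>

lemma superspaceI:
  fixes V :: "('k::field, 'v, 'z) superspace_scheme" (structure)
  assumes add: "\<And>x y. \<lbrakk>x \<in> carrier V; y \<in> carrier V\<rbrakk> \<Longrightarrow> x \<oplus> y \<in> carrier V"
    and zero: "\<zero> \<in> carrier V"
    and smult: "\<And>c x. x \<in> carrier V \<Longrightarrow> c \<odot> x \<in> carrier V"
    and assoc: "\<And>x y z. \<lbrakk>x \<in> carrier V; y \<in> carrier V; z \<in> carrier V\<rbrakk> \<Longrightarrow> x \<oplus> y \<oplus> z = x \<oplus> (y \<oplus> z)"
    and comm: "\<And>x y. \<lbrakk>x \<in> carrier V; y \<in> carrier V\<rbrakk> \<Longrightarrow> x \<oplus> y = y \<oplus> x"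
    and l_zero: "\<And>x. x \<in> carrier V \<Longrightarrow> \<zero> \<oplus> x = x"
    and smult_zero: "\<And>x. x \<in> carrier V \<Longrightarrow> 0 \<odot> x = \<zero>"
    and smult_one: "\<And>x. x \<in> carrier V \<Longrightarrow> 1 \<odot> x = x"
    and smult_l: "\<And>a b x. x \<in> carrier V \<Longrightarrow> (a + b) \<odot> x = a \<odot> x \<oplus> b \<odot> x"
    and smult_r: "\<And>a x y. \<lbrakk>x \<in> carrier V; y \<in> carrier V\<rbrakk> \<Longrightarrow> a \<odot> (x \<oplus> y) = a \<odot> x \<oplus> a \<odot> y"
    and smult_assoc: "\<And>a b x. x \<in> carrier V \<Longrightarrow> (a * b) \<odot> x = a \<odot> (b \<odot> x)"
    and part_sub: "\<And>i. part V i \<subseteq> carrier V"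
    and part_add: "\<And>i x y. \<lbrakk>x \<in> part V i; y \<in> part V i\<rbrakk> \<Longrightarrow> x \<oplus> y \<in> part V i"
    and part_zero: "\<And>i. \<zero> \<in> part V i"
    and part_smult: "\<And>i c x. x \<in> part V i \<Longrightarrow> c \<odot> x \<in> part V i"
    and dec: "\<And>v. v \<in> carrier V \<Longrightarrow> \<exists>a\<in>part V 0. \<exists>b\<in>part V 1. v = a \<oplus> b"
    and disj: "\<And>v. v \<in> part V 0 \<Longrightarrow> v \<in> part V 1 \<Longrightarrow> v = \<zero>"
  shows "superspace V"
proof -
  have neg: "(- 1) \<odot> x \<in> carrier V" "(- 1) \<odot> x \<oplus> x = \<zero>" if "x \<in> carrier V" for x
    using that smult smult_l[of x "- 1" 1] smult_one smult_zero by auto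
  have "abelian_group V"
    using neg by (intro abelian_groupI) (auto simp: add zero assoc l_zero intro: comm)
  then have "module (scalars :: 'k ring) V"
    by (intro moduleI) (use smult smult_l smult_r smult_assoc smult_one in
        \<open>auto intro: cring_from_type_algebra\<close>)
  then interpret module "scalars :: 'k ring" V .
  have inv: "\<ominus> x = (- 1) \<odot> x" if "x \<in> carrier V" for x
    using that neg minus_equality by simp
  show ?thesis
  proof (intro superspace.intro superspace_axioms.intro)
    show "module (scalars :: 'k ring) V" by unfold_locales
  next
    show "submodule (part V i) (scalars :: 'k ring) V" for i
      by (rule submoduleI) (use part_sub part_add part_zero part_smult inv in \<open>auto simp: subset_iff\<close>)
  next
    fix v assume "v \<in> carrier V"
    then obtain a b where ab: "a \<in> part V 0" "b \<in> part V 1" "v = a \<oplus> b" using dec by blast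
    show "\<exists>!ab. fst ab \<in> part V 0 \<and> snd ab \<in> part V 1 \<and> v = fst ab \<oplus> snd ab"
    proof (rule ex1I[of _ "(a, b)"])
      show "fst (a, b) \<in> part V 0 \<and> snd (a, b) \<in> part V 1 \<and> v = fst (a, b) \<oplus> snd (a, b)" using ab by simp
    next
      fix ab' assume a': "fst ab' \<in> part V 0 \<and> snd ab' \<in> part V 1 \<and> v = fst ab' \<oplus> snd ab'"
      have c: "a \<in> carrier V" "b \<in> carrier V" "fst ab' \<in> carrier V" "snd ab' \<in> carrier V"
        using ab a' part_sub by auto
      have eq: "fst ab' \<ominus> a = b \<ominus> snd ab'" using ab a' c by (simp add: M.group_simps)
      have "fst ab' \<ominus> a \<in> part V 0" "b \<ominus> snd ab' \<in> part V 1"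
        using ab a' c part_add part_smult inv by (auto simp: a_minus_def)
      with eq disj have "fst ab' \<ominus> a = \<zero>" "b \<ominus> snd ab' = \<zero>" by auto
      then show "ab' = (a, b)" using c by (auto simp: M.minus_eq_zero_iff prod_eq_iff)
    qed
  qed
qed

lemma additive_map_simps:
  assumes "superspace V" "superspace W" and f: "\<And>x. x \<in> carrier V \<Longrightarrow> f x \<in> carrier W"
    and add: "\<And>x y. \<lbrakk>x \<in> carrier V; y \<in> carrier V\<rbrakk> \<Longrightarrow> f (x \<oplus>\<^bsub>V\<^esub> y) = f x \<oplus>\<^bsub>W\<^esub> f y"
  shows "f \<zero>\<^bsub>V\<^esub> = \<zero>\<^bsub>W\<^esub>"
    and "x \<in> carrier V \<Longrightarrow> f (\<ominus>\<^bsub>V\<^esub> x) = \<ominus>\<^bsub>W\<^esub> f x"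
    and "\<lbrakk>x \<in> carrier V; y \<in> carrier V\<rbrakk> \<Longrightarrow> f (x \<ominus>\<^bsub>V\<^esub> y) = f x \<ominus>\<^bsub>W\<^esub> f y"
proof -
  interpret V: superspace V by fact
  interpret W: superspace W by fact
  show zero: "f \<zero>\<^bsub>V\<^esub> = \<zero>\<^bsub>W\<^esub>"
    using add[of "\<zero>\<^bsub>V\<^esub>" "\<zero>\<^bsub>V\<^esub>"] f by (metis V.zero_closed V.r_zero W.add.r_cancel_one')
  show neg: "f (\<ominus>\<^bsub>V\<^esub> x) = \<ominus>\<^bsub>W\<^esub> f x" if "x \<in> carrier V" for x
    using add[of "\<ominus>\<^bsub>V\<^esub> x" x] that f zero by (simp add: V.l_neg W.minus_equality)
  show "f (x \<ominus>\<^bsub>V\<^esub> y) = f x \<ominus>\<^bsub>W\<^esub> f y" if "x \<in> carrier V" "y \<in> carrier V"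
    using that by (simp add: a_minus_def neg add)
qed

section \<open>Modules over a Lie superalgebra\<close>

context gmodule
begin

text \<open>Closure is not an axiom of \<open>gmodule\<close>: \<open>act_part\<close> yields it for
  homogeneous arguments, and biadditivity extends it.\<close>

lemma act_closed [simp, intro]:
  assumes "x \<in> carrier G" "v \<in> carrier V" shows "act V x v \<in> carrier V"
proof -
  obtain a b where x: "a \<in> part G 0" "b \<in> part G (0 + 1)" "x = a \<oplus>\<^bsub>G\<^esub> b"
    using assms G.decompose by blast
  obtain u w where v: "u \<in> part V 0" "w \<in> part V (0 + 1)" "v = u \<oplus>\<^bsub>V\<^esub> w"
    using assms V.decompose by blast
  have c: "a \<in> carrier G" "b \<in> carrier G" "u \<in> carrier V" "w \<in> carrier V"
    using x v G.part_carrier V.part_carrier by blast+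
  have "act V y t \<in> carrier V" if "y \<in> {a, b}" "t \<in> {u, w}" for y t
    using that x v act_part[THEN V.part_carrier] by blast
  then show ?thesis
    using c x v by (simp add: act_add_left act_add_right)
qed

lemma act_simps [simp]:
  "x \<in> carrier G \<Longrightarrow> act V x \<zero>\<^bsub>V\<^esub> = \<zero>\<^bsub>V\<^esub>"
  "\<lbrakk>x \<in> carrier G; v \<in> carrier V\<rbrakk> \<Longrightarrow> act V x (\<ominus>\<^bsub>V\<^esub> v) = \<ominus>\<^bsub>V\<^esub> act V x v"
  "\<lbrakk>x \<in> carrier G; v \<in> carrier V; w \<in> carrier V\<rbrakk> \<Longrightarrow>
    act V x (v \<ominus>\<^bsub>V\<^esub> w) = act V x v \<ominus>\<^bsub>V\<^esub> act V x w"
  using additive_map_simps[OF V.superspace_axioms V.superspace_axioms, of "act V x"]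
  by (auto simp: act_add_right)

lemma act_zero_left [simp]: "v \<in> carrier V \<Longrightarrow> act V \<zero>\<^bsub>G\<^esub> v = \<zero>\<^bsub>V\<^esub>"
  using additive_map_simps(1)[OF G.superspace_axioms V.superspace_axioms, of "\<lambda>x. act V x v"]
  by (auto simp: act_add_left)

lemma act_pow_closed [simp, intro]:
  "x \<in> carrier G \<Longrightarrow> v \<in> carrier V \<Longrightarrow> (act V x ^^ n) v \<in> carrier V"
  by (induction n) auto

lemma act_pow_simps:
  assumes "x \<in> carrier G"
  shows "\<lbrakk>v \<in> carrier V; w \<in> carrier V\<rbrakk> \<Longrightarrow>
      (act V x ^^ n) (v \<oplus>\<^bsub>V\<^esub> w) = (act V x ^^ n) v \<oplus>\<^bsub>V\<^esub> (act V x ^^ n) w"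
    and "v \<in> carrier V \<Longrightarrow> (act V x ^^ n) (c \<odot>\<^bsub>V\<^esub> v) = c \<odot>\<^bsub>V\<^esub> (act V x ^^ n) v"
  by (induction n) (use assms in \<open>auto simp: act_add_right act_smult_right\<close>)

end

text \<open>The bracket relation is only demanded on homogeneous vectors, because the action on a
  space of maps has a simple formula only there. It is written as a sum so that no negatives have to
  be computed in the constructed module.\<close>

lemma gmoduleI:
  fixes G :: "('k::field, 'g, 'y) lie_super_scheme" and V :: "('k, 'g, 'v, 'z) gmodule_scheme"
  assumes "lie_superalgebra G" "superspace V"
    and add_left: "\<And>x y v. \<lbrakk>x \<in> carrier G; y \<in> carrier G; v \<in> carrier V\<rbrakk> \<Longrightarrow>
      act V (x \<oplus>\<^bsub>G\<^esub> y) v = act V x v \<oplus>\<^bsub>V\<^esub> act V y v"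
    and add_right: "\<And>x v w. \<lbrakk>x \<in> carrier G; v \<in> carrier V; w \<in> carrier V\<rbrakk> \<Longrightarrow>
      act V x (v \<oplus>\<^bsub>V\<^esub> w) = act V x v \<oplus>\<^bsub>V\<^esub> act V x w"
    and smult_left: "\<And>c x v. \<lbrakk>x \<in> carrier G; v \<in> carrier V\<rbrakk> \<Longrightarrow>
      act V (c \<odot>\<^bsub>G\<^esub> x) v = c \<odot>\<^bsub>V\<^esub> act V x v"
    and smult_right: "\<And>c x v. \<lbrakk>x \<in> carrier G; v \<in> carrier V\<rbrakk> \<Longrightarrow>
      act V x (c \<odot>\<^bsub>V\<^esub> v) = c \<odot>\<^bsub>V\<^esub> act V x v"
    and act_part: "\<And>i j x v. \<lbrakk>x \<in> part G i; v \<in> part V j\<rbrakk> \<Longrightarrow> act V x v \<in> part V (i + j)"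
    and bracket: "\<And>i j l x y v. \<lbrakk>x \<in> part G i; y \<in> part G j; v \<in> part V l\<rbrakk> \<Longrightarrow>
      act V (bracket G x y) v \<oplus>\<^bsub>V\<^esub> koszul i j \<odot>\<^bsub>V\<^esub> act V y (act V x v) = act V x (act V y v)"
  shows "gmodule G V"
proof -
  interpret G: lie_superalgebra G by fact
  interpret V: superspace V by fact
  have closed: "act V x v \<in> carrier V" if h: "x \<in> carrier G" "v \<in> carrier V" for x v
  proof -
    obtain a b where x: "a \<in> part G 0" "b \<in> part G (0 + 1)" "x = a \<oplus>\<^bsub>G\<^esub> b"
      using h G.decompose by blast
    obtain u w where v: "u \<in> part V 0" "w \<in> part V (0 + 1)" "v = u \<oplus>\<^bsub>V\<^esub> w"
      using h V.decompose by blast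
    have c: "a \<in> carrier G" "b \<in> carrier G" "u \<in> carrier V" "w \<in> carrier V"
      using x v G.part_carrier V.part_carrier by blast+
    have "act V y t \<in> carrier V" if "y \<in> {a, b}" "t \<in> {u, w}" for y t
      using that x v act_part[THEN V.part_carrier] by blast
    then show ?thesis
      using c x v by (simp add: add_left add_right)
  qed
  show ?thesis
  proof (intro gmodule.intro gmodule_axioms.intro assms(1,2) add_left add_right smult_left smult_right act_part)
    fix x y v i j assume xy: "x \<in> part G i" "y \<in> part G j" and v: "v \<in> carrier V"
    obtain u w where uw: "u \<in> part V 0" "w \<in> part V (0 + 1)" "v = u \<oplus>\<^bsub>V\<^esub> w"
      using v V.decompose by blast
    note c = G.part_carrier[OF xy(1)] G.part_carrier[OF xy(2)] V.part_carrier[OF uw(1)]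
      V.part_carrier[OF uw(2)] G.part_carrier[OF G.bracket_part[OF xy]]
    have "act V (bracket G x y) v \<oplus>\<^bsub>V\<^esub> koszul i j \<odot>\<^bsub>V\<^esub> act V y (act V x v) =
      (act V (bracket G x y) u \<oplus>\<^bsub>V\<^esub> koszul i j \<odot>\<^bsub>V\<^esub> act V y (act V x u)) \<oplus>\<^bsub>V\<^esub>
      (act V (bracket G x y) w \<oplus>\<^bsub>V\<^esub> koszul i j \<odot>\<^bsub>V\<^esub> act V y (act V x w))"
      using c uw closed by (simp add: add_right V.smult_simps V.group_simps)
    also have "\<dots> = act V x (act V y u) \<oplus>\<^bsub>V\<^esub> act V x (act V y w)"
      using bracket xy uw by simp
    also have "\<dots> = act V x (act V y v)" using c uw closed by (simp add: add_right)
    finally show "act V (bracket G x y) v =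
        act V x (act V y v) \<ominus>\<^bsub>V\<^esub> koszul i j \<odot>\<^bsub>V\<^esub> act V y (act V x v)"
      using c v closed by (simp add: V.group_simps)
  qed auto
qed

lemma (in gmodule) act_bracket_add:
  assumes "x \<in> part G i" "y \<in> part G j" "v \<in> carrier V"
  shows "act V (bracket G x y) v \<oplus>\<^bsub>V\<^esub> koszul i j \<odot>\<^bsub>V\<^esub> act V y (act V x v) = act V x (act V y v)"
  using act_bracket[OF assms] G.part_carrier[OF assms(1)] G.part_carrier[OF assms(2)]
    G.part_carrier[OF G.bracket_part[OF assms(1,2)]] assms(3)
  by (simp add: V.group_simps)

text \<open>Covers quotients, where \<open>q\<close> is the projection to cosets, and transport
  along an injection into another type. Apart from compatibility with the operations only
  \<open>ker\<close> matters: the kernel of \<open>q\<close> has to be graded, or else the images of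
  the two parts could meet.\<close>

lemma gmodule_surj_image:
  fixes W :: "('k::field, 'g, 'w, 'z) gmodule_scheme"
  assumes "gmodule G V"
    and car: "carrier W = q ` carrier V"
    and zero: "\<zero>\<^bsub>W\<^esub> = q \<zero>\<^bsub>V\<^esub>"
    and add: "\<And>x y. \<lbrakk>x \<in> carrier V; y \<in> carrier V\<rbrakk> \<Longrightarrow> q x \<oplus>\<^bsub>W\<^esub> q y = q (x \<oplus>\<^bsub>V\<^esub> y)"
    and smult: "\<And>c x. x \<in> carrier V \<Longrightarrow> c \<odot>\<^bsub>W\<^esub> q x = q (c \<odot>\<^bsub>V\<^esub> x)"
    and act: "\<And>x v. \<lbrakk>x \<in> carrier G; v \<in> carrier V\<rbrakk> \<Longrightarrow> act W x (q v) = q (act V x v)"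
    and part: "\<And>i. part W i = q ` part V i"
    and ker: "\<And>v. \<lbrakk>v \<in> carrier V; q v = q \<zero>\<^bsub>V\<^esub>\<rbrakk> \<Longrightarrow> q (component V 0 v) = q \<zero>\<^bsub>V\<^esub>"
  shows "gmodule G W"
proof -
  interpret gmodule G V by fact
  have sub: "superspace W"
  proof (rule superspaceI)
    show "\<exists>a\<in>part W 0. \<exists>b\<in>part W 1. w = a \<oplus>\<^bsub>W\<^esub> b" if "w \<in> carrier W" for w
    proof -
      obtain v where v: "v \<in> carrier V" "w = q v" using \<open>w \<in> carrier W\<close> car by auto
      obtain a b where ab: "a \<in> part V 0" "b \<in> part V (0 + 1)" "v = a \<oplus>\<^bsub>V\<^esub> b" using V.decompose[OF v(1)] .
      then have "w = q a \<oplus>\<^bsub>W\<^esub> q b" using v add V.part_carrier by metis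
      with ab show ?thesis by (auto simp: part)
    qed
    show "w = \<zero>\<^bsub>W\<^esub>" if w: "w \<in> part W 0" "w \<in> part W 1" for w
    proof -
      obtain a b where ab: "a \<in> part V 0" "b \<in> part V 1" "w = q a" "w = q b" using w part by auto
      note c = V.part_carrier[OF ab(1)] V.part_carrier[OF ab(2)]
      have m: "(- 1) \<odot>\<^bsub>V\<^esub> b \<in> part V 1" using ab by blast
      \<comment> \<open>The difference a - b lies in the kernel of \<open>q\<close> and has even
        component a, so \<open>ker\<close> gives q a = 0.\<close>
      have "q (a \<oplus>\<^bsub>V\<^esub> (- 1) \<odot>\<^bsub>V\<^esub> b) = q a \<oplus>\<^bsub>W\<^esub> (- 1) \<odot>\<^bsub>W\<^esub> q b" using c add smult by auto
      also have "\<dots> = q (a \<oplus>\<^bsub>V\<^esub> (- 1) \<odot>\<^bsub>V\<^esub> a)"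
        using c ab add[of a "(- 1) \<odot>\<^bsub>V\<^esub> a"] smult[of a "- 1"] by simp
      also have "a \<oplus>\<^bsub>V\<^esub> (- 1) \<odot>\<^bsub>V\<^esub> a = \<zero>\<^bsub>V\<^esub>" using c by (simp add: V.r_neg)
      finally have "q (component V 0 (a \<oplus>\<^bsub>V\<^esub> (- 1) \<odot>\<^bsub>V\<^esub> b)) = q \<zero>\<^bsub>V\<^esub>"
        using ker c by auto
      then show ?thesis using V.component_eqI[of a 0] ab m zero by simp
    qed
  qed (use V.part_carrier in \<open>auto simp: car zero add smult part V.smult_simps V.group_simps\<close>)
  show ?thesis
  proof (rule gmoduleI[OF G.lie_superalgebra_axioms sub])
    show "act W x v \<in> part W (i + j)" if h: "x \<in> part G i" "v \<in> part W j" for x v i j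
    proof -
      obtain u where u: "u \<in> part V j" "v = q u" using h part by auto
      then have "act W x v = q (act V x u)"
        using act[of x u] G.part_carrier[OF h(1)] V.part_carrier[OF u(1)] by simp
      then show ?thesis using act_part[OF h(1) u(1)] part by simp
    qed
    show "act W (bracket G x y) v \<oplus>\<^bsub>W\<^esub> koszul i j \<odot>\<^bsub>W\<^esub> act W y (act W x v) = act W x (act W y v)"
      if h: "x \<in> part G i" "y \<in> part G j" "v \<in> part W l" for i j l x y v
    proof -
      obtain u where u: "u \<in> part V l" "v = q u" using h part by auto
      note c = G.part_carrier[OF h(1)] G.part_carrier[OF h(2)] V.part_carrier[OF u(1)]
        G.part_carrier[OF G.bracket_part[OF h(1,2)]]
      show ?thesis
        using c act_bracket_add[OF h(1,2) c(3)] by (simp add: u act smult add)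
    qed
  qed (auto simp: car add smult act act_add_left act_add_right act_smult_left act_smult_right)
qed

lemma restricted_gmoduleI:
  fixes G :: "('k::field, 'g, 'y) restricted_lie_super_scheme"
  assumes "gmodule G V"
    and "\<And>x v. \<lbrakk>x \<in> part G 0; v \<in> carrier V\<rbrakk> \<Longrightarrow> (act V x ^^ CHAR('k)) v = act V (ppow G x) v"
  shows "restricted_gmodule G V"
  using assms by (simp add: restricted_gmodule_def restricted_gmodule_axioms_def)

lemma gmodule_sub_superspace:
  fixes V :: "('k::field, 'g, 'v, 'z) gmodule_scheme"
  assumes "gmodule G V" "S \<subseteq> carrier V"
    and zero: "\<zero>\<^bsub>V\<^esub> \<in> S"
    and add: "\<And>x y. \<lbrakk>x \<in> S; y \<in> S\<rbrakk> \<Longrightarrow> x \<oplus>\<^bsub>V\<^esub> y \<in> S"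
    and smult: "\<And>c x. x \<in> S \<Longrightarrow> c \<odot>\<^bsub>V\<^esub> x \<in> S"
    and act: "\<And>x v. \<lbrakk>x \<in> carrier G; v \<in> S\<rbrakk> \<Longrightarrow> act V x v \<in> S"
    and comp: "\<And>i v. v \<in> S \<Longrightarrow> component V i v \<in> S"
  shows "gmodule G (sub_superspace V S)"
proof -
  interpret gmodule G V by fact
  have S: "x \<in> carrier V" if "x \<in> S" for x using that assms(2) by auto
  have sub: "superspace (sub_superspace V S)"
  proof (rule superspaceI)
    fix v assume "v \<in> carrier (sub_superspace V S)"
    then have v: "v \<in> S" by (simp add: sub_superspace_def)
    show "\<exists>a\<in>part (sub_superspace V S) 0. \<exists>b\<in>part (sub_superspace V S) 1. v = a \<oplus>\<^bsub>sub_superspace V S\<^esub> b"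
      using comp[OF v] S[OF v] V.component_sum[of v 0]
      by (intro bexI[of _ "component V 0 v"] bexI[of _ "component V 1 v"]) (simp_all add: sub_superspace_def)
  next
    fix v assume "v \<in> part (sub_superspace V S) 0" "v \<in> part (sub_superspace V S) 1"
    then show "v = \<zero>\<^bsub>sub_superspace V S\<^esub>"
      using V.part_disjoint[of v 0 1] by (simp add: sub_superspace_def)
  qed (use S in \<open>auto simp: sub_superspace_def zero add smult V.smult_simps V.group_simps\<close>)
  show ?thesis
    by (rule gmoduleI[OF G.lie_superalgebra_axioms sub])
      (use S in \<open>auto simp: sub_superspace_def act act_add_left act_add_right act_smult_left
          act_smult_right act_part act_bracket_add G.part_carrier\<close>)
qed

section \<open>Direct and twisted sums\<close>

definition twisted_sum ::
    "('k::field, 'g, 'v, 'y) gmodule_scheme \<Rightarrow> ('k, 'g, 'w, 'z) gmodule_scheme \<Rightarrow>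
     ('g \<Rightarrow> 'w \<Rightarrow> 'v) \<Rightarrow> ('k, 'g, 'v \<times> 'w) gmodule"
  where "twisted_sum V W b = (direct_sum V W)
    \<lparr>act := \<lambda>x (v, w). (act V x v \<oplus>\<^bsub>V\<^esub> b x w, act W x w)\<rparr>"

lemma direct_sum_simps [simp]:
  "carrier (direct_sum V W) = carrier V \<times> carrier W"
  "\<zero>\<^bsub>direct_sum V W\<^esub> = (\<zero>\<^bsub>V\<^esub>, \<zero>\<^bsub>W\<^esub>)"
  "(v, w) \<oplus>\<^bsub>direct_sum V W\<^esub> (v', w') = (v \<oplus>\<^bsub>V\<^esub> v', w \<oplus>\<^bsub>W\<^esub> w')"
  "c \<odot>\<^bsub>direct_sum V W\<^esub> (v, w) = (c \<odot>\<^bsub>V\<^esub> v, c \<odot>\<^bsub>W\<^esub> w)"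
  "part (direct_sum V W) i = part V i \<times> part W i"
  "act (direct_sum V W) x (v, w) = (act V x v, act W x w)"
  by (simp_all add: direct_sum_def)

lemma twisted_sum_simps [simp]:
  "carrier (twisted_sum V W b) = carrier V \<times> carrier W"
  "\<zero>\<^bsub>twisted_sum V W b\<^esub> = (\<zero>\<^bsub>V\<^esub>, \<zero>\<^bsub>W\<^esub>)"
  "(v, w) \<oplus>\<^bsub>twisted_sum V W b\<^esub> (v', w') = (v \<oplus>\<^bsub>V\<^esub> v', w \<oplus>\<^bsub>W\<^esub> w')"
  "c \<odot>\<^bsub>twisted_sum V W b\<^esub> (v, w) = (c \<odot>\<^bsub>V\<^esub> v, c \<odot>\<^bsub>W\<^esub> w)"
  "part (twisted_sum V W b) i = part V i \<times> part W i"
  "act (twisted_sum V W b) x (v, w) = (act V x v \<oplus>\<^bsub>V\<^esub> b x w, act W x w)"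
  by (simp_all add: twisted_sum_def direct_sum_def)

text \<open>The action on the twisted sum is block triangular with off-diagonal block
  \<open>b\<close>, and \<open>bracket\<close> is the off-diagonal block of the bracket relation,
  that is, the cocycle condition for \<open>b\<close> with values in the maps from \<open>W\<close>
  to \<open>V\<close>. It is used for extensions of \<open>N\<close> by \<open>K\<close> and for the
  extension of the trivial module by a module of coefficients.\<close>

lemma gmodule_twisted_sum:
  assumes "gmodule G V" "gmodule G W"
    and closed: "\<And>x w. \<lbrakk>x \<in> carrier G; w \<in> carrier W\<rbrakk> \<Longrightarrow> b x w \<in> carrier V"
    and add_left: "\<And>x y w. \<lbrakk>x \<in> carrier G; y \<in> carrier G; w \<in> carrier W\<rbrakk> \<Longrightarrow>
      b (x \<oplus>\<^bsub>G\<^esub> y) w = b x w \<oplus>\<^bsub>V\<^esub> b y w"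
    and add_right: "\<And>x w z. \<lbrakk>x \<in> carrier G; w \<in> carrier W; z \<in> carrier W\<rbrakk> \<Longrightarrow>
      b x (w \<oplus>\<^bsub>W\<^esub> z) = b x w \<oplus>\<^bsub>V\<^esub> b x z"
    and smult_left: "\<And>c x w. \<lbrakk>x \<in> carrier G; w \<in> carrier W\<rbrakk> \<Longrightarrow>
      b (c \<odot>\<^bsub>G\<^esub> x) w = c \<odot>\<^bsub>V\<^esub> b x w"
    and smult_right: "\<And>c x w. \<lbrakk>x \<in> carrier G; w \<in> carrier W\<rbrakk> \<Longrightarrow>
      b x (c \<odot>\<^bsub>W\<^esub> w) = c \<odot>\<^bsub>V\<^esub> b x w"
    and part: "\<And>i j x w. \<lbrakk>x \<in> part G i; w \<in> part W j\<rbrakk> \<Longrightarrow> b x w \<in> part V (i + j)"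
    and bracket: "\<And>i j l x y w. \<lbrakk>x \<in> part G i; y \<in> part G j; w \<in> part W l\<rbrakk> \<Longrightarrow>
      b (bracket G x y) w \<oplus>\<^bsub>V\<^esub> koszul i j \<odot>\<^bsub>V\<^esub> (act V y (b x w) \<oplus>\<^bsub>V\<^esub> b y (act W x w)) =
      act V x (b y w) \<oplus>\<^bsub>V\<^esub> b x (act W y w)"
  shows "gmodule G (twisted_sum V W b)"
proof -
  interpret V: gmodule G V by fact
  interpret W: gmodule G W by fact
  have sup: "superspace (twisted_sum V W b)"
  proof (rule superspaceI)
    fix t assume "t \<in> carrier (twisted_sum V W b)"
    then obtain v w where t: "t = (v, w)" "v \<in> carrier V" "w \<in> carrier W" by auto
    show "\<exists>a\<in>part (twisted_sum V W b) 0. \<exists>c\<in>part (twisted_sum V W b) 1. t = a \<oplus>\<^bsub>twisted_sum V W b\<^esub> c"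
      using t V.V.component_sum[of v 0] W.V.component_sum[of w 0]
      by (intro bexI[of _ "(component V 0 v, component W 0 w)"]
          bexI[of _ "(component V 1 v, component W 1 w)"]) simp_all
  next
    fix t assume "t \<in> part (twisted_sum V W b) 0" "t \<in> part (twisted_sum V W b) 1"
    then show "t = \<zero>\<^bsub>twisted_sum V W b\<^esub>"
      using V.V.part_disjoint[of "fst t" 0 1] W.V.part_disjoint[of "snd t" 0 1] by auto
  qed (auto simp: V.V.smult_simps W.V.smult_simps V.V.group_simps W.V.group_simps
        V.V.part_carrier W.V.part_carrier)
  show ?thesis
  proof (rule gmoduleI[OF V.G.lie_superalgebra_axioms sup])
    fix x y t i j l
    assume h: "x \<in> part G i" "y \<in> part G j" "t \<in> part (twisted_sum V W b) l"
    then obtain v w where t: "t = (v, w)" "v \<in> part V l" "w \<in> part W l" by auto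
    note c = V.G.part_carrier[OF h(1)] V.G.part_carrier[OF h(2)] V.V.part_carrier[OF t(2)]
      W.V.part_carrier[OF t(3)] V.G.part_carrier[OF V.G.bracket_part[OF h(1,2)]]
    have "act V (bracket G x y) v \<oplus>\<^bsub>V\<^esub> b (bracket G x y) w \<oplus>\<^bsub>V\<^esub>
        koszul i j \<odot>\<^bsub>V\<^esub> (act V y (act V x v \<oplus>\<^bsub>V\<^esub> b x w) \<oplus>\<^bsub>V\<^esub> b y (act W x w)) =
      (act V (bracket G x y) v \<oplus>\<^bsub>V\<^esub> koszul i j \<odot>\<^bsub>V\<^esub> act V y (act V x v)) \<oplus>\<^bsub>V\<^esub>
      (b (bracket G x y) w \<oplus>\<^bsub>V\<^esub> koszul i j \<odot>\<^bsub>V\<^esub> (act V y (b x w) \<oplus>\<^bsub>V\<^esub> b y (act W x w)))"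
      using c closed by (simp add: V.act_add_right V.V.smult_simps V.V.group_simps)
    also have "\<dots> = act V x (act V y v \<oplus>\<^bsub>V\<^esub> b y w) \<oplus>\<^bsub>V\<^esub> b x (act W y w)"
      using c closed V.act_bracket_add[OF h(1,2) c(3)] bracket[OF h(1,2) t(3)]
      by (simp add: V.act_add_right V.V.group_simps)
    finally show "act (twisted_sum V W b) (bracket G x y) t \<oplus>\<^bsub>twisted_sum V W b\<^esub>
          koszul i j \<odot>\<^bsub>twisted_sum V W b\<^esub> act (twisted_sum V W b) y (act (twisted_sum V W b) x t) =
        act (twisted_sum V W b) x (act (twisted_sum V W b) y t)"
      using W.act_bracket_add[OF h(1,2) c(4)] by (simp add: t)
  next
    fix x t i j assume "x \<in> part G i" "t \<in> part (twisted_sum V W b) j"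
    then show "act (twisted_sum V W b) x t \<in> part (twisted_sum V W b) (i + j)"
      by (auto simp: V.act_part W.act_part part)
  qed (auto simp: add_left add_right smult_left smult_right closed V.act_add_left V.act_add_right
        V.act_smult_left V.act_smult_right W.act_add_left W.act_add_right W.act_smult_left
        W.act_smult_right V.V.smult_simps V.V.group_simps)
qed

text \<open>The direct sum agrees with the twisted sum by 0 on the carrier only, where adding the
  zero of \<open>V\<close> changes nothing; hence the passage through
  \<open>gmodule_surj_image\<close> with the identity.\<close>

lemma gmodule_direct_sum:
  fixes G :: "('k::field, 'g, 'y) lie_super_scheme"
  assumes "gmodule G V" "gmodule G W"
  shows "gmodule G (direct_sum V W)"
proof -
  interpret V: gmodule G V by fact
  interpret W: gmodule G W by fact
  have tw: "gmodule G (twisted_sum V W (\<lambda>x w. \<zero>\<^bsub>V\<^esub>))"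
    by (rule gmodule_twisted_sum[OF assms])
      (auto simp: V.G.part_carrier)
  interpret S: gmodule G "twisted_sum V W (\<lambda>x w. \<zero>\<^bsub>V\<^esub>)" by fact
  show ?thesis
    by (rule gmodule_surj_image[OF tw, where q = id]) (use S.V.component_zero in auto)
qed

lemma superspace_cong:
  fixes V :: "('k::field, 'v, 'y) superspace_scheme" and W :: "('k, 'v, 'z) superspace_scheme"
  assumes "superspace V" and "carrier W = carrier V" "\<zero>\<^bsub>W\<^esub> = \<zero>\<^bsub>V\<^esub>" "add W = add V"
    "module.smult W = module.smult V" "part W = part V"
  shows "superspace W"
proof -
  interpret V: superspace V by fact
  show ?thesis
  proof (rule superspaceI)
    show "\<exists>a\<in>part W 0. \<exists>b\<in>part W 1. v = a \<oplus>\<^bsub>W\<^esub> b" if "v \<in> carrier W" for v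
      using V.decompose[of v 0] that assms(2-) by (metis add_0)
    show "v = \<zero>\<^bsub>W\<^esub>" if "v \<in> part W 0" "v \<in> part W 1" for v
      using V.part_disjoint[of v 0 1] that assms(2-) by simp
  qed (simp_all only: assms(2-) V.a_closed V.zero_closed V.smultC V.smult_simps V.a_assoc V.l_zero V.smult_consts
      V.part_closed V.part_carrier subsetI, simp_all add: V.a_comm)
qed

section \<open>Spaces of linear maps\<close>

lemma hom_space_simps [simp]:
  "carrier (hom_space V W) = lin_maps V W"
  "\<zero>\<^bsub>hom_space V W\<^esub> = (\<lambda>a\<in>carrier V. \<zero>\<^bsub>W\<^esub>)"
  "f \<oplus>\<^bsub>hom_space V W\<^esub> g = (\<lambda>a\<in>carrier V. f a \<oplus>\<^bsub>W\<^esub> g a)"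
  "c \<odot>\<^bsub>hom_space V W\<^esub> f = (\<lambda>a\<in>carrier V. c \<odot>\<^bsub>W\<^esub> f a)"
  "part (hom_space V W) i = lin_maps_deg V W i"
  by (simp_all add: hom_space_def)

lemma hom_gmodule_simps [simp]:
  "carrier (hom_gmodule G V W) = lin_maps V W"
  "\<zero>\<^bsub>hom_gmodule G V W\<^esub> = (\<lambda>a\<in>carrier V. \<zero>\<^bsub>W\<^esub>)"
  "f \<oplus>\<^bsub>hom_gmodule G V W\<^esub> g = (\<lambda>a\<in>carrier V. f a \<oplus>\<^bsub>W\<^esub> g a)"
  "c \<odot>\<^bsub>hom_gmodule G V W\<^esub> f = (\<lambda>a\<in>carrier V. c \<odot>\<^bsub>W\<^esub> f a)"
  "part (hom_gmodule G V W) i = lin_maps_deg V W i"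
  by (simp_all add: hom_gmodule_def hom_space_def superspace.defs)

lemma lin_mapsD:
  assumes "f \<in> lin_maps V W"
  shows "x \<in> carrier V \<Longrightarrow> f x \<in> carrier W"
    and "\<lbrakk>x \<in> carrier V; y \<in> carrier V\<rbrakk> \<Longrightarrow> f (x \<oplus>\<^bsub>V\<^esub> y) = f x \<oplus>\<^bsub>W\<^esub> f y"
    and "x \<in> carrier V \<Longrightarrow> f (c \<odot>\<^bsub>V\<^esub> x) = c \<odot>\<^bsub>W\<^esub> f x"
    and "x \<notin> carrier V \<Longrightarrow> f x = undefined"
  using assms by (auto simp: lin_maps_def)

lemma lin_maps_degD:
  assumes "f \<in> lin_maps_deg V W d"
  shows "f \<in> lin_maps V W" and "x \<in> part V i \<Longrightarrow> f x \<in> part W (d + i)"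
  using assms by (auto simp: lin_maps_deg_def)

lemma lin_mapsI:
  assumes "\<And>x. x \<in> carrier V \<Longrightarrow> f x \<in> carrier W"
    and "\<And>x y. \<lbrakk>x \<in> carrier V; y \<in> carrier V\<rbrakk> \<Longrightarrow> f (x \<oplus>\<^bsub>V\<^esub> y) = f x \<oplus>\<^bsub>W\<^esub> f y"
    and "\<And>c x. x \<in> carrier V \<Longrightarrow> f (c \<odot>\<^bsub>V\<^esub> x) = c \<odot>\<^bsub>W\<^esub> f x"
    and "\<And>x. x \<notin> carrier V \<Longrightarrow> f x = undefined"
  shows "f \<in> lin_maps V W"
  using assms by (auto simp: lin_maps_def extensional_def PiE_def)

lemma lin_maps_degI:
  assumes "f \<in> lin_maps V W" "\<And>i x. x \<in> part V i \<Longrightarrow> f x \<in> part W (d + i)"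
  shows "f \<in> lin_maps_deg V W d"
  using assms by (auto simp: lin_maps_deg_def)

lemma lin_maps_eqI:
  assumes "f \<in> lin_maps V W" "g \<in> lin_maps V W" "\<And>x. x \<in> carrier V \<Longrightarrow> f x = g x"
  shows "f = g"
proof
  show "f x = g x" for x using assms lin_mapsD(4)[of f V W x] lin_mapsD(4)[of g V W x] by (cases "x \<in> carrier V") auto
qed

context
  fixes V :: "('k::field, 'v, 'y) superspace_scheme" and W :: "('k, 'w, 'z) superspace_scheme"
  assumes VW: "superspace V" "superspace W"
begin

interpretation V: superspace V by (fact VW)
interpretation W: superspace W by (fact VW)

lemma lin_maps_zero: "f \<in> lin_maps V W \<Longrightarrow> f \<zero>\<^bsub>V\<^esub> = \<zero>\<^bsub>W\<^esub>"
  by (rule additive_map_simps(1)[OF VW, of f]) (auto dest: lin_mapsD)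

lemma lin_maps_minus:
  "f \<in> lin_maps V W \<Longrightarrow> x \<in> carrier V \<Longrightarrow> y \<in> carrier V \<Longrightarrow> f (x \<ominus>\<^bsub>V\<^esub> y) = f x \<ominus>\<^bsub>W\<^esub> f y"
  "f \<in> lin_maps V W \<Longrightarrow> x \<in> carrier V \<Longrightarrow> f (\<ominus>\<^bsub>V\<^esub> x) = \<ominus>\<^bsub>W\<^esub> f x"
  by (rule additive_map_simps(3)[OF VW, of f] additive_map_simps(2)[OF VW, of f]; auto dest: lin_mapsD)+

text \<open>The homogeneous part of degree \<open>j\<close>: of the four blocks of \<open>f\<close>
  between the parts of \<open>V\<close> and \<open>W\<close>, the two that shift degrees by
  \<open>j\<close> are kept.\<close>

definition hom_part where
  "hom_part j f = (\<lambda>a\<in>carrier V.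
    component W j (f (component V 0 a)) \<oplus>\<^bsub>W\<^esub> component W (j + 1) (f (component V 1 a)))"

lemma hom_part_deg:
  assumes f: "f \<in> lin_maps V W" shows "hom_part j f \<in> lin_maps_deg V W j"
proof (rule lin_maps_degI)
  note fD = lin_mapsD[OF f]
  show "hom_part j f \<in> lin_maps V W"
    by (rule lin_mapsI)
      (auto simp: hom_part_def fD V.component_add W.component_add V.component_smult W.component_smult
        W.smult_simps W.group_simps)
  fix i x assume x: "x \<in> part V i"
  then have c: "x \<in> carrier V" by (rule V.part_carrier)
  have z: "f \<zero>\<^bsub>V\<^esub> = \<zero>\<^bsub>W\<^esub>" by (rule lin_maps_zero[OF f])
  consider "i = 0" | "i = 1" using bit_cases by blast
  then show "hom_part j f x \<in> part W (j + i)"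
    by cases (use x c in \<open>auto simp: hom_part_def V.component_part[OF x] z fD\<close>)
qed

lemma hom_part_sum:
  assumes f: "f \<in> lin_maps V W"
  shows "hom_part j f \<oplus>\<^bsub>hom_space V W\<^esub> hom_part (j + 1) f = f"
proof (rule lin_maps_eqI[OF _ f])
  note fD = lin_mapsD[OF f]
  show *: "(hom_part j f \<oplus>\<^bsub>hom_space V W\<^esub> hom_part (j + 1) f) x = f x" if x: "x \<in> carrier V" for x
  proof -
    let ?a = "component V 0 x" and ?b = "component V 1 x"
    have "(hom_part j f \<oplus>\<^bsub>hom_space V W\<^esub> hom_part (j + 1) f) x =
      (component W j (f ?a) \<oplus>\<^bsub>W\<^esub> component W (j + 1) (f ?a)) \<oplus>\<^bsub>W\<^esub>
      (component W (j + 1) (f ?b) \<oplus>\<^bsub>W\<^esub> component W (j + 1 + 1) (f ?b))"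
      using x fD by (simp add: hom_part_def W.group_simps)
    also have "\<dots> = f x"
      using W.component_sum fD x V.component_sum[OF x, of 0] by (metis V.component_in_carrier add_0)
    finally show ?thesis .
  qed
  show "hom_part j f \<oplus>\<^bsub>hom_space V W\<^esub> hom_part (j + 1) f \<in> lin_maps V W"
    by (rule lin_mapsI) (auto simp: * fD simp del: hom_space_simps, simp)
qed

lemma superspace_hom_space: "superspace (hom_space V W)"
proof (rule superspaceI)
  fix f assume "f \<in> carrier (hom_space V W)"
  then show "\<exists>a\<in>part (hom_space V W) 0. \<exists>b\<in>part (hom_space V W) 1. f = a \<oplus>\<^bsub>hom_space V W\<^esub> b"
    using hom_part_sum[of f 0] hom_part_deg[of f] by (metis add_0 hom_space_simps(1,5))
next
  fix f assume "f \<in> part (hom_space V W) 0" "f \<in> part (hom_space V W) 1"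
  then have f: "f \<in> lin_maps_deg V W 0" "f \<in> lin_maps_deg V W 1" by auto
  note fD = lin_mapsD[OF lin_maps_degD(1)[OF f(1)]]
  have z: "f a = \<zero>\<^bsub>W\<^esub>" if "a \<in> part V i" for a i
    using lin_maps_degD(2)[OF f(1) that] lin_maps_degD(2)[OF f(2) that] W.part_disjoint
    by (metis add_0 add_cancel_right_left zero_neq_one)
  have "f a = \<zero>\<^bsub>W\<^esub>" if a: "a \<in> carrier V" for a
    using V.component_sum[OF a, of 0] z fD(2) V.component_in_part[OF a] V.part_carrier
    by (metis W.l_zero W.zero_closed)
  then show "f = \<zero>\<^bsub>hom_space V W\<^esub>" using fD(4) by (auto simp: fun_eq_iff)
qed (auto simp: lin_maps_deg_def lin_maps_def PiE_iff extensional_def fun_eq_iff image_subset_iff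
      W.smult_simps W.group_simps V.part_carrier W.smult_left_commute)

end

lemma (in abelian_monoid) finsum_bit:
  "\<lbrakk>f 0 \<in> carrier G; f 1 \<in> carrier G\<rbrakk> \<Longrightarrow> (\<Oplus>i\<in>(UNIV :: bit set). f i) = f 0 \<oplus> f 1"
  by (simp add: bit_UNIV)

section \<open>The module of linear maps from N to K\<close>

context
  fixes G :: "('k::field, 'g, 'x) lie_super_scheme"
    and N :: "('k, 'g, 'w, 'y) gmodule_scheme" and K :: "('k, 'g, 'v, 'z) gmodule_scheme"
  assumes NK: "gmodule G N" "gmodule G K"
begin

interpretation N: gmodule G N by (fact NK)
interpretation K: gmodule G K by (fact NK)
interpretation H: superspace "hom_space N K"
  by (rule superspace_hom_space[OF N.V.superspace_axioms K.V.superspace_axioms])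

text \<open>The sign depends on the degree of \<open>m\<close> only for the odd component of
  \<open>x\<close>. Everything else in the double sum adds up to \<open>x\<close> and
  \<open>m\<close> themselves, while for the odd component the two components of \<open>m\<close>
  enter with opposite signs.\<close>

lemma act_hom_gmodule:
  assumes "x \<in> carrier G" "m \<in> lin_maps N K" "a \<in> carrier N"
  shows "act (hom_gmodule G N K) x m a =
    act K x (m a) \<ominus>\<^bsub>K\<^esub> m (act N (component G 0 x) a) \<ominus>\<^bsub>K\<^esub>
      (component (hom_space N K) 0 m (act N (component G 1 x) a) \<ominus>\<^bsub>K\<^esub>
       component (hom_space N K) 1 m (act N (component G 1 x) a))"
proof -
  let ?x = "\<lambda>i. component G i x" and ?m = "\<lambda>i. component (hom_space N K) i m"
  have m: "?m i \<in> lin_maps N K" for i using H.component_in_carrier[of m i] assms by simp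
  note mD = lin_mapsD[OF m]
  have c: "?x i \<in> carrier G" for i using assms by simp
  have msum: "m b = ?m 0 b \<oplus>\<^bsub>K\<^esub> ?m 1 b" if "b \<in> carrier N" for b
    using fun_cong[OF H.component_sum[of m 0], of b] assms(2) that by simp
  have xsum: "act K x b = act K (?x 0) b \<oplus>\<^bsub>K\<^esub> act K (?x 1) b" if "b \<in> carrier K" for b
    using N.G.component_sum[of x 0] K.act_add_left[of "?x 0" "?x 1" b] assms(1) that by simp
  show ?thesis
    using assms c mD
    by (simp add: hom_gmodule_def gmodule.defs superspace.defs K.V.finsum_bit koszul_def msum xsum
        K.act_add_right K.V.group_simps)
qed

lemma act_hom_gmodule_homogeneous:
  assumes "x \<in> part G i" "m \<in> lin_maps_deg N K j" "a \<in> carrier N"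
  shows "act (hom_gmodule G N K) x m a =
    act K x (m a) \<ominus>\<^bsub>K\<^esub> koszul i j \<odot>\<^bsub>K\<^esub> m (act N x a)"
proof -
  have x: "x \<in> carrier G" using assms N.G.part_carrier by blast
  have m: "m \<in> lin_maps N K" using assms lin_maps_degD by blast
  have xc: "component G l x = (if i = l then x else \<zero>\<^bsub>G\<^esub>)" for l by (rule N.G.component_part[OF assms(1)])
  have mc: "component (hom_space N K) l m = (if j = l then m else \<zero>\<^bsub>hom_space N K\<^esub>)" for l
    by (rule H.component_part) (simp add: assms)
  have z: "m \<zero>\<^bsub>N\<^esub> = \<zero>\<^bsub>K\<^esub>" using lin_maps_zero[OF N.V.superspace_axioms K.V.superspace_axioms m] .
  show ?thesis
    using bit_cases[of i] bit_cases[of j] assms(3) x lin_mapsD[OF m]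
    by (auto simp: act_hom_gmodule[OF x m assms(3)] xc mc z koszul_def K.V.group_simps)
qed

text \<open>For even \<open>x\<close> the sign is 1 whatever the degree of \<open>m\<close>, so
  \<open>m\<close> need not be homogeneous. This is the form in which powers of the action are
  computed.\<close>

lemma act_hom_gmodule_even:
  assumes "x \<in> part G 0" "m \<in> lin_maps N K" "a \<in> carrier N"
  shows "act (hom_gmodule G N K) x m a = act K x (m a) \<ominus>\<^bsub>K\<^esub> m (act N x a)"
proof -
  have x: "x \<in> carrier G" using assms N.G.part_carrier by blast
  have xc: "component G l x = (if 0 = l then x else \<zero>\<^bsub>G\<^esub>)" for l by (rule N.G.component_part[OF assms(1)])
  have "component (hom_space N K) l m \<in> lin_maps N K" for l using H.component_in_carrier[of m l] assms by simp
  then have z: "component (hom_space N K) l m \<zero>\<^bsub>N\<^esub> = \<zero>\<^bsub>K\<^esub>" for l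
    using lin_maps_zero[OF N.V.superspace_axioms K.V.superspace_axioms] by blast
  show ?thesis
    using assms(3) x lin_mapsD[OF assms(2)] by (simp add: act_hom_gmodule[OF x assms(2,3)] xc z)
qed

lemma gmodule_hom_gmodule: "gmodule G (hom_gmodule G N K)"
proof (rule gmoduleI)
  let ?M = "hom_gmodule G N K"
  show "lie_superalgebra G" by (rule N.G.lie_superalgebra_axioms)
  show "superspace ?M"
    by (rule superspace_cong[OF H.superspace_axioms]) (auto simp: fun_eq_iff)
  have comp: "component (hom_space N K) i m b \<in> carrier K" if "m \<in> lin_maps N K" "b \<in> carrier N" for i m b
    using H.component_in_carrier[of m i] lin_mapsD(1) that by fastforce
  have comp_add: "component (hom_space N K) i m (b \<oplus>\<^bsub>N\<^esub> c) =
      component (hom_space N K) i m b \<oplus>\<^bsub>K\<^esub> component (hom_space N K) i m c"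
    if "m \<in> lin_maps N K" "b \<in> carrier N" "c \<in> carrier N" for i m b c
    using H.component_in_carrier[of m i] lin_mapsD(2) that by fastforce
  have comp_smult: "component (hom_space N K) i m (s \<odot>\<^bsub>N\<^esub> b) = s \<odot>\<^bsub>K\<^esub> component (hom_space N K) i m b"
    if "m \<in> lin_maps N K" "b \<in> carrier N" for i m b s
    using H.component_in_carrier[of m i] lin_mapsD(3) that by fastforce
  have add_comp: "component (hom_space N K) i (\<lambda>a\<in>carrier N. m a \<oplus>\<^bsub>K\<^esub> n a) b =
      component (hom_space N K) i m b \<oplus>\<^bsub>K\<^esub> component (hom_space N K) i n b"
    if "m \<in> lin_maps N K" "n \<in> lin_maps N K" "b \<in> carrier N" for i m n b
    using H.component_add[of m n i] that by simp
  have smult_comp: "component (hom_space N K) i (\<lambda>a\<in>carrier N. s \<odot>\<^bsub>K\<^esub> m a) b =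
      s \<odot>\<^bsub>K\<^esub> component (hom_space N K) i m b"
    if "m \<in> lin_maps N K" "b \<in> carrier N" for i m b s
    using H.component_smult[of m i s] that by simp
  have undef: "act ?M x m a = undefined" if "a \<notin> carrier N" for x m a
    using that by (simp add: hom_gmodule_def gmodule.defs superspace.defs)
  have act_lin: "act ?M x m \<in> lin_maps N K" if x: "x \<in> carrier G" and m: "m \<in> lin_maps N K" for x m
    by (rule lin_mapsI)
      (use lin_mapsD[OF m] x in \<open>auto simp: undef act_hom_gmodule[OF x m] comp[OF m] comp_add[OF m] comp_smult[OF m]
          N.act_add_right K.act_add_right N.act_smult_right K.act_smult_right K.V.smult_simps K.V.group_simps\<close>)
  have add_lin: "(\<lambda>a\<in>carrier N. m a \<oplus>\<^bsub>K\<^esub> n a) \<in> lin_maps N K"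
    if "m \<in> lin_maps N K" "n \<in> lin_maps N K" for m n
    using H.add.m_closed[of m n] that by simp
  have smult_lin: "(\<lambda>a\<in>carrier N. s \<odot>\<^bsub>K\<^esub> m a) \<in> lin_maps N K" if "m \<in> lin_maps N K" for m s
    using H.smultC[of m s] that by simp
  show "act ?M (x \<oplus>\<^bsub>G\<^esub> y) m = act ?M x m \<oplus>\<^bsub>?M\<^esub> act ?M y m"
    if h: "x \<in> carrier G" "y \<in> carrier G" "m \<in> carrier ?M" for x y m
  proof -
    have m: "m \<in> lin_maps N K" using h by simp
    show ?thesis
      by (rule ext) (use h lin_mapsD[OF m] in \<open>auto simp: undef act_hom_gmodule[OF _ m] comp[OF m] comp_add[OF m]
        N.G.component_add N.act_add_left K.act_add_left K.V.group_simps\<close>)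
  qed
  show "act ?M (s \<odot>\<^bsub>G\<^esub> x) m = s \<odot>\<^bsub>?M\<^esub> act ?M x m"
    if h: "x \<in> carrier G" "m \<in> carrier ?M" for s x m
  proof -
    have m: "m \<in> lin_maps N K" using h by simp
    show ?thesis
      by (rule ext) (use h lin_mapsD[OF m] in \<open>auto simp: undef act_hom_gmodule[OF _ m] comp[OF m] comp_smult[OF m]
        N.G.component_smult N.act_smult_left K.act_smult_left K.V.smult_simps\<close>)
  qed
  show "act ?M x (m \<oplus>\<^bsub>?M\<^esub> n) = act ?M x m \<oplus>\<^bsub>?M\<^esub> act ?M x n"
    if h: "x \<in> carrier G" "m \<in> carrier ?M" "n \<in> carrier ?M" for x m n
  proof -
    have mn: "m \<in> lin_maps N K" "n \<in> lin_maps N K" using h by simp_all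
    show ?thesis
      by (rule ext) (use h lin_mapsD[OF mn(1)] lin_mapsD[OF mn(2)] in \<open>auto simp: undef act_hom_gmodule
        add_lin comp add_comp K.act_add_right K.V.group_simps\<close>)
  qed
  show "act ?M x (s \<odot>\<^bsub>?M\<^esub> m) = s \<odot>\<^bsub>?M\<^esub> act ?M x m"
    if h: "x \<in> carrier G" "m \<in> carrier ?M" for s x m
  proof -
    have m: "m \<in> lin_maps N K" using h by simp
    show ?thesis
      by (rule ext) (use h lin_mapsD[OF m] in \<open>auto simp: undef act_hom_gmodule
        smult_lin comp smult_comp K.act_smult_right K.V.smult_simps\<close>)
  qed
  show deg: "act ?M x m \<in> part ?M (i + j)" if h: "x \<in> part G i" "m \<in> part ?M j" for x m i j
  proof -
    have m: "m \<in> lin_maps_deg N K j" using h by simp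
    note md = lin_maps_degD[OF m]
    have x: "x \<in> carrier G" using h N.G.part_carrier by blast
    have "act ?M x m \<in> lin_maps_deg N K (i + j)"
    proof (rule lin_maps_degI[OF act_lin[OF x md(1)]])
      fix l a assume a: "a \<in> part N l"
      have "act K x (m a) \<in> part K (i + (j + l))" "m (act N x a) \<in> part K (j + (i + l))"
        using K.act_part[OF h(1) md(2)[OF a]] md(2)[OF N.act_part[OF h(1) a]] by simp_all
      then show "act ?M x m a \<in> part K (i + j + l)"
        using act_hom_gmodule_homogeneous[OF h(1) m N.V.part_carrier[OF a]]
        by (simp add: add.assoc add.left_commute)
    qed
    then show ?thesis by simp
  qed
  show "act ?M (bracket G x y) m \<oplus>\<^bsub>?M\<^esub> koszul i j \<odot>\<^bsub>?M\<^esub> act ?M y (act ?M x m) =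
      act ?M x (act ?M y m)"
    if h: "x \<in> part G i" "y \<in> part G j" "m \<in> part ?M l" for i j l x y m
  proof
    fix a
    have m: "m \<in> lin_maps_deg N K l" using h by simp
    have ym: "act ?M y m \<in> lin_maps_deg N K (j + l)" and xm: "act ?M x m \<in> lin_maps_deg N K (i + l)"
      using deg h by simp_all
    have b: "bracket G x y \<in> part G (i + j)" using N.G.bracket_part h by blast
    note md = lin_mapsD[OF lin_maps_degD(1)[OF m]]
    note min = lin_maps_minus[OF N.V.superspace_axioms K.V.superspace_axioms lin_maps_degD(1)[OF m]]
    note c = N.G.part_carrier[OF h(1)] N.G.part_carrier[OF h(2)] N.G.part_carrier[OF b]
    show "(act ?M (bracket G x y) m \<oplus>\<^bsub>?M\<^esub> koszul i j \<odot>\<^bsub>?M\<^esub> act ?M y (act ?M x m)) a =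
      act ?M x (act ?M y m) a"
    proof (cases "a \<in> carrier N")
      case False then show ?thesis by (simp add: undef)
    next
      case True
      \<comment> \<open>The signs depend only on the three degrees. In each of the eight cases they
        are constants, and the identity becomes one in the abelian group \<open>K\<close>.\<close>
      show ?thesis
        using True c md bit_cases[of i] bit_cases[of j] bit_cases[of l]
        by (auto simp: act_hom_gmodule_homogeneous[OF b m] act_hom_gmodule_homogeneous[OF h(1) m]
          act_hom_gmodule_homogeneous[OF h(2) m] act_hom_gmodule_homogeneous[OF h(1) ym]
          act_hom_gmodule_homogeneous[OF h(2) xm] N.act_bracket[OF h(1,2)] K.act_bracket[OF h(1,2)]
          koszul_def min K.V.group_simps K.act_add_right)
    qed
  qed
qed

end

section \<open>Powers of operators in characteristic p\<close>

context superspace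
begin

text \<open>The binomial theorem for L = A + B with commuting A and B. The grid \<open>T j i\<close>
  stands for A^j B^i v, so that neither operator has to be given separately, and \<open>step\<close>
  is Pascal's rule along the grid.\<close>

lemma pascal_power:
  fixes T :: "nat \<Rightarrow> nat \<Rightarrow> 'v"
  assumes T: "\<And>j i. T j i \<in> carrier V"
    and L: "\<And>v. v \<in> carrier V \<Longrightarrow> L v \<in> carrier V"
      "\<And>v w. \<lbrakk>v \<in> carrier V; w \<in> carrier V\<rbrakk> \<Longrightarrow> L (v \<oplus> w) = L v \<oplus> L w"
      "\<And>c v. v \<in> carrier V \<Longrightarrow> L (c \<odot> v) = c \<odot> L v"
    and step: "\<And>j i. L (T j i) = T (Suc j) i \<oplus> T j (Suc i)"
  shows "(L ^^ n) (T 0 0) = (\<Oplus>j\<in>{..n}. of_nat (n choose j) \<odot> T j (n - j))"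
proof (induction n)
  case 0 then show ?case using T by simp
next
  case (Suc n)
  have L0: "L \<zero> = \<zero>" using additive_map_simps(1)[OF superspace_axioms superspace_axioms L(1,2)] .
  have L_sum: "L (\<Oplus>j\<in>A. g j) = (\<Oplus>j\<in>A. L (g j))" if "finite A" "g \<in> A \<rightarrow> carrier V" for A and g :: "nat \<Rightarrow> 'v"
    using that by (induction A rule: finite_induct) (auto simp: L L0 Pi_def)
  let ?f = "\<lambda>m j. of_nat (n choose j) \<odot> T m (Suc n - m)"
  \<comment> \<open>The term for j = 0 is split off and the index shifted. The right-hand sum may
    run up to \<open>n\<close> because \<open>n choose Suc n\<close> is 0.\<close>
  have e1: "(\<Oplus>j\<in>{..n}. of_nat (n choose j) \<odot> T j (Suc n - j)) =
      (\<Oplus>j\<in>{..n}. of_nat (n choose Suc j) \<odot> T (Suc j) (n - j)) \<oplus> T 0 (Suc n)"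
    using finsum_Suc2[of "\<lambda>j. of_nat (n choose j) \<odot> T j (Suc n - j)" n]
      finsum_Suc[of "\<lambda>j. of_nat (n choose j) \<odot> T j (Suc n - j)" n] T by (simp add: Pi_def binomial_eq_0)
  have "(L ^^ Suc n) (T 0 0) = (\<Oplus>j\<in>{..n}. of_nat (n choose j) \<odot> L (T j (n - j)))"
    using T by (simp add: Suc L_sum L Pi_def)
  also have "\<dots> = (\<Oplus>j\<in>{..n}. of_nat (n choose j) \<odot> T (Suc j) (n - j) \<oplus> of_nat (n choose j) \<odot> T j (Suc n - j))"
    using T by (intro finsum_cong') (auto simp: step smult_simps Suc_diff_le)
  also have "\<dots> = (\<Oplus>j\<in>{..n}. of_nat (n choose j) \<odot> T (Suc j) (n - j)) \<oplus>
      (\<Oplus>j\<in>{..n}. of_nat (n choose j) \<odot> T j (Suc n - j))"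
    using T by (intro finsum_addf) auto
  also have "\<dots> = ((\<Oplus>j\<in>{..n}. of_nat (n choose j) \<odot> T (Suc j) (n - j)) \<oplus>
      (\<Oplus>j\<in>{..n}. of_nat (n choose Suc j) \<odot> T (Suc j) (n - j))) \<oplus> T 0 (Suc n)"
    using T by (simp add: e1 a_assoc Pi_def)
  also have "(\<Oplus>j\<in>{..n}. of_nat (n choose j) \<odot> T (Suc j) (n - j)) \<oplus>
      (\<Oplus>j\<in>{..n}. of_nat (n choose Suc j) \<odot> T (Suc j) (n - j)) =
      (\<Oplus>j\<in>{..n}. of_nat (n choose j) \<odot> T (Suc j) (n - j) \<oplus> of_nat (n choose Suc j) \<odot> T (Suc j) (n - j))"
    using T by (intro finsum_addf[symmetric]) auto
  also have "\<dots> = (\<Oplus>j\<in>{..n}. of_nat (Suc n choose Suc j) \<odot> T (Suc j) (n - j))"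
    using T by (intro finsum_cong') (auto simp: smult_simps)
  also have "\<dots> \<oplus> T 0 (Suc n) = (\<Oplus>j\<in>{..Suc n}. of_nat (Suc n choose j) \<odot> T j (Suc n - j))"
    using finsum_Suc2[of "\<lambda>j. of_nat (Suc n choose j) \<odot> T j (Suc n - j)" n] T by (simp add: Pi_def)
  finally show ?case .
qed

text \<open>The characteristic is a prime p, and p divides \<open>p choose j\<close> for 0 < j < p.
  Only the two ends of the binomial sum survive.\<close>

lemma pascal_power_CHAR:
  fixes T :: "nat \<Rightarrow> nat \<Rightarrow> 'v"
  assumes "CHAR('k) > 0" and T: "\<And>j i. T j i \<in> carrier V"
    and L: "\<And>v. v \<in> carrier V \<Longrightarrow> L v \<in> carrier V"
      "\<And>v w. \<lbrakk>v \<in> carrier V; w \<in> carrier V\<rbrakk> \<Longrightarrow> L (v \<oplus> w) = L v \<oplus> L w"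
      "\<And>c v. v \<in> carrier V \<Longrightarrow> L (c \<odot> v) = c \<odot> L v"
    and step: "\<And>j i. L (T j i) = T (Suc j) i \<oplus> T j (Suc i)"
  shows "(L ^^ CHAR('k)) (T 0 0) = T CHAR('k) 0 \<oplus> T 0 CHAR('k)"
proof -
  let ?p = "CHAR('k)"
  have p: "prime ?p" using prime_CHAR_semidom assms(1) by blast
  then obtain q where q: "?p = Suc q" by (metis not0_implies_Suc not_prime_0)
  have z: "of_nat (?p choose j) = (0::'k)" if "0 < j" "j < ?p" for j
    using dvd_choose_prime[of j ?p] that p by (simp add: of_nat_eq_0_iff_char_dvd assms(1))
  let ?g = "\<lambda>j. of_nat (?p choose j) \<odot> T j (?p - j)"
  have "(L ^^ ?p) (T 0 0) = (\<Oplus>j\<in>{..?p}. ?g j)" by (rule pascal_power) (fact T L step)+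
  also have "\<dots> = ?g ?p \<oplus> (\<Oplus>j\<in>{..q}. ?g j)"
    using finsum_Suc[of ?g q] T unfolding q by (simp add: Pi_def)
  also have "(\<Oplus>j\<in>{..q}. ?g j) = (\<Oplus>j\<in>{..q}. if 0 = j then T 0 ?p else \<zero>)"
    using T z q by (intro finsum_cong') (auto simp: Pi_def)
  also have "\<dots> = T 0 ?p" using finsum_singleton[of 0 "{..q}" "\<lambda>_. T 0 ?p"] T by simp
  finally show ?thesis using T by simp
qed

end

context
  fixes G :: "('k::field, 'g, 'x) lie_super_scheme"
    and N :: "('k, 'g, 'w, 'y) gmodule_scheme" and K :: "('k, 'g, 'v, 'z) gmodule_scheme"
  assumes NK: "gmodule G N" "gmodule G K" and char: "CHAR('k) > 0"
begin

interpretation N: gmodule G N by (fact NK)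
interpretation K: gmodule G K by (fact NK)
interpretation H: gmodule G "hom_gmodule G N K" by (rule gmodule_hom_gmodule[OF NK])

text \<open>Left and right multiplication by \<open>x\<close> commute, so that \<open>(L - R)\<^sup>p = L\<^sup>p - R\<^sup>p\<close>.\<close>

lemma act_hom_gmodule_CHAR_power:
  assumes x: "x \<in> part G 0" and m: "m \<in> lin_maps N K" and a: "a \<in> carrier N"
  shows "(act (hom_gmodule G N K) x ^^ CHAR('k)) m a =
    (act K x ^^ CHAR('k)) (m a) \<ominus>\<^bsub>K\<^esub> m ((act N x ^^ CHAR('k)) a)"
proof -
  let ?D = "act (hom_gmodule G N K) x"
  let ?T = "\<lambda>j i. (?D ^^ j) m ((act N x ^^ i) a)"
  have xc: "x \<in> carrier G" using x N.G.part_carrier by blast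
  have mj: "(?D ^^ j) m \<in> lin_maps N K" for j using H.act_pow_closed[OF xc, of m] m by simp
  have T: "?T j i \<in> carrier K" for j i using lin_mapsD(1)[OF mj] a xc by blast
  have "(act K x ^^ CHAR('k)) (?T 0 0) = ?T CHAR('k) 0 \<oplus>\<^bsub>K\<^esub> ?T 0 CHAR('k)"
  proof (rule K.V.pascal_power_CHAR[where T = ?T and L = "act K x", OF char])
    show "?T j i \<in> carrier K" for j i by (rule T)
    show "act K x (?T j i) = ?T (Suc j) i \<oplus>\<^bsub>K\<^esub> ?T j (Suc i)" for j i
    proof -
      \<comment> \<open>The formula for the action of the even element \<open>x\<close> on the map
        \<open>(?D ^^ j) m\<close>, evaluated at \<open>(act N x ^^ i) a\<close>. Solved for the
        first term on the right it is Pascal's rule for the grid, with the action on maps and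
        precomposition with \<open>x\<close> as the two commuting operators.\<close>
      have e: "?T (Suc j) i = act K x (?T j i) \<ominus>\<^bsub>K\<^esub> ?T j (Suc i)"
        using act_hom_gmodule_even[OF NK x mj, of "(act N x ^^ i) a" j] a xc by simp
      show ?thesis
        unfolding e using K.act_closed[OF xc T, of j i] T[of j "Suc i"]
        by (simp add: K.V.group_simps del: funpow.simps)
    qed
  qed (use xc in \<open>auto simp: K.act_add_right K.act_smult_right\<close>)
  then show ?thesis using T[of "CHAR('k)" 0] T[of 0 "CHAR('k)"] T[of 0 0] xc by (simp add: K.V.group_simps)
qed

end

text \<open>The p-th power of an even x acts as the difference of the p-th powers on
  \<open>K\<close> and \<open>N\<close>. On both modules these are the actions of
  \<open>ppow G x\<close>, whose own action on maps is the same difference.\<close>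

lemma restricted_gmodule_hom_gmodule:
  fixes G :: "('k::field, 'g, 'x) restricted_lie_super_scheme"
  assumes "CHAR('k) > 0" "restricted_lie_superalgebra G" "restricted_gmodule G N" "restricted_gmodule G K"
  shows "restricted_gmodule G (hom_gmodule G N K)"
proof (rule restricted_gmoduleI)
  interpret G: restricted_lie_superalgebra G by fact
  interpret N: restricted_gmodule G N by fact
  interpret K: restricted_gmodule G K by fact
  show g: "gmodule G (hom_gmodule G N K)"
    by (rule gmodule_hom_gmodule[OF N.gmodule_axioms K.gmodule_axioms])
  then interpret H: gmodule G "hom_gmodule G N K" .
  fix x m assume x: "x \<in> part G 0" and "m \<in> carrier (hom_gmodule G N K)"
  then have m: "m \<in> lin_maps N K" by simp
  have xc: "x \<in> carrier G" "ppow G x \<in> carrier G" using G.ppow_closed[OF x] x G.part_carrier by blast+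
  have "(act (hom_gmodule G N K) x ^^ CHAR('k)) m \<in> lin_maps N K" "act (hom_gmodule G N K) (ppow G x) m \<in> lin_maps N K"
    using H.act_pow_closed[OF xc(1), of m] H.act_closed[OF xc(2), of m] m by simp_all
  then show "(act (hom_gmodule G N K) x ^^ CHAR('k)) m = act (hom_gmodule G N K) (ppow G x) m"
    by (rule lin_maps_eqI)
      (simp add: act_hom_gmodule_CHAR_power[OF N.gmodule_axioms K.gmodule_axioms assms(1) x m]
        act_hom_gmodule_even[OF N.gmodule_axioms K.gmodule_axioms G.ppow_closed[OF x] m]
        N.act_ppow[OF x] K.act_ppow[OF x] lin_mapsD[OF m])
qed

section \<open>Complements and even sections\<close>

context superspace
begin

definition subspace where
  "subspace S \<longleftrightarrow> S \<subseteq> carrier V \<and> \<zero> \<in> S \<and> (\<forall>x\<in>S. \<forall>y\<in>S. x \<oplus> y \<in> S) \<and> (\<forall>c. \<forall>x\<in>S. c \<odot> x \<in> S)"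

text \<open>Zorn's lemma yields a maximal subspace of \<open>P\<close> that meets \<open>D\<close>
  only in 0. \<open>D\<close> need not lie in \<open>P\<close>, which allows \<open>P\<close> to be
  a single part of a superspace and \<open>D\<close> the kernel of a map on the whole of it.\<close>

lemma subspace_complement:
  assumes P: "subspace P" and D: "subspace D"
  obtains S where "subspace S" "S \<subseteq> P" "S \<inter> D = {\<zero>}" "\<And>v. v \<in> P \<Longrightarrow> \<exists>s\<in>S. \<exists>d\<in>D. v = s \<oplus> d"
proof -
  define A where "A = {S. subspace S \<and> S \<subseteq> P \<and> S \<inter> D = {\<zero>}}"
  have "\<exists>Y\<in>A. \<forall>Z\<in>A. Y \<subseteq> Z \<longrightarrow> Z = Y"
  proof (rule subset_Zorn_nonempty)
    have "{\<zero>} \<in> A" using P D by (auto simp: subspace_def A_def)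
    then show "A \<noteq> {}" by blast
    fix C assume C: "C \<noteq> {}" "subset.chain A C"
    have 1: "\<And>Z. Z \<in> C \<Longrightarrow> Z \<in> A" using C by (auto simp: subset.chain_def)
    have 2: "Z \<subseteq> Y \<or> Y \<subseteq> Z" if "Z \<in> C" "Y \<in> C" for Z Y using C that by (auto simp: subset.chain_def)
    have "x \<oplus> y \<in> \<Union>C" if xy: "x \<in> Z" "Z \<in> C" "y \<in> Y" "Y \<in> C" for x y Z Y
    proof (cases "Z \<subseteq> Y")
      case True
      then have "x \<oplus> y \<in> Y" using 1[OF xy(4)] xy by (auto simp: subspace_def A_def)
      then show ?thesis using xy by blast
    next
      case False
      then have "x \<oplus> y \<in> Z" using 2[OF xy(2,4)] 1[OF xy(2)] xy by (auto simp: subspace_def A_def)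
      then show ?thesis using xy by blast
    qed
    moreover have "\<Union>C \<subseteq> carrier V" "\<zero> \<in> \<Union>C" "\<And>c x. x \<in> \<Union>C \<Longrightarrow> c \<odot> x \<in> \<Union>C"
      using 1 C(1) by (fastforce simp: subspace_def A_def)+
    ultimately have "subspace (\<Union>C)" by (auto simp: subspace_def)
    moreover have "\<Union>C \<subseteq> P" "\<Union>C \<inter> D = {\<zero>}" using 1 C(1) by (auto simp: A_def)
    ultimately show "\<Union>C \<in> A" by (simp add: A_def)
  qed
  then obtain S where SA: "S \<in> A" and max: "\<And>Z. Z \<in> A \<Longrightarrow> S \<subseteq> Z \<Longrightarrow> Z = S" by blast
  then have S: "subspace S" "S \<subseteq> P" "S \<inter> D = {\<zero>}" by (simp_all add: A_def)
  have c: "S \<subseteq> carrier V" "D \<subseteq> carrier V" "P \<subseteq> carrier V" using S P D by (auto simp: subspace_def)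
  have "\<exists>s\<in>S. \<exists>d\<in>D. v = s \<oplus> d" if v: "v \<in> P" for v
  proof (rule ccontr)
    assume no: "\<not> ?thesis"
    let ?Z = "{s \<oplus> c \<odot> v | s c. s \<in> S}"
    have vc: "v \<in> carrier V" using v c by auto
    have Z: "subspace ?Z"
      unfolding subspace_def
    proof (intro conjI ballI allI)
      show "?Z \<subseteq> carrier V" using c vc by auto
      show "\<zero> \<in> ?Z" using S(1) vc by (auto simp: subspace_def intro!: exI[of _ \<zero>] exI[of _ 0])
    next
      fix x y assume "x \<in> ?Z" "y \<in> ?Z"
      then obtain s t a b where h: "s \<in> S" "t \<in> S" "x = s \<oplus> a \<odot> v" "y = t \<oplus> b \<odot> v" by blast
      then have "s \<in> carrier V" "t \<in> carrier V" using c by auto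
      then have "x \<oplus> y = (s \<oplus> t) \<oplus> (a + b) \<odot> v" "s \<oplus> t \<in> S"
        using h S(1) vc by (auto simp: smult_simps group_simps subspace_def)
      then show "x \<oplus> y \<in> ?Z" by blast
    next
      fix k x assume "x \<in> ?Z"
      then obtain s a where h: "s \<in> S" "x = s \<oplus> a \<odot> v" by blast
      then have "k \<odot> x = k \<odot> s \<oplus> (k * a) \<odot> v" "k \<odot> s \<in> S"
        using S(1) c vc by (auto simp: smult_simps subspace_def subset_iff)
      then show "k \<odot> x \<in> ?Z" by blast
    qed
    have XP: "?Z \<subseteq> P" using S(2) P v by (auto simp: subspace_def subset_iff)
    have "w = \<zero>" if w: "w \<in> ?Z" "w \<in> D" for w
    proof -
      obtain s a where h: "s \<in> S" "w = s \<oplus> a \<odot> v" using w by blast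
      have sc: "s \<in> carrier V" "w \<in> carrier V" using h w c by auto
      show ?thesis
      proof (cases "a = 0")
        case True then show ?thesis using h w S(3) sc vc by auto
      next
        case False
        \<comment> \<open>If a is nonzero, the equation w = s + a v can be solved for v, which puts
          v into S + D against \<open>no\<close>.\<close>
        have "inverse a \<odot> w = inverse a \<odot> s \<oplus> v"
          using False h sc vc by (simp add: smult_simps flip: smult_simps(3))
        then have "v = ((- inverse a) \<odot> s) \<oplus> inverse a \<odot> w" using sc vc
          by (simp add: group_simps)
        moreover have "(- inverse a) \<odot> s \<in> S" "inverse a \<odot> w \<in> D"
          using S(1) D h w unfolding subspace_def by blast+
        ultimately show ?thesis using no by blast
      qed
    qed
    then have "?Z \<inter> D = {\<zero>}" using Z D by (auto simp: subspace_def)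
    moreover have SX: "S \<subseteq> ?Z"
    proof
      fix s assume "s \<in> S"
      then have "s = s \<oplus> 0 \<odot> v" "s \<in> S" using c vc by auto
      then show "s \<in> ?Z" by blast
    qed
    ultimately have XS: "?Z = S" using max[of ?Z] Z XP by (simp add: A_def)
    have "\<zero> \<oplus> 1 \<odot> v \<in> ?Z" using S(1) unfolding subspace_def by blast
    then have "\<zero> \<oplus> 1 \<odot> v \<in> S" unfolding XS .
    then have "v \<in> S" using vc by simp
    moreover have "v = v \<oplus> \<zero>" "\<zero> \<in> D" using vc D by (auto simp: subspace_def)
    ultimately show False using no by blast
  qed
  with S that show thesis by blast
qed

end

text \<open>The kernel is complemented in each part separately, so that the complements consist of
  homogeneous elements. On the sum \<open>?T\<close> of the two complements \<open>\<phi>\<close> is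
  a bijection onto \<open>N\<close>, and its inverse is even.\<close>

lemma even_section_exists:
  assumes EN: "superspace E" "superspace N" and \<phi>: "\<phi> \<in> lin_maps_deg E N 0" "\<phi> ` carrier E = carrier N"
  obtains \<sigma> where "\<sigma> \<in> lin_maps_deg N E 0" "\<And>a. a \<in> carrier N \<Longrightarrow> \<phi> (\<sigma> a) = a"
proof -
  interpret E: superspace E by fact
  interpret N: superspace N by fact
  note \<phi>D = lin_mapsD[OF lin_maps_degD(1)[OF \<phi>(1)]]
  have \<phi>0: "\<phi> \<zero>\<^bsub>E\<^esub> = \<zero>\<^bsub>N\<^esub>" by (rule lin_maps_zero[OF EN lin_maps_degD(1)[OF \<phi>(1)]])
  have sub: "E.subspace (part E i)" "E.subspace {e \<in> carrier E. \<phi> e = \<zero>\<^bsub>N\<^esub>}" for i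
    using E.part_carrier by (auto simp: E.subspace_def \<phi>D \<phi>0)
  let ?Ker = "{e \<in> carrier E. \<phi> e = \<zero>\<^bsub>N\<^esub>}"
  let ?P = "\<lambda>i S. E.subspace S \<and> S \<subseteq> part E i \<and> S \<inter> ?Ker = {\<zero>\<^bsub>E\<^esub>} \<and>
    (\<forall>v\<in>part E i. \<exists>s\<in>S. \<exists>d\<in>?Ker. v = s \<oplus>\<^bsub>E\<^esub> d)"
  have "\<exists>S. ?P i S" for i
    by (rule E.subspace_complement[OF sub(1)[of i] sub(2)]) (intro exI conjI ballI)
  then have "\<forall>i. \<exists>S. ?P i S" ..
  from choice[OF this] obtain S where S0: "\<forall>i. ?P i (S i)" ..
  have S: "\<And>i. E.subspace (S i)" "\<And>i. S i \<subseteq> part E i" "\<And>i. S i \<inter> ?Ker = {\<zero>\<^bsub>E\<^esub>}"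
    "\<And>i v. v \<in> part E i \<Longrightarrow> \<exists>s\<in>S i. \<exists>d\<in>?Ker. v = s \<oplus>\<^bsub>E\<^esub> d"
    using S0 by blast+
  have Sc: "s \<in> carrier E" if "s \<in> S i" for s i using that S(2) E.part_carrier by blast
  \<comment> \<open>As \<open>\<phi>\<close> is even, the degree \<open>i\<close> component of any
    preimage of \<open>b\<close> is a preimage too; removing its summand in the kernel leaves one in
    \<open>S i\<close>.\<close>
  have ex: "\<exists>s\<in>S i. \<phi> s = b" if b: "b \<in> part N i" for i b
  proof -
    obtain e where e: "e \<in> carrier E" "\<phi> e = b" using b \<phi>(2) N.part_carrier by (metis imageE)
    have "b = \<phi> (component E i e) \<oplus>\<^bsub>N\<^esub> \<phi> (component E (i + 1) e)"
      using e \<phi>D(2) E.component_sum by (metis E.component_in_carrier)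
    then have "component N i b = \<phi> (component E i e)"
      using N.component_eqI[of "\<phi> (component E i e)" i] lin_maps_degD(2)[OF \<phi>(1)] e by fastforce
    then have b': "\<phi> (component E i e) = b" using N.component_part[OF b, of i] by simp
    obtain s d where "s \<in> S i" "d \<in> carrier E" "\<phi> d = \<zero>\<^bsub>N\<^esub>" "component E i e = s \<oplus>\<^bsub>E\<^esub> d"
      using S(4)[of "component E i e" i] e by blast
    then show ?thesis using b' \<phi>D Sc by force
  qed
  let ?T = "{s \<oplus>\<^bsub>E\<^esub> t | s t. s \<in> S 0 \<and> t \<in> S 1}"
  have T: "E.subspace ?T"
    unfolding E.subspace_def
  proof (intro conjI ballI allI)
    show "?T \<subseteq> carrier E" using Sc by auto
    have "\<zero>\<^bsub>E\<^esub> = \<zero>\<^bsub>E\<^esub> \<oplus>\<^bsub>E\<^esub> \<zero>\<^bsub>E\<^esub>" by simp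
    then show "\<zero>\<^bsub>E\<^esub> \<in> ?T" using S(1) unfolding E.subspace_def by blast
  next
    fix x y assume "x \<in> ?T" "y \<in> ?T"
    then obtain s t s' t' where h: "s \<in> S 0" "t \<in> S 1" "s' \<in> S 0" "t' \<in> S 1"
      "x = s \<oplus>\<^bsub>E\<^esub> t" "y = s' \<oplus>\<^bsub>E\<^esub> t'" by blast
    then have "x \<oplus>\<^bsub>E\<^esub> y = (s \<oplus>\<^bsub>E\<^esub> s') \<oplus>\<^bsub>E\<^esub> (t \<oplus>\<^bsub>E\<^esub> t')"
      using Sc by (simp add: E.group_simps)
    moreover have "s \<oplus>\<^bsub>E\<^esub> s' \<in> S 0" "t \<oplus>\<^bsub>E\<^esub> t' \<in> S 1" using h S(1) unfolding E.subspace_def by blast+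
    ultimately show "x \<oplus>\<^bsub>E\<^esub> y \<in> ?T" by blast
  next
    fix c x assume "x \<in> ?T"
    then obtain s t where h: "s \<in> S 0" "t \<in> S 1" "x = s \<oplus>\<^bsub>E\<^esub> t" by blast
    then have "c \<odot>\<^bsub>E\<^esub> x = c \<odot>\<^bsub>E\<^esub> s \<oplus>\<^bsub>E\<^esub> c \<odot>\<^bsub>E\<^esub> t" using Sc by (simp add: E.smult_simps)
    moreover have "c \<odot>\<^bsub>E\<^esub> s \<in> S 0" "c \<odot>\<^bsub>E\<^esub> t \<in> S 1" using h S(1) unfolding E.subspace_def by blast+
    ultimately show "c \<odot>\<^bsub>E\<^esub> x \<in> ?T" by blast
  qed
  have ST: "s \<in> ?T" if s: "s \<in> S i" for s i
  proof -
    have "\<zero>\<^bsub>E\<^esub> \<in> S j" for j using S(1) unfolding E.subspace_def by blast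
    moreover have "s = s \<oplus>\<^bsub>E\<^esub> \<zero>\<^bsub>E\<^esub>" "s = \<zero>\<^bsub>E\<^esub> \<oplus>\<^bsub>E\<^esub> s" using Sc[OF s] by simp_all
    ultimately show ?thesis using s bit_cases[of i] by blast
  qed
  have Tc: "s \<in> carrier E" if "s \<in> ?T" for s using that Sc by auto
  have Tker: "t = \<zero>\<^bsub>E\<^esub>" if t: "t \<in> ?T" "\<phi> t = \<zero>\<^bsub>N\<^esub>" for t
  proof -
    obtain u v where h: "u \<in> S 0" "v \<in> S 1" "t = u \<oplus>\<^bsub>E\<^esub> v" using t by blast
    have p: "\<phi> u \<in> part N 0" "\<phi> v \<in> part N (0 + 1)"
      using lin_maps_degD(2)[OF \<phi>(1), of _ 0] lin_maps_degD(2)[OF \<phi>(1), of _ 1] h S(2) by auto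
    have s: "\<phi> u \<oplus>\<^bsub>N\<^esub> \<phi> v = \<zero>\<^bsub>N\<^esub>" using h t Sc \<phi>D(2) by auto
    then have u0: "\<phi> u = \<zero>\<^bsub>N\<^esub>" using N.component_eqI[OF p] by simp
    then have v0: "\<phi> v = \<zero>\<^bsub>N\<^esub>" using s p N.part_carrier by simp
    have "u = \<zero>\<^bsub>E\<^esub>" "v = \<zero>\<^bsub>E\<^esub>" using S(3)[of 0] S(3)[of 1] h u0 v0 Sc by blast+
    then show ?thesis using h by simp
  qed
  have uniq: "s = t" if "s \<in> ?T" "t \<in> ?T" "\<phi> s = \<phi> t" for s t
  proof -
    have n: "(- 1) \<odot>\<^bsub>E\<^esub> t \<in> ?T" using T that(2) unfolding E.subspace_def by blast
    have "s \<oplus>\<^bsub>E\<^esub> (- 1) \<odot>\<^bsub>E\<^esub> t \<in> ?T" using T that(1) n unfolding E.subspace_def by blast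
    moreover have "\<phi> (s \<oplus>\<^bsub>E\<^esub> (- 1) \<odot>\<^bsub>E\<^esub> t) = \<zero>\<^bsub>N\<^esub>"
      using Tc that by (simp only: \<phi>D E.smultC) (simp add: \<phi>D N.r_neg)
    ultimately have "s \<oplus>\<^bsub>E\<^esub> (- 1) \<odot>\<^bsub>E\<^esub> t = \<zero>\<^bsub>E\<^esub>" by (rule Tker)
    then show ?thesis using Tc[OF that(1)] Tc[OF that(2)] by (simp add: E.group_simps)
  qed
  have exT: "\<exists>t\<in>?T. \<phi> t = a" if a: "a \<in> carrier N" for a
  proof -
    obtain u v where uv: "u \<in> part N 0" "v \<in> part N (0 + 1)" "a = u \<oplus>\<^bsub>N\<^esub> v" using N.decompose[OF a] .
    obtain s t where "s \<in> S 0" "\<phi> s = u" "t \<in> S 1" "\<phi> t = v" using ex[OF uv(1)] ex[OF uv(2)] by auto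
    then show ?thesis using uv(3) \<phi>D(2) Sc by blast
  qed
  define \<sigma> where "\<sigma> = (\<lambda>a\<in>carrier N. SOME t. t \<in> ?T \<and> \<phi> t = a)"
  have \<sigma>: "\<sigma> a \<in> ?T" "\<phi> (\<sigma> a) = a" if "a \<in> carrier N" for a
    using someI_ex[of "\<lambda>t. t \<in> ?T \<and> \<phi> t = a"] exT[OF that] that unfolding \<sigma>_def by auto
  \<comment> \<open>By this uniqueness, linearity and evenness of \<open>\<sigma>\<close> only
    require an element of \<open>?T\<close> with the right image under
    \<open>\<phi>\<close>.\<close>
  have eq: "\<sigma> a = t" if "t \<in> ?T" "\<phi> t = a" "a \<in> carrier N" for a t using uniq \<sigma> that by blast
  have "\<sigma> \<in> lin_maps N E"
  proof (rule lin_mapsI)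
    show "\<sigma> a \<in> carrier E" if "a \<in> carrier N" for a by (rule Tc[OF \<sigma>(1)[OF that]])
    show "\<sigma> (a \<oplus>\<^bsub>N\<^esub> b) = \<sigma> a \<oplus>\<^bsub>E\<^esub> \<sigma> b" if h: "a \<in> carrier N" "b \<in> carrier N" for a b
    proof (rule eq)
      show "\<sigma> a \<oplus>\<^bsub>E\<^esub> \<sigma> b \<in> ?T" using T \<sigma>(1)[OF h(1)] \<sigma>(1)[OF h(2)] unfolding E.subspace_def by blast
      show "\<phi> (\<sigma> a \<oplus>\<^bsub>E\<^esub> \<sigma> b) = a \<oplus>\<^bsub>N\<^esub> b" using h \<sigma> Tc \<phi>D(2) by simp
    qed (use h in simp)
    show "\<sigma> (c \<odot>\<^bsub>N\<^esub> a) = c \<odot>\<^bsub>E\<^esub> \<sigma> a" if h: "a \<in> carrier N" for a c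
    proof (rule eq)
      show "c \<odot>\<^bsub>E\<^esub> \<sigma> a \<in> ?T" using T \<sigma>(1)[OF h(1)] unfolding E.subspace_def by blast
      show "\<phi> (c \<odot>\<^bsub>E\<^esub> \<sigma> a) = c \<odot>\<^bsub>N\<^esub> a" using h \<sigma> Tc \<phi>D(3) by simp
    qed (use h in simp)
    show "\<sigma> a = undefined" if "a \<notin> carrier N" for a using that by (simp add: \<sigma>_def)
  qed
  moreover have "\<sigma> b \<in> part E (0 + i)" if b: "b \<in> part N i" for i b
  proof -
    obtain s where s: "s \<in> S i" "\<phi> s = b" using ex[OF b] by blast
    then have "\<sigma> b = s" using eq[OF ST[OF s(1)] s(2)] b N.part_carrier by blast
    then show ?thesis using s S(2) by auto
  qed
  ultimately have "\<sigma> \<in> lin_maps_deg N E 0" by (rule lin_maps_degI)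
  then show thesis using \<sigma>(2) that by blast
qed


section \<open>Enveloping algebras\<close>

text \<open>The monomial case ranges over the monomials of \<open>t\<close> only, so that conditions
  on its keys stay available: letters in the carrier, no constant term, a fixed degree.\<close>

lemma poly_mapping_keys_induct [case_names zero single add]:
  fixes t :: "'a \<Rightarrow>\<^sub>0 'b::comm_monoid_add"
  assumes "P 0" "\<And>w. w \<in> Poly_Mapping.keys t \<Longrightarrow> P (Poly_Mapping.single w (Poly_Mapping.lookup t w))"
    and "\<And>a b. P a \<Longrightarrow> P b \<Longrightarrow> P (a + b)"
  shows "P t"
proof -
  let ?s = "\<lambda>w. Poly_Mapping.single w (Poly_Mapping.lookup t w)"
  have "(\<Sum>w\<in>Poly_Mapping.keys t. ?s w) = t"
  proof (rule poly_mapping_eqI)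
    fix k
    have "Poly_Mapping.lookup (\<Sum>w\<in>Poly_Mapping.keys t. ?s w) k =
      (\<Sum>w\<in>Poly_Mapping.keys t. if k = w then Poly_Mapping.lookup t w else 0)"
      by (simp add: lookup_sum lookup_single when_def eq_commute)
    then show "Poly_Mapping.lookup (\<Sum>w\<in>Poly_Mapping.keys t. ?s w) k = Poly_Mapping.lookup t k"
      by (simp add: in_keys_iff)
  qed
  moreover have "P (\<Sum>w\<in>A. ?s w)" if "finite A" "A \<subseteq> Poly_Mapping.keys t" for A
    using that by (induction A rule: finite_induct) (auto intro: assms)
  ultimately show ?thesis by (metis finite_keys order_refl)
qed

lemma ring_cong:
  assumes "ring R" "carrier S = carrier R" "monoid.mult S = monoid.mult R" "one S = one R"
    "ring.zero S = ring.zero R" "add S = add R"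
  shows "ring S"
proof -
  interpret R: ring R by fact
  have "abelian_group S"
    by (rule abelian_groupI)
      (use assms(2-) R.add.l_inv_ex in \<open>auto simp: R.a_assoc intro: R.a_comm\<close>)
  moreover have "Group.monoid S"
    by (rule Group.monoidI) (simp_all only: assms(2-) R.m_closed R.one_closed R.m_assoc R.l_one R.r_one)
  ultimately show ?thesis
    by (rule ringI) (simp_all only: assms(2-) R.l_distr R.r_distr)
qed

text \<open>When scalars act as multiplication by ring elements \<open>e c\<close>, every ideal is
  stable under them and the quotient is again of this kind. This is applied twice in succession,
  from the free algebra to \<open>env_alg G\<close> and on to \<open>renv_alg G\<close>.\<close>

locale scalar_algebra = ring A for A :: "('k::field, 'a, 'z) superspace_scheme" (structure) +
  fixes e :: "'k \<Rightarrow> 'a"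
  assumes e_closed: "e c \<in> carrier A"
    and smult_e: "a \<in> carrier A \<Longrightarrow> c \<odot> a = e c \<otimes> a"

context
  fixes A :: "('k::field, 'a, 'z) superspace_scheme" (structure) and e D
  assumes A: "scalar_algebra A e" and D: "ideal D A"
begin

interpretation A: scalar_algebra A e by (fact A)
interpretation D: ideal D A by (fact D)

abbreviation (input) Q where "Q \<equiv> quot_superspace A D"

lemma quot_superspace_simps:
  "carrier Q = (\<lambda>a. D +> a) ` carrier A"
  "\<zero>\<^bsub>Q\<^esub> = D" "\<one>\<^bsub>Q\<^esub> = D +> \<one>"
  "part Q i = (\<lambda>a. D +> a) ` part A i"
  "\<lbrakk>a \<in> carrier A; b \<in> carrier A\<rbrakk> \<Longrightarrow> (D +> a) \<otimes>\<^bsub>Q\<^esub> (D +> b) = D +> (a \<otimes> b)"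
  "\<lbrakk>a \<in> carrier A; b \<in> carrier A\<rbrakk> \<Longrightarrow> (D +> a) \<oplus>\<^bsub>Q\<^esub> (D +> b) = D +> (a \<oplus> b)"
  by (auto simp: quot_superspace_def quot_module_def module.defs ring.defs superspace.defs FactRing_def
      A_RCOSETS_def' D.rcoset_mult_add D.a_rcos_sum)

lemma ring_quot_superspace: "ring Q"
  by (rule ring_cong[OF D.quotient_is_ring])
    (simp_all add: quot_superspace_def quot_module_def module.defs ring.defs superspace.defs)

interpretation Q: ring Q by (rule ring_quot_superspace)

lemma quot_superspace_eqI:
  assumes "a \<in> carrier A" "b \<in> carrier A" "a \<ominus> b \<in> D"
  shows "D +> a = D +> b"
  using A.quotient_eq_iff_same_a_r_cos[OF D assms(1,2)] assms(3) by simp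

lemma quot_superspace_minus:
  assumes "a \<in> carrier A" "b \<in> carrier A"
  shows "(D +> a) \<ominus>\<^bsub>Q\<^esub> (D +> b) = D +> (a \<ominus> b)"
proof -
  have "D +> \<ominus> b \<in> carrier Q" "(D +> \<ominus> b) \<oplus>\<^bsub>Q\<^esub> (D +> b) = \<zero>\<^bsub>Q\<^esub>" "D +> b \<in> carrier Q"
    using assms by (simp_all add: quot_superspace_simps A.l_neg D.a_rcos_const[OF D.zero_closed])
  then have "\<ominus>\<^bsub>Q\<^esub> (D +> b) = D +> \<ominus> b" using Q.minus_equality by blast
  then show ?thesis using assms by (simp add: a_minus_def quot_superspace_simps)
qed

lemma quot_superspace_smult:
  assumes "a \<in> carrier A" shows "c \<odot>\<^bsub>Q\<^esub> (D +> a) = D +> (c \<odot> a)"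
proof -
  have "c \<odot>\<^bsub>Q\<^esub> (D +> a) = (\<Union>b\<in>D +> a. D +> (c \<odot> b))"
    by (simp add: quot_superspace_def quot_module_def module.defs ring.defs superspace.defs)
  also have "\<dots> = D +> (c \<odot> a)"
    using assms D.a_subset
    by (intro D.UN_rcos_map) (auto simp: A.smult_e A.e_closed A.r_distr subset_iff D.I_l_closed)
  finally show ?thesis .
qed

lemma scalar_algebra_quot: "scalar_algebra Q (\<lambda>c. D +> e c)"
  by (intro scalar_algebra.intro scalar_algebra_axioms.intro ring_quot_superspace)
    (auto simp: quot_superspace_simps quot_superspace_smult A.e_closed A.smult_e)

end

text \<open>The annihilator of \<open>V\<close> under an action \<open>f\<close> of the ring
  \<open>A\<close>. Since \<open>env_ideal\<close> and \<open>renv_ideal\<close> are the least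
  ideals containing their relations, they annihilate \<open>V\<close> as soon as the relations
  do.\<close>

lemma (in gmodule) kernel_ideal:
  assumes "ring A"
    and closed: "\<And>a v. \<lbrakk>a \<in> carrier A; v \<in> carrier V\<rbrakk> \<Longrightarrow> f a v \<in> carrier V"
    and add: "\<And>a b v. \<lbrakk>a \<in> carrier A; b \<in> carrier A; v \<in> carrier V\<rbrakk> \<Longrightarrow> f (a \<oplus>\<^bsub>A\<^esub> b) v = f a v \<oplus>\<^bsub>V\<^esub> f b v"
    and mult: "\<And>a b v. \<lbrakk>a \<in> carrier A; b \<in> carrier A; v \<in> carrier V\<rbrakk> \<Longrightarrow> f (a \<otimes>\<^bsub>A\<^esub> b) v = f a (f b v)"
    and zero: "\<And>a. a \<in> carrier A \<Longrightarrow> f a \<zero>\<^bsub>V\<^esub> = \<zero>\<^bsub>V\<^esub>"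
  shows "ideal {a \<in> carrier A. \<forall>v\<in>carrier V. f a v = \<zero>\<^bsub>V\<^esub>} A"
proof -
  interpret A: ring A by fact
  have z: "f \<zero>\<^bsub>A\<^esub> v = \<zero>\<^bsub>V\<^esub>" if "v \<in> carrier V" for v
    using add[of "\<zero>\<^bsub>A\<^esub>" "\<zero>\<^bsub>A\<^esub>" v] closed[of "\<zero>\<^bsub>A\<^esub>" v] that
    by (metis A.zero_closed A.r_zero V.add.r_cancel_one')
  have n: "f (\<ominus>\<^bsub>A\<^esub> a) v = \<ominus>\<^bsub>V\<^esub> f a v" if "a \<in> carrier A" "v \<in> carrier V" for a v
    using add[of "\<ominus>\<^bsub>A\<^esub> a" a v] that closed z by (simp add: A.l_neg V.minus_equality)
  show ?thesis
  proof (rule idealI[OF assms(1)])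
    show "subgroup {a \<in> carrier A. \<forall>v\<in>carrier V. f a v = \<zero>\<^bsub>V\<^esub>} (add_monoid A)"
      using n by (intro A.add.subgroupI) (auto simp: add z a_inv_def)
  qed (auto simp: mult zero closed)
qed

section \<open>The free algebra and its action on modules\<close>

lemma letters_simps [simp]: "letters 0 = []" "letters (v + w) = letters v @ letters w"
  by (simp_all add: zero_free_word_def plus_free_word_def)

lemma Word_Nil: "Word [] = 0"
  by (simp add: zero_free_word_def)

lemma free_word_add_eq_0_iff [simp]: "v + w = 0 \<longleftrightarrow> v = 0 \<and> w = (0 :: 'g free_word)"
  by (cases v; cases w) (auto simp: zero_free_word_def plus_free_word_def)

lemma free_alg_simps [simp]:
  "\<zero>\<^bsub>free_alg G\<^esub> = 0" "\<one>\<^bsub>free_alg G\<^esub> = 1" "s \<oplus>\<^bsub>free_alg G\<^esub> t = s + t" "s \<otimes>\<^bsub>free_alg G\<^esub> t = s * t"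
  "c \<odot>\<^bsub>free_alg G\<^esub> t = Poly_Mapping.single 0 c * t"
  by (simp_all add: free_alg_def)

lemma free_alg_carrier:
  "t \<in> carrier (free_alg G) \<longleftrightarrow> (\<forall>w \<in> Poly_Mapping.keys t. set (letters w) \<subseteq> carrier G)"
  by (simp add: free_alg_def)

lemma free_alg_closed [simp]:
  "0 \<in> carrier (free_alg G)" "1 \<in> carrier (free_alg G)"
  "s \<in> carrier (free_alg G) \<Longrightarrow> t \<in> carrier (free_alg G) \<Longrightarrow> s + t \<in> carrier (free_alg G)"
  "s \<in> carrier (free_alg G) \<Longrightarrow> - s \<in> carrier (free_alg G)"
  "s \<in> carrier (free_alg G) \<Longrightarrow> t \<in> carrier (free_alg G) \<Longrightarrow> s - t \<in> carrier (free_alg G)"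
  "s \<in> carrier (free_alg G) \<Longrightarrow> t \<in> carrier (free_alg G) \<Longrightarrow> s * t \<in> carrier (free_alg G)"
  "s \<in> carrier (free_alg G) \<Longrightarrow> s ^ n \<in> carrier (free_alg G)"
  "x \<in> carrier G \<Longrightarrow> letter x \<in> carrier (free_alg G)"
  "Poly_Mapping.single 0 c \<in> carrier (free_alg G)"
proof -
  show add: "s + t \<in> carrier (free_alg G)" if "s \<in> carrier (free_alg G)" "t \<in> carrier (free_alg G)" for s t
    using that keys_add[of s t] by (fastforce simp: free_alg_carrier)
  show neg: "- s \<in> carrier (free_alg G)" if "s \<in> carrier (free_alg G)" for s
    using that by (auto simp: free_alg_carrier in_keys_iff)
  show "s - t \<in> carrier (free_alg G)" if "s \<in> carrier (free_alg G)" "t \<in> carrier (free_alg G)" for s t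
    using add[OF that(1) neg[OF that(2)]] by simp
  show mult: "s * t \<in> carrier (free_alg G)" if "s \<in> carrier (free_alg G)" "t \<in> carrier (free_alg G)" for s t
    using that keys_mult[of s t] by (fastforce simp: free_alg_carrier)
  show "1 \<in> carrier (free_alg G)" by (simp add: free_alg_carrier)
  then show "s ^ n \<in> carrier (free_alg G)" if "s \<in> carrier (free_alg G)"
    using that mult by (induction n) auto
qed (auto simp: free_alg_carrier letter_def)

lemma ring_free_alg: "ring (free_alg G)"
  by (intro ringI abelian_groupI Group.monoidI)
    (auto simp: algebra_simps intro: bexI[of _ "- _"])

lemma free_alg_minus [simp]:
  assumes "s \<in> carrier (free_alg G)" "t \<in> carrier (free_alg G)"
  shows "s \<ominus>\<^bsub>free_alg G\<^esub> t = s - t"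
proof -
  interpret ring "free_alg G" by (rule ring_free_alg)
  have "\<ominus>\<^bsub>free_alg G\<^esub> t = - t" using minus_equality[of "- t" t] assms by simp
  then show ?thesis by (simp add: a_minus_def)
qed

lemma scalar_algebra_free_alg: "scalar_algebra (free_alg G) (Poly_Mapping.single 0)"
  by (intro scalar_algebra.intro scalar_algebra_axioms.intro ring_free_alg) auto

context gmodule
begin

abbreviation FA where "FA \<equiv> carrier (free_alg G)"

lemma word_act_closed: "set xs \<subseteq> carrier G \<Longrightarrow> v \<in> carrier V \<Longrightarrow> foldr (act V) xs v \<in> carrier V"
  by (induction xs) auto

lemma free_act_superset:
  assumes "t \<in> FA" "v \<in> carrier V" "finite S" "Poly_Mapping.keys t \<subseteq> S" "\<And>w. w \<in> S \<Longrightarrow> set (letters w) \<subseteq> carrier G"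
  shows "free_act V t v = (\<Oplus>\<^bsub>V\<^esub>w\<in>S. Poly_Mapping.lookup t w \<odot>\<^bsub>V\<^esub> foldr (act V) (letters w) v)"
  unfolding free_act_def
  by (rule V.add.finprod_mono_neutral_cong_left)
    (use assms word_act_closed in \<open>auto simp: in_keys_iff\<close>)

lemma free_act_closed [simp, intro]:
  assumes "t \<in> FA" "v \<in> carrier V" shows "free_act V t v \<in> carrier V"
  unfolding free_act_def
  by (rule V.finsum_closed) (use assms word_act_closed in \<open>auto simp: free_alg_carrier\<close>)

lemma free_act_add:
  assumes "s \<in> FA" "t \<in> FA" "v \<in> carrier V"
  shows "free_act V (s + t) v = free_act V s v \<oplus>\<^bsub>V\<^esub> free_act V t v"
proof -
  let ?S = "Poly_Mapping.keys s \<union> Poly_Mapping.keys t"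
  have S: "\<And>w. w \<in> ?S \<Longrightarrow> set (letters w) \<subseteq> carrier G" using assms by (auto simp: free_alg_carrier)
  note sup = free_act_superset[OF _ assms(3) _ _ S]
  have c: "foldr (act V) (letters w) v \<in> carrier V" if "w \<in> ?S" for w
    using word_act_closed[OF S[OF that] assms(3)] .
  have "free_act V (s + t) v = (\<Oplus>\<^bsub>V\<^esub>w\<in>?S. Poly_Mapping.lookup (s + t) w \<odot>\<^bsub>V\<^esub> foldr (act V) (letters w) v)"
    using assms keys_add[of s t] by (intro sup) auto
  also have "\<dots> = (\<Oplus>\<^bsub>V\<^esub>w\<in>?S. Poly_Mapping.lookup s w \<odot>\<^bsub>V\<^esub> foldr (act V) (letters w) v \<oplus>\<^bsub>V\<^esub>
      Poly_Mapping.lookup t w \<odot>\<^bsub>V\<^esub> foldr (act V) (letters w) v)"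
    using c by (intro V.finsum_cong') (auto simp: lookup_add V.smult_simps)
  also have "\<dots> = (\<Oplus>\<^bsub>V\<^esub>w\<in>?S. Poly_Mapping.lookup s w \<odot>\<^bsub>V\<^esub> foldr (act V) (letters w) v) \<oplus>\<^bsub>V\<^esub>
      (\<Oplus>\<^bsub>V\<^esub>w\<in>?S. Poly_Mapping.lookup t w \<odot>\<^bsub>V\<^esub> foldr (act V) (letters w) v)"
    using c by (intro V.finsum_addf) auto
  also have "\<dots> = free_act V s v \<oplus>\<^bsub>V\<^esub> free_act V t v" using assms by (subst (1 2) sup) auto
  finally show ?thesis .
qed

lemma free_act_zero [simp]: "free_act V 0 v = \<zero>\<^bsub>V\<^esub>"
  by (simp add: free_act_def)

lemma free_act_single:
  assumes "set (letters w) \<subseteq> carrier G" "v \<in> carrier V"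
  shows "free_act V (Poly_Mapping.single w c) v = c \<odot>\<^bsub>V\<^esub> foldr (act V) (letters w) v"
  using word_act_closed[OF assms] by (simp add: free_act_def)

lemma free_act_letter [simp]: "x \<in> carrier G \<Longrightarrow> v \<in> carrier V \<Longrightarrow> free_act V (letter x) v = act V x v"
  by (simp add: letter_def free_act_single)

lemma free_act_scalar [simp]: "v \<in> carrier V \<Longrightarrow> free_act V (Poly_Mapping.single 0 c) v = c \<odot>\<^bsub>V\<^esub> v"
  by (simp add: free_act_single)

lemma free_act_uminus:
  assumes "t \<in> FA" "v \<in> carrier V" shows "free_act V (- t) v = \<ominus>\<^bsub>V\<^esub> free_act V t v"
  using free_act_add[of "- t" t v] assms V.minus_equality[of "free_act V (- t) v" "free_act V t v"] by simp

lemma free_act_minus: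
  assumes "s \<in> FA" "t \<in> FA" "v \<in> carrier V"
  shows "free_act V (s - t) v = free_act V s v \<ominus>\<^bsub>V\<^esub> free_act V t v"
  using free_act_add[of s "- t" v] assms by (simp add: free_act_uminus a_minus_def)

lemma free_alg_induct [consumes 1, case_names zero single add]:
  assumes "t \<in> FA" "P 0"
    and "\<And>w c. w \<in> Poly_Mapping.keys t \<Longrightarrow> set (letters w) \<subseteq> carrier G \<Longrightarrow> P (Poly_Mapping.single w c)"
    and "\<And>a b. a \<in> FA \<Longrightarrow> b \<in> FA \<Longrightarrow> P a \<Longrightarrow> P b \<Longrightarrow> P (a + b)"
  shows "P t"
proof -
  have "t \<in> FA \<and> P t"
  proof (induction t rule: poly_mapping_keys_induct)
    case (single w)
    then have "set (letters w) \<subseteq> carrier G" using assms(1) by (simp add: free_alg_carrier)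
    then show ?case using assms(3)[OF single] by (auto simp: free_alg_carrier)
  qed (use assms(2,4) in \<open>auto\<close>)
  then show ?thesis ..
qed

lemma free_act_hom:
  fixes W :: "('k, 'g, 'w, 'q) gmodule_scheme"
  assumes "gmodule G W"
    and closed: "\<And>v. v \<in> carrier V \<Longrightarrow> \<alpha> v \<in> carrier W"
    and add: "\<And>v w. \<lbrakk>v \<in> carrier V; w \<in> carrier V\<rbrakk> \<Longrightarrow> \<alpha> (v \<oplus>\<^bsub>V\<^esub> w) = \<alpha> v \<oplus>\<^bsub>W\<^esub> \<alpha> w"
    and smult: "\<And>c v. v \<in> carrier V \<Longrightarrow> \<alpha> (c \<odot>\<^bsub>V\<^esub> v) = c \<odot>\<^bsub>W\<^esub> \<alpha> v"
    and act: "\<And>x v. \<lbrakk>x \<in> carrier G; v \<in> carrier V\<rbrakk> \<Longrightarrow> \<alpha> (act V x v) = act W x (\<alpha> v)"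
    and t: "t \<in> FA" and v: "v \<in> carrier V"
  shows "\<alpha> (free_act V t v) = free_act W t (\<alpha> v)"
proof -
  interpret W: gmodule G W by fact
  have word: "\<alpha> (foldr (act V) xs v) = foldr (act W) xs (\<alpha> v)" if "set xs \<subseteq> carrier G" for xs
    using that v by (induction xs) (auto simp: act word_act_closed)
  have zero: "\<alpha> \<zero>\<^bsub>V\<^esub> = \<zero>\<^bsub>W\<^esub>"
    by (rule additive_map_simps(1)[OF V.superspace_axioms W.V.superspace_axioms closed add])
  show ?thesis
    using t
    by (induction t rule: free_alg_induct)
      (auto simp: zero free_act_single W.free_act_single v closed smult word word_act_closed
        free_act_add W.free_act_add add)
qed

lemma free_act_add_right:
  assumes "t \<in> FA" "v \<in> carrier V" "w \<in> carrier V"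
  shows "free_act V t (v \<oplus>\<^bsub>V\<^esub> w) = free_act V t v \<oplus>\<^bsub>V\<^esub> free_act V t w"
proof -
  have word: "foldr (act V) xs (v \<oplus>\<^bsub>V\<^esub> w) = foldr (act V) xs v \<oplus>\<^bsub>V\<^esub> foldr (act V) xs w" if "set xs \<subseteq> carrier G" for xs
    using that by (induction xs) (use assms in \<open>auto simp: act_add_right word_act_closed\<close>)
  show ?thesis
    using assms(1)
    by (induction t rule: free_alg_induct)
      (use assms in \<open>auto simp: word free_act_single word_act_closed free_act_add V.smult_simps V.group_simps\<close>)
qed

lemma free_act_smult_right:
  assumes "t \<in> FA" "v \<in> carrier V"
  shows "free_act V t (c \<odot>\<^bsub>V\<^esub> v) = c \<odot>\<^bsub>V\<^esub> free_act V t v"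
proof -
  have word: "foldr (act V) xs (c \<odot>\<^bsub>V\<^esub> v) = c \<odot>\<^bsub>V\<^esub> foldr (act V) xs v" if "set xs \<subseteq> carrier G" for xs
    using that by (induction xs) (use assms in \<open>auto simp: act_smult_right word_act_closed\<close>)
  show ?thesis
    using assms(1)
    by (induction t rule: free_alg_induct)
      (use assms in \<open>auto simp: word free_act_single word_act_closed free_act_add V.smult_simps V.smult_left_commute[of _ c]\<close>)
qed

lemma free_act_zero_right [simp]: "t \<in> FA \<Longrightarrow> free_act V t \<zero>\<^bsub>V\<^esub> = \<zero>\<^bsub>V\<^esub>"
  using free_act_smult_right[of t "\<zero>\<^bsub>V\<^esub>" 0] by simp

lemma free_act_mult:
  assumes "s \<in> FA" "t \<in> FA" "v \<in> carrier V"
  shows "free_act V (s * t) v = free_act V s (free_act V t v)"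
  using assms(1)
proof (induction s rule: free_alg_induct)
  case zero then show ?case using assms by simp
next
  case (add a b) then show ?case using assms by (simp add: distrib_right free_act_add)
next
  case (single w c)
  have *: "Poly_Mapping.single w c \<in> FA" using single by (auto simp: free_alg_carrier)
  show ?case using assms(2)
  proof (induction t rule: free_alg_induct)
    case zero then show ?case using * by simp
  next
    case (add a b) then show ?case
      using * assms by (simp add: distrib_left free_act_add free_act_add_right)
  next
    case (single u d)
    have "foldr (act V) xs (d \<odot>\<^bsub>V\<^esub> y) = d \<odot>\<^bsub>V\<^esub> foldr (act V) xs y"
      if "set xs \<subseteq> carrier G" "y \<in> carrier V" for xs y
      using that by (induction xs) (auto simp: act_smult_right word_act_closed)
    then show ?case
      using single \<open>set (letters w) \<subseteq> carrier G\<close> assms(3)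
      by (simp add: mult_single free_act_single word_act_closed V.smult_simps)
  qed
qed

lemma word_act_part:
  assumes "list_all2 (\<lambda>x d. x \<in> part G d) xs ds" "v \<in> part V j"
  shows "foldr (act V) xs v \<in> part V (sum_list ds + j)"
  using assms by (induction xs ds rule: list_all2_induct) (auto simp: act_part add.assoc)

lemma free_act_part:
  assumes "t \<in> part (free_alg G) i" "v \<in> part V j"
  shows "free_act V t v \<in> part V (i + j)"
proof -
  have t: "t \<in> FA" and d: "\<And>w. w \<in> Poly_Mapping.keys t \<Longrightarrow> word_degree G w i"
    using assms(1) by (auto simp: free_alg_def)
  show ?thesis
    using t
  proof (induction t rule: free_alg_induct)
    case (single w c)
    then show ?case
      using d[OF single(1)] word_act_part[OF _ assms(2)] V.part_carrier[OF assms(2)]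
      by (auto simp: word_degree_def free_act_single)
  qed (use assms V.part_carrier in \<open>auto simp: free_act_add\<close>)
qed

lemma free_act_env_relations:
  assumes "t \<in> env_relations G" "v \<in> carrier V"
  shows "t \<in> FA" "free_act V t v = \<zero>\<^bsub>V\<^esub>"
proof -
  note simps = free_act_minus free_act_mult act_add_left act_smult_left
  consider (add) x y where "x \<in> carrier G" "y \<in> carrier G" "t = letter (x \<oplus>\<^bsub>G\<^esub> y) - letter x - letter y"
    | (smult) c x where "x \<in> carrier G" "t = letter (c \<odot>\<^bsub>G\<^esub> x) - Poly_Mapping.single 0 c * letter x"
    | (bracket) i j x y where "x \<in> part G i" "y \<in> part G j"
      "t = letter x * letter y - Poly_Mapping.single 0 (koszul i j) * letter y * letter x - letter (bracket G x y)"
    using assms(1) unfolding env_relations_def by blast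
  then have "t \<in> FA \<and> free_act V t v = \<zero>\<^bsub>V\<^esub>"
  proof cases
    case add then show ?thesis using assms(2) by (simp add: simps V.group_simps V.minus_eq_zero_iff)
  next
    case smult then show ?thesis using assms(2) by (simp add: simps)
  next
    case bracket
    note c = G.part_carrier[OF bracket(1)] G.part_carrier[OF bracket(2)]
      G.part_carrier[OF G.bracket_part[OF bracket(1,2)]]
    show ?thesis
      using c assms(2) act_bracket[OF bracket(1,2) assms(2)] by (simp add: bracket(3) simps)
  qed
  then show "t \<in> FA" "free_act V t v = \<zero>\<^bsub>V\<^esub>" by auto
qed

end

text \<open>Both quotients are passed in one step. Computations in \<open>renv_alg G\<close> are
  thus done on representatives in the free algebra, where the operations are those of
  polynomials.\<close>

definition renv_class ::
    "('k::field, 'g, 'z) restricted_lie_super_scheme \<Rightarrow> ('k, 'g) free_poly \<Rightarrow> ('k, 'g) free_poly set set"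
  where "renv_class G t = renv_ideal G +>\<^bsub>env_alg G\<^esub> (env_ideal G +>\<^bsub>free_alg G\<^esub> t)"

section \<open>The restricted enveloping algebra and its augmentation ideal\<close>

context restricted_lie_superalgebra
begin

abbreviation env_class where "env_class t \<equiv> env_ideal G +>\<^bsub>free_alg G\<^esub> t"

lemma env_relations_closed: "env_relations G \<subseteq> carrier (free_alg G)"
proof -
  have "\<lbrakk>x \<in> part G i; y \<in> part G j\<rbrakk> \<Longrightarrow> bracket G x y \<in> carrier G" for x y i j
    using bracket_part part_carrier by blast
  then show ?thesis using part_carrier by (auto simp: env_relations_def)
qed

lemma ideal_env_ideal: "ideal (env_ideal G) (free_alg G)"
  unfolding env_ideal_def by (rule ring.genideal_ideal[OF ring_free_alg env_relations_closed])

lemmas env_quot = scalar_algebra_free_alg[of G] ideal_env_ideal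
lemmas env_alg_simps = quot_superspace_simps[OF env_quot, folded env_alg_def]
  quot_superspace_minus[OF env_quot, folded env_alg_def]
  quot_superspace_smult[OF env_quot, folded env_alg_def]
lemmas scalar_algebra_env_alg = scalar_algebra_quot[OF env_quot, folded env_alg_def]

lemma ring_env_alg: "ring (env_alg G)"
  using scalar_algebra_env_alg by (rule scalar_algebra.axioms)

lemma env_class_eqI:
  assumes "s \<in> carrier (free_alg G)" "t \<in> carrier (free_alg G)" "s - t \<in> env_relations G"
  shows "env_class s = env_class t"
  by (rule quot_superspace_eqI[OF env_quot assms(1,2)])
    (use assms ring.genideal_self[OF ring_free_alg env_relations_closed] in \<open>auto simp: env_ideal_def\<close>)

lemma env_class_pow:
  assumes "x \<in> carrier G"
  shows "env_incl G x [^]\<^bsub>env_alg G\<^esub> (n::nat) = env_class (letter x ^ n)"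
proof (induction n)
  case 0
  interpret ring "env_alg G" by (rule ring_env_alg)
  show ?case using nat_pow_0[of "env_incl G x"] by (simp add: env_alg_simps)
next
  case (Suc n)
  interpret ring "env_alg G" by (rule ring_env_alg)
  show ?case
    using Suc assms by (simp add: env_incl_def env_alg_simps flip: power_Suc2)
qed

definition ppow_relations where "ppow_relations =
  {env_incl G x [^]\<^bsub>env_alg G\<^esub> CHAR('k) \<ominus>\<^bsub>env_alg G\<^esub> env_incl G (ppow G x) | x. x \<in> part G 0}"

lemma ppow_relations_eq:
  "ppow_relations = {env_class (letter x ^ CHAR('k) - letter (ppow G x)) | x. x \<in> part G 0}"
proof -
  have "env_incl G x [^]\<^bsub>env_alg G\<^esub> CHAR('k) \<ominus>\<^bsub>env_alg G\<^esub> env_incl G (ppow G x) =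
    env_class (letter x ^ CHAR('k) - letter (ppow G x))" if "x \<in> part G 0" for x
  proof -
    have "x \<in> carrier G" "ppow G x \<in> carrier G" using that ppow_closed part_carrier by blast+
    then show ?thesis by (simp only: env_class_pow) (simp add: env_incl_def env_alg_simps)
  qed
  then show ?thesis unfolding ppow_relations_def by fastforce
qed

lemma ppow_relations_closed: "ppow_relations \<subseteq> carrier (env_alg G)"
proof
  fix a assume "a \<in> ppow_relations"
  then obtain x where x: "x \<in> part G 0" "a = env_class (letter x ^ CHAR('k) - letter (ppow G x))"
    unfolding ppow_relations_eq by blast
  have "x \<in> carrier G" "ppow G x \<in> carrier G" using x ppow_closed part_carrier by blast+
  then show "a \<in> carrier (env_alg G)" by (simp add: x env_alg_simps)
qed

lemma ideal_renv_ideal: "ideal (renv_ideal G) (env_alg G)"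
  unfolding renv_ideal_def ppow_relations_def[symmetric]
  by (rule ring.genideal_ideal[OF ring_env_alg ppow_relations_closed])

lemmas renv_quot = scalar_algebra_env_alg ideal_renv_ideal
lemmas renv_alg_simps = quot_superspace_simps[OF renv_quot, folded renv_alg_def]
  quot_superspace_smult[OF renv_quot, folded renv_alg_def]
lemmas scalar_algebra_renv_alg = scalar_algebra_quot[OF renv_quot, folded renv_alg_def]

lemma ring_renv_alg: "ring (renv_alg G)"
  using scalar_algebra_renv_alg by (rule scalar_algebra.axioms)

lemma renv_class_simps:
  "carrier (renv_alg G) = renv_class G ` carrier (free_alg G)"
  "part (renv_alg G) i = renv_class G ` part (free_alg G) i"
  "\<one>\<^bsub>renv_alg G\<^esub> = renv_class G 1"
  "\<zero>\<^bsub>renv_alg G\<^esub> = renv_class G 0"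
  "\<lbrakk>s \<in> carrier (free_alg G); t \<in> carrier (free_alg G)\<rbrakk> \<Longrightarrow>
    renv_class G s \<oplus>\<^bsub>renv_alg G\<^esub> renv_class G t = renv_class G (s + t)"
  "\<lbrakk>s \<in> carrier (free_alg G); t \<in> carrier (free_alg G)\<rbrakk> \<Longrightarrow>
    renv_class G s \<otimes>\<^bsub>renv_alg G\<^esub> renv_class G t = renv_class G (s * t)"
  "t \<in> carrier (free_alg G) \<Longrightarrow>
    c \<odot>\<^bsub>renv_alg G\<^esub> renv_class G t = renv_class G (Poly_Mapping.single 0 c * t)"
  "renv_incl G x = renv_class G (letter x)"
proof -
  interpret D: ideal "renv_ideal G" "env_alg G" by (rule ideal_renv_ideal)
  interpret E: ideal "env_ideal G" "free_alg G" by (rule ideal_env_ideal)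
  have "env_class 0 = \<zero>\<^bsub>env_alg G\<^esub>"
    using E.a_rcos_const[OF additive_subgroup.zero_closed[OF ideal.axioms(1)[OF ideal_env_ideal]]] by (simp add: env_alg_simps)
  then have "renv_class G 0 = renv_ideal G"
    using D.a_rcos_const[OF additive_subgroup.zero_closed[OF ideal.axioms(1)[OF ideal_renv_ideal]]] by (simp add: renv_class_def)
  then show "\<zero>\<^bsub>renv_alg G\<^esub> = renv_class G 0" by (simp add: renv_alg_simps)
qed (auto simp: renv_class_def renv_alg_simps env_alg_simps renv_incl_def env_incl_def image_image)

text \<open>For a cocycle on the augmentation ideal these relations become, in this order,
  additivity, homogeneity, the cocycle identity on the Lie superalgebra and the condition on
  \<open>ppow\<close>.\<close>

lemma renv_class_relations:
  "\<lbrakk>x \<in> carrier G; y \<in> carrier G\<rbrakk> \<Longrightarrow> renv_class G (letter (x \<oplus> y)) = renv_class G (letter x + letter y)"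
  "x \<in> carrier G \<Longrightarrow> renv_class G (letter (c \<odot> x)) = renv_class G (Poly_Mapping.single 0 c * letter x)"
  "\<lbrakk>x \<in> part G i; y \<in> part G j\<rbrakk> \<Longrightarrow> renv_class G (letter x * letter y) =
    renv_class G (letter (bracket G x y) + Poly_Mapping.single 0 (koszul i j) * letter y * letter x)"
  "x \<in> part G 0 \<Longrightarrow> renv_class G (letter x ^ CHAR('k)) = renv_class G (letter (ppow G x))"
proof -
  have b: "\<lbrakk>x \<in> part G i; y \<in> part G j\<rbrakk> \<Longrightarrow> bracket G x y \<in> carrier G" for x y i j
    using bracket_part part_carrier by blast
  show "renv_class G (letter (x \<oplus> y)) = renv_class G (letter x + letter y)" if "x \<in> carrier G" "y \<in> carrier G"
    unfolding renv_class_def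
    by (subst env_class_eqI[of "letter (x \<oplus> y)" "letter x + letter y"])
      (use that in \<open>auto simp: env_relations_def diff_diff_eq[symmetric]\<close>)
  show "renv_class G (letter (c \<odot> x)) = renv_class G (Poly_Mapping.single 0 c * letter x)" if "x \<in> carrier G"
    unfolding renv_class_def
    by (subst env_class_eqI[of "letter (c \<odot> x)" "Poly_Mapping.single 0 c * letter x"])
      (use that in \<open>auto simp: env_relations_def\<close>)
  show "renv_class G (letter x * letter y) =
    renv_class G (letter (bracket G x y) + Poly_Mapping.single 0 (koszul i j) * letter y * letter x)"
    if "x \<in> part G i" "y \<in> part G j"
  proof -
    have "letter x * letter y - (letter (bracket G x y) + Poly_Mapping.single 0 (koszul i j) * letter y * letter x) =
      letter x * letter y - Poly_Mapping.single 0 (koszul i j) * letter y * letter x - letter (bracket G x y)"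
      by (simp add: algebra_simps)
    also have "\<dots> \<in> env_relations G" unfolding env_relations_def using that by blast
    finally show ?thesis
      unfolding renv_class_def using that part_carrier b by (subst env_class_eqI) auto
  qed
  show "renv_class G (letter x ^ CHAR('k)) = renv_class G (letter (ppow G x))" if x: "x \<in> part G 0"
    unfolding renv_class_def
  proof (rule quot_superspace_eqI[OF renv_quot])
    have c: "x \<in> carrier G" "ppow G x \<in> carrier G" using that ppow_closed part_carrier by blast+
    then show "env_class (letter x ^ CHAR('k)) \<in> carrier (env_alg G)" "env_class (letter (ppow G x)) \<in> carrier (env_alg G)"
      by (auto simp: env_alg_simps)
    have "env_class (letter x ^ CHAR('k)) \<ominus>\<^bsub>env_alg G\<^esub> env_class (letter (ppow G x)) \<in> ppow_relations"
      using c x by (auto simp: env_alg_simps ppow_relations_eq)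
    then show "env_class (letter x ^ CHAR('k)) \<ominus>\<^bsub>env_alg G\<^esub> env_class (letter (ppow G x)) \<in> renv_ideal G"
      using ring.genideal_self[OF ring_env_alg ppow_relations_closed]
      by (auto simp: renv_ideal_def ppow_relations_def)
  qed
qed

definition renv_aug where "renv_aug = Idl\<^bsub>renv_alg G\<^esub> (renv_incl G ` carrier G)"

lemma renv_incl_closed: "renv_incl G ` carrier G \<subseteq> carrier (renv_alg G)"
  by (auto simp: renv_class_simps)

lemma ideal_renv_aug: "ideal renv_aug (renv_alg G)"
  unfolding renv_aug_def by (rule ring.genideal_ideal[OF ring_renv_alg renv_incl_closed])

lemma renv_incl_aug: "x \<in> carrier G \<Longrightarrow> renv_class G (letter x) \<in> renv_aug"
  using ring.genideal_self[OF ring_renv_alg renv_incl_closed] by (auto simp: renv_aug_def renv_class_simps)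

lemma renv_plus_simps:
  "carrier (renv_plus G) = renv_aug"
  "add (renv_plus G) = add (renv_alg G)"
  "monoid.mult (renv_plus G) = monoid.mult (renv_alg G)"
  "module.smult (renv_plus G) = module.smult (renv_alg G)"
  "part (renv_plus G) i = part (renv_alg G) i \<inter> renv_aug"
  by (simp_all add: renv_plus_def sub_superspace_def renv_aug_def)

text \<open>The classes of polynomials without constant term form an ideal that contains all
  letters. Conversely, a nonempty word is a letter times a word and hence lies in any ideal
  containing the letters.\<close>

lemma renv_aug_eq: "renv_aug = renv_class G ` {t \<in> carrier (free_alg G). 0 \<notin> Poly_Mapping.keys t}"
proof
  let ?P = "{t \<in> carrier (free_alg G). 0 \<notin> Poly_Mapping.keys t}"
  have add: "s + t \<in> ?P" if "s \<in> ?P" "t \<in> ?P" for s t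
    using that keys_add[of s t] by auto
  have mult: "s * t \<in> ?P" if "s \<in> carrier (free_alg G)" "t \<in> carrier (free_alg G)" "s \<in> ?P \<or> t \<in> ?P" for s t
    using that keys_mult[of s t] by (auto 0 4)
  interpret A: ring "renv_alg G" by (rule ring_renv_alg)
  have "ideal (renv_class G ` ?P) (renv_alg G)"
  proof (rule idealI[OF ring_renv_alg])
    show "subgroup (renv_class G ` ?P) (add_monoid (renv_alg G))"
    proof (rule A.add.subgroupI)
      show "renv_class G ` ?P \<subseteq> carrier (renv_alg G)" by (auto simp: renv_class_simps)
      show "renv_class G ` ?P \<noteq> {}" by (auto intro!: exI[of _ 0])
    next
      fix a assume "a \<in> renv_class G ` ?P"
      then obtain t where t: "t \<in> ?P" "a = renv_class G t" by blast
      have n: "- t \<in> ?P" using t by (auto simp: in_keys_iff)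
      have "renv_class G (- t) \<oplus>\<^bsub>renv_alg G\<^esub> renv_class G t = \<zero>\<^bsub>renv_alg G\<^esub>"
        using t n by (simp add: renv_class_simps)
      then have "\<ominus>\<^bsub>renv_alg G\<^esub> a = renv_class G (- t)"
        using A.minus_equality[of "renv_class G (- t)" a] t n by (auto simp: renv_class_simps)
      then show "\<ominus>\<^bsub>renv_alg G\<^esub> a \<in> renv_class G ` ?P" using n by blast
    next
      fix a b assume "a \<in> renv_class G ` ?P" "b \<in> renv_class G ` ?P"
      then show "a \<oplus>\<^bsub>renv_alg G\<^esub> b \<in> renv_class G ` ?P" using add by (force simp: renv_class_simps)
    qed
  next
    fix a b assume "a \<in> renv_class G ` ?P" "b \<in> carrier (renv_alg G)"
    then obtain s t where "s \<in> ?P" "t \<in> carrier (free_alg G)" "a = renv_class G s" "b = renv_class G t"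
      by (auto simp: renv_class_simps)
    then show "b \<otimes>\<^bsub>renv_alg G\<^esub> a \<in> renv_class G ` ?P" "a \<otimes>\<^bsub>renv_alg G\<^esub> b \<in> renv_class G ` ?P"
      using mult[of t s] mult[of s t] by (simp_all add: renv_class_simps)
  qed
  then show "renv_aug \<subseteq> renv_class G ` ?P"
    unfolding renv_aug_def
    by (rule A.genideal_minimal) (auto simp: renv_class_simps letter_def zero_free_word_def free_alg_carrier)
next
  interpret I: ideal renv_aug "renv_alg G" by (rule ideal_renv_aug)
  have word: "renv_class G (Poly_Mapping.single w c) \<in> renv_aug"
    if w: "set (letters w) \<subseteq> carrier G" "w \<noteq> 0" for w c
  proof -
    obtain x xs where xs: "w = Word (x # xs)" using w(2) by (metis Word_Nil free_word.exhaust list.exhaust)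
    have "Poly_Mapping.single w c = letter x * Poly_Mapping.single (Word xs) c"
      by (simp add: xs letter_def mult_single plus_free_word_def)
    moreover have c: "x \<in> carrier G" "Poly_Mapping.single (Word xs) c \<in> carrier (free_alg G)"
      using w xs by (auto simp: free_alg_carrier)
    moreover have "renv_class G (letter x) \<otimes>\<^bsub>renv_alg G\<^esub> renv_class G (Poly_Mapping.single (Word xs) c) \<in> renv_aug"
      using I.I_r_closed[OF renv_incl_aug[OF c(1)]] c(2) by (auto simp: renv_class_simps)
    ultimately show ?thesis by (simp add: renv_class_simps)
  qed
  have "renv_class G t \<in> renv_aug" if t: "t \<in> carrier (free_alg G)" "0 \<notin> Poly_Mapping.keys t" for t
  proof -
    have "t \<in> carrier (free_alg G) \<and> renv_class G t \<in> renv_aug"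
    proof (induction t rule: poly_mapping_keys_induct)
      case zero then show ?case using additive_subgroup.zero_closed[OF ideal.axioms(1)[OF ideal_renv_aug]] by (simp add: renv_class_simps)
    next
      case (single w)
      then have "set (letters w) \<subseteq> carrier G" "w \<noteq> 0" using t by (auto simp: free_alg_carrier)
      then show ?case using word by (auto simp: free_alg_carrier)
    next
      case (add a b)
      then show ?case using additive_subgroup.a_closed[OF ideal.axioms(1)[OF ideal_renv_aug], of "renv_class G a" "renv_class G b"] by (simp add: renv_class_simps)
    qed
    then show ?thesis ..
  qed
  then show "renv_class G ` {t \<in> carrier (free_alg G). 0 \<notin> Poly_Mapping.keys t} \<subseteq> renv_aug" by blast
qed

end

lemma the_elem_image_constant:
  assumes "A \<noteq> {}" "\<And>x. x \<in> A \<Longrightarrow> f x = y" shows "the_elem (f ` A) = y"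
proof -
  have "f ` A = {y}" using assms by auto
  then show ?thesis by simp
qed

context
  fixes G :: "('k::field, 'g, 'x) restricted_lie_super_scheme" and V :: "('k, 'g, 'v, 'z) gmodule_scheme"
  assumes G: "restricted_lie_superalgebra G" and V: "restricted_gmodule G V"
begin

interpretation G: restricted_lie_superalgebra G by (fact G)
interpretation V: restricted_gmodule G V by (fact V)

text \<open>The ideal \<open>env_ideal G\<close> annihilates \<open>V\<close>, so all
  representatives of a class act alike and \<open>the_elem\<close> is applied to a
  singleton.\<close>

lemma env_act_class:
  assumes t: "t \<in> carrier (free_alg G)" and v: "v \<in> carrier V"
  shows "env_act V (env_ideal G +>\<^bsub>free_alg G\<^esub> t) v = free_act V t v"
proof -
  have "env_ideal G \<subseteq> {a \<in> carrier (free_alg G). \<forall>v\<in>carrier V. free_act V a v = \<zero>\<^bsub>V\<^esub>}"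
    unfolding env_ideal_def
    by (rule ring.genideal_minimal[OF ring_free_alg V.kernel_ideal[OF ring_free_alg]])
      (use V.free_act_env_relations in \<open>auto simp: V.free_act_add V.free_act_mult\<close>)
  then have "free_act V (h + t) v = free_act V t v" if "h \<in> env_ideal G" for h
    using that t v by (subst V.free_act_add) auto
  moreover have "env_ideal G \<noteq> {}"
    using ideal.axioms(1)[OF G.ideal_env_ideal] additive_subgroup.zero_closed by blast
  ultimately show ?thesis
    unfolding env_act_def by (intro the_elem_image_constant) (auto simp: a_r_coset_def')
qed

text \<open>Here it matters that \<open>V\<close> is restricted: this makes the elements of
  \<open>ppow_relations\<close> act as zero, and with them the ideal that they generate.\<close>

lemma renv_act_class:
  assumes t: "t \<in> carrier (free_alg G)" and v: "v \<in> carrier V"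
  shows "renv_act V (renv_class G t) v = free_act V t v"
proof -
  note env = G.env_alg_simps(1) env_act_class
  let ?K = "{a \<in> carrier (env_alg G). \<forall>v\<in>carrier V. env_act V a v = \<zero>\<^bsub>V\<^esub>}"
  have "ideal ?K (env_alg G)"
    by (rule V.kernel_ideal[OF G.ring_env_alg])
      (auto simp: G.env_alg_simps env_act_class V.free_act_add V.free_act_mult)
  moreover have "G.ppow_relations \<subseteq> ?K"
  proof
    fix a assume "a \<in> G.ppow_relations"
    then obtain x where x: "x \<in> part G 0" "a = G.env_class (letter x ^ CHAR('k) - letter (ppow G x))"
      unfolding G.ppow_relations_eq by blast
    have c: "x \<in> carrier G" "ppow G x \<in> carrier G" using x G.ppow_closed G.part_carrier by blast+
    have "free_act V (letter x ^ n) w = (act V x ^^ n) w" if "w \<in> carrier V" for n w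
    proof (induction n)
      case 0 then show ?case using V.free_act_scalar[of w 1] that by (simp flip: single_one)
    next
      case (Suc n) then show ?case using c that by (simp add: V.free_act_mult)
    qed
    then show "a \<in> ?K"
      using c x V.act_ppow[OF x(1)] by (auto simp: G.env_alg_simps env_act_class V.free_act_minus)
  qed
  ultimately have K: "renv_ideal G \<subseteq> ?K"
    unfolding renv_ideal_def G.ppow_relations_def[symmetric] by (rule ring.genideal_minimal[OF G.ring_env_alg])
  have "env_act V (h \<oplus>\<^bsub>env_alg G\<^esub> G.env_class t) v = free_act V t v" if h: "h \<in> renv_ideal G" for h
  proof -
    obtain s where s: "s \<in> carrier (free_alg G)" "h = G.env_class s"
      using h K by (auto simp: G.env_alg_simps)
    then have "free_act V s v = \<zero>\<^bsub>V\<^esub>" using h K v env_act_class[of s v] by auto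
    then show ?thesis using s t v by (simp add: G.env_alg_simps env_act_class V.free_act_add)
  qed
  moreover have "renv_ideal G \<noteq> {}"
    using ideal.axioms(1)[OF G.ideal_renv_ideal] additive_subgroup.zero_closed by blast
  ultimately show ?thesis
    unfolding renv_act_def renv_class_def by (intro the_elem_image_constant) (auto simp: a_r_coset_def')
qed

end


section \<open>Restricted cocycles\<close>

text \<open>The quotient in the extension of the ground field by a module of coefficients. As it is
  concentrated in even degree, the vector (0, 1) of that extension is even, and so is the cocycle
  obtained from it.\<close>

definition trivial_gmodule :: "('k::field, 'g, 'k) gmodule"
  where "trivial_gmodule =
    \<lparr>carrier = UNIV, monoid.mult = undefined, one = undefined, zero = 0, add = (+), module.smult = (*),
     part = (\<lambda>i. if i = 0 then UNIV else {0}), act = (\<lambda>_ _. 0)\<rparr>"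

lemma trivial_gmodule_simps [simp]:
  "carrier trivial_gmodule = UNIV" "\<zero>\<^bsub>trivial_gmodule\<^esub> = 0" "a \<oplus>\<^bsub>trivial_gmodule\<^esub> b = a + b"
  "c \<odot>\<^bsub>trivial_gmodule\<^esub> a = c * a" "part trivial_gmodule i = (if i = 0 then UNIV else {0})"
  "act trivial_gmodule x a = 0"
  by (simp_all add: trivial_gmodule_def)

lemma gmodule_trivial:
  fixes G :: "('k::field, 'g, 'z) lie_super_scheme"
  assumes "lie_superalgebra G" shows "gmodule G trivial_gmodule"
proof (rule gmoduleI[OF assms])
  show "superspace (trivial_gmodule :: ('k, 'g, 'k) gmodule)"
    by (rule superspaceI) (auto simp: algebra_simps)
qed auto

text \<open>A cocycle on the augmentation ideal satisfies f(x^p) = x^(p-1) . f(x), and x^p is there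
  the class of \<open>ppow G x\<close>. The following lemmas show that \<open>res_incl\<close> is a
  bijection from \<open>Z1_res\<close> onto this set.\<close>

definition Z1_ppow ::
    "('k::field, 'g, 'y) restricted_lie_super_scheme \<Rightarrow> ('k, 'g, 'm, 'z) gmodule_scheme \<Rightarrow> ('g \<Rightarrow> 'm) set"
  where "Z1_ppow G M = {f \<in> Z1 G M. \<forall>x\<in>part G 0. f (ppow G x) = (act M x ^^ (CHAR('k) - 1)) (f x)}"

definition res_incl ::
    "('k::field, 'g, 'y) restricted_lie_super_scheme \<Rightarrow> (('k, 'g) free_poly set set \<Rightarrow> 'm) \<Rightarrow> 'g \<Rightarrow> 'm"
  where "res_incl G f = (\<lambda>x\<in>carrier G. f (renv_incl G x))"

lemma Z1D:
  assumes "f \<in> Z1 G M"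
  shows "f \<in> lin_maps_deg G M 0" and "f \<in> lin_maps G M"
    and "\<lbrakk>x \<in> part G i; y \<in> part G j\<rbrakk> \<Longrightarrow>
      f (bracket G x y) = act M x (f y) \<ominus>\<^bsub>M\<^esub> koszul i j \<odot>\<^bsub>M\<^esub> act M y (f x)"
  using assms by (auto simp: Z1_def lin_maps_deg_def)

context
  fixes G :: "('k::field, 'g, 'x) restricted_lie_super_scheme" and M :: "('k, 'g, 'm, 'z) gmodule_scheme"
  assumes G: "restricted_lie_superalgebra G" and M: "restricted_gmodule G M" and char: "CHAR('k) > 0"
begin

interpretation G: restricted_lie_superalgebra G by (fact G)
interpretation M: restricted_gmodule G M by (fact M)

abbreviation FP where "FP \<equiv> {t \<in> carrier (free_alg G). 0 \<notin> Poly_Mapping.keys t}"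

lemma FP_closed:
  "s \<in> FP \<Longrightarrow> t \<in> FP \<Longrightarrow> s + t \<in> FP"
  "s \<in> carrier (free_alg G) \<Longrightarrow> t \<in> FP \<Longrightarrow> s * t \<in> FP"
  "x \<in> carrier G \<Longrightarrow> letter x \<in> FP"
  "x \<in> carrier G \<Longrightarrow> letter x ^ Suc n \<in> FP"
proof -
  show mult: "s * t \<in> FP" if "s \<in> carrier (free_alg G)" "t \<in> FP" for s t
    using that keys_mult[of s t] by (auto 0 4)
  show letter: "letter x \<in> FP" if "x \<in> carrier G" for x
    using that by (simp add: letter_def zero_free_word_def free_alg_carrier)
  show "s \<in> FP \<Longrightarrow> t \<in> FP \<Longrightarrow> s + t \<in> FP" using keys_add[of s t] by auto
  show "letter x ^ Suc n \<in> FP" if "x \<in> carrier G"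
    using mult[of "letter x ^ n" "letter x"] letter that by (simp add: power_commutes)
qed

lemma renv_aug_eq': "G.renv_aug = renv_class G ` FP"
  by (rule G.renv_aug_eq)

lemma Z1_res_class:
  assumes f: "f \<in> Z1_res G M"
  shows "t \<in> FP \<Longrightarrow> f (renv_class G t) \<in> carrier M"
    and "\<lbrakk>s \<in> FP; t \<in> FP\<rbrakk> \<Longrightarrow> f (renv_class G (s + t)) = f (renv_class G s) \<oplus>\<^bsub>M\<^esub> f (renv_class G t)"
    and "t \<in> FP \<Longrightarrow> f (renv_class G (Poly_Mapping.single 0 c * t)) = c \<odot>\<^bsub>M\<^esub> f (renv_class G t)"
    and "\<lbrakk>s \<in> FP; t \<in> FP\<rbrakk> \<Longrightarrow> f (renv_class G (s * t)) = free_act M s (f (renv_class G t))"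
proof -
  have d: "f \<in> lin_maps_deg (renv_plus G) M 0"
    and m: "\<And>u v. \<lbrakk>u \<in> G.renv_aug; v \<in> G.renv_aug\<rbrakk> \<Longrightarrow> f (u \<otimes>\<^bsub>renv_alg G\<^esub> v) = renv_act M u (f v)"
    using f by (auto simp: Z1_res_def G.renv_plus_simps)
  note l = lin_mapsD[OF lin_maps_degD(1)[OF d], unfolded G.renv_plus_simps renv_aug_eq']
  show c: "t \<in> FP \<Longrightarrow> f (renv_class G t) \<in> carrier M" for t using l(1) by blast
  show "\<lbrakk>s \<in> FP; t \<in> FP\<rbrakk> \<Longrightarrow> f (renv_class G (s + t)) = f (renv_class G s) \<oplus>\<^bsub>M\<^esub> f (renv_class G t)"
    using l(2)[of "renv_class G s" "renv_class G t"] by (simp add: G.renv_class_simps)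
  show "t \<in> FP \<Longrightarrow> f (renv_class G (Poly_Mapping.single 0 c * t)) = c \<odot>\<^bsub>M\<^esub> f (renv_class G t)"
    using l(3)[of "renv_class G t" c] by (simp add: G.renv_class_simps)
  show "\<lbrakk>s \<in> FP; t \<in> FP\<rbrakk> \<Longrightarrow> f (renv_class G (s * t)) = free_act M s (f (renv_class G t))"
    using m[of "renv_class G s" "renv_class G t"] c
    by (simp add: renv_aug_eq' G.renv_class_simps renv_act_class[OF G M])
qed

text \<open>The rule f(uv) = u . f(v) is applied to both sides of the defining relations of the
  enveloping algebra.\<close>

lemma res_incl_Z1_ppow:
  assumes f: "f \<in> Z1_res G M" shows "res_incl G f \<in> Z1_ppow G M"
proof -
  note F = Z1_res_class[OF f] and P = FP_closed
  let ?F = "\<lambda>t. f (renv_class G t)"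
  have r: "res_incl G f x = ?F (letter x)" if "x \<in> carrier G" for x
    using that by (simp add: res_incl_def G.renv_class_simps)
  have b: "bracket G x y \<in> carrier G" if "x \<in> part G i" "y \<in> part G j" for x y i j
    using that G.bracket_part G.part_carrier by blast
  have lin: "res_incl G f \<in> lin_maps G M"
  proof (rule lin_mapsI)
    fix x assume x: "x \<in> carrier G"
    show "res_incl G f x \<in> carrier M" using F(1)[OF P(3)[OF x]] r[OF x] by simp
    show "res_incl G f (x \<oplus>\<^bsub>G\<^esub> y) = res_incl G f x \<oplus>\<^bsub>M\<^esub> res_incl G f y" if y: "y \<in> carrier G" for y
      using x y F(2)[OF P(3)[OF x] P(3)[OF y]] by (simp add: r G.renv_class_relations(1))
    show "res_incl G f (c \<odot>\<^bsub>G\<^esub> x) = c \<odot>\<^bsub>M\<^esub> res_incl G f x" for c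
      using x F(3)[OF P(3)[OF x]] by (simp add: r G.renv_class_relations(2))
  qed (simp add: res_incl_def)
  have deg: "res_incl G f \<in> lin_maps_deg G M 0"
  proof (rule lin_maps_degI[OF lin])
    fix i x assume x: "x \<in> part G i"
    then have xc: "x \<in> carrier G" by (rule G.part_carrier)
    have "word_degree G (Word [x]) i" using x by (auto simp: word_degree_def intro!: exI[of _ "[i]"])
    then have "letter x \<in> part (free_alg G) i" using xc by (simp add: free_alg_def letter_def)
    then have "renv_class G (letter x) \<in> part (renv_plus G) i"
      using G.renv_incl_aug[OF xc] by (simp add: G.renv_plus_simps G.renv_class_simps)
    then show "res_incl G f x \<in> part M (0 + i)"
      using f lin_maps_degD(2)[of f "renv_plus G" M 0] r[OF xc] by (simp add: Z1_res_def)
  qed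
  have br: "res_incl G f (bracket G x y) =
      act M x (res_incl G f y) \<ominus>\<^bsub>M\<^esub> koszul i j \<odot>\<^bsub>M\<^esub> act M y (res_incl G f x)"
    if x: "x \<in> part G i" and y: "y \<in> part G j" for i j x y
  proof -
    note c = G.part_carrier[OF x] G.part_carrier[OF y] b[OF x y]
    have "act M x (?F (letter y)) = ?F (letter x * letter y)" using c F(1,4) P(3) by simp
    also have "\<dots> = ?F (letter (bracket G x y) + Poly_Mapping.single 0 (koszul i j) * (letter y * letter x))"
      using G.renv_class_relations(3)[OF x y] by (simp add: mult.assoc)
    also have "\<dots> = ?F (letter (bracket G x y)) \<oplus>\<^bsub>M\<^esub> koszul i j \<odot>\<^bsub>M\<^esub> act M y (?F (letter x))"
      using c F P(2,3) by simp
    finally show ?thesis using c F(1)[OF P(3)] by (simp add: r M.V.group_simps)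
  qed
  have pp: "res_incl G f (ppow G x) = (act M x ^^ (CHAR('k) - 1)) (res_incl G f x)" if x: "x \<in> part G 0" for x
  proof -
    have c: "x \<in> carrier G" "ppow G x \<in> carrier G" using x G.ppow_closed G.part_carrier by blast+
    \<comment> \<open>As \<open>f\<close> is given on the augmentation ideal only, the recursion
      stops at a single letter and not at the empty product; hence the exponent \<open>Suc n\<close>
      on the left and \<open>n\<close> on the right.\<close>
    have "?F (letter x ^ Suc n) = (act M x ^^ n) (?F (letter x))" for n
    proof (induction n)
      case (Suc n)
      have "?F (letter x * letter x ^ Suc n) = act M x (?F (letter x ^ Suc n))"
        using F(4)[OF P(3)[OF c(1)] P(4)[OF c(1)]] F(1)[OF P(4)[OF c(1)]] c(1) by simp
      then show ?case using Suc by simp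
    qed simp
    from this[of "CHAR('k) - 1"] show ?thesis
      using char c by (simp add: r G.renv_class_relations(4)[OF x] del: power_Suc)
  qed
  show ?thesis using deg br pp by (auto simp: Z1_ppow_def Z1_def)
qed

text \<open>Splitting letters off from the left, f(xw) = x . f(w), expresses \<open>f\<close> on
  nonempty words by its values on letters, and the classes of nonempty words span the augmentation
  ideal.\<close>

lemma res_incl_inj:
  assumes f: "f \<in> Z1_res G M" and g: "g \<in> Z1_res G M" and eq: "res_incl G f = res_incl G g"
  shows "f = g"
proof -
  note F = Z1_res_class[OF f] and H = Z1_res_class[OF g] and P = FP_closed
  have letter: "f (renv_class G (letter x)) = g (renv_class G (letter x))" if "x \<in> carrier G" for x
    using fun_cong[OF eq, of x] that by (simp add: res_incl_def G.renv_class_simps)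
  have word: "f (renv_class G (Poly_Mapping.single (Word (x # xs)) c)) =
      g (renv_class G (Poly_Mapping.single (Word (x # xs)) c))"
    if "set (x # xs) \<subseteq> carrier G" for x xs c
    using that
  proof (induction xs arbitrary: x)
    case Nil
    have "Poly_Mapping.single (Word [x]) c = Poly_Mapping.single 0 c * letter x"
      by (simp add: letter_def mult_single)
    then show ?case using Nil F(3)[OF P(3), of x c] H(3)[OF P(3), of x c] letter[of x] by simp
  next
    case (Cons y ys)
    have e: "Poly_Mapping.single (Word (x # y # ys)) c = letter x * Poly_Mapping.single (Word (y # ys)) c"
      by (simp add: letter_def mult_single plus_free_word_def)
    have "Poly_Mapping.single (Word (y # ys)) c \<in> FP" using Cons.prems by (auto simp: free_alg_carrier zero_free_word_def)
    then show ?case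
      unfolding e using Cons F(4)[OF P(3)] H(4)[OF P(3)] by simp
  qed
  have eqP: "f (renv_class G t) = g (renv_class G t)" if t: "t \<in> FP" for t
  proof -
    have z: "f (renv_class G 0) = g (renv_class G 0)" using F(3)[of 0 0] H(3)[of 0 0] F(1)[of 0] H(1)[of 0] by simp
    have "t \<in> FP \<and> f (renv_class G t) = g (renv_class G t)"
    proof (induction t rule: poly_mapping_keys_induct)
      case (single w)
      then have w: "set (letters w) \<subseteq> carrier G" "w \<noteq> 0" using t by (auto simp: free_alg_carrier)
      then obtain x xs where "w = Word (x # xs)" by (metis Word_Nil free_word.exhaust list.exhaust)
      then show ?case using word w by (auto simp: free_alg_carrier)
    next
      case (add a b) then show ?case using P(1)[of a b] F(2)[of a b] H(2)[of a b] by simp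
    qed (use z in auto)
    then show ?thesis ..
  qed
  have "f \<in> lin_maps (renv_plus G) M" "g \<in> lin_maps (renv_plus G) M"
    using f g lin_maps_degD(1) by (auto simp: Z1_res_def)
  then show ?thesis
    by (rule lin_maps_eqI) (use eqP in \<open>auto simp: G.renv_plus_simps renv_aug_eq'\<close>)
qed

text \<open>The extension \<open>M \<oplus> k\<close> in which \<open>x\<cdot>(0, 1) = (h x, 0)\<close> is restricted for \<open>h\<close> in \<^const>\<open>Z1_ppow\<close>;
  a cocycle on the augmentation ideal is then read off from \<open>u\<cdot>(0, 1)\<close>.\<close>

lemma res_incl_surj:
  assumes h: "h \<in> Z1_ppow G M"
  obtains f where "f \<in> Z1_res G M" "res_incl G f = h"
proof -
  have hZ: "h \<in> Z1 G M" and hp: "\<And>x. x \<in> part G 0 \<Longrightarrow> h (ppow G x) = (act M x ^^ (CHAR('k) - 1)) (h x)"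
    using h by (auto simp: Z1_ppow_def)
  note hl = lin_mapsD[OF Z1D(2)[OF hZ]]
  let ?b = "\<lambda>x c. c \<odot>\<^bsub>M\<^esub> h x"
  define E :: "('k, 'g, 'm \<times> 'k) gmodule" where "E = twisted_sum M trivial_gmodule ?b"
  have triv: "gmodule G trivial_gmodule" by (rule gmodule_trivial[OF G.lie_superalgebra_axioms])
  have gE: "gmodule G E"
    unfolding E_def
  proof (rule gmodule_twisted_sum[OF M.gmodule_axioms triv])
    fix i j x c assume "x \<in> part G i" "c \<in> part (trivial_gmodule :: ('k, 'g, 'k) gmodule) j"
    then show "c \<odot>\<^bsub>M\<^esub> h x \<in> part M (i + j)"
      using lin_maps_degD(2)[OF Z1D(1)[OF hZ], of x i] M.V.part_carrier by (auto split: if_splits)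
  next
    fix i j l x y c assume xy: "x \<in> part G i" "y \<in> part G j"
    then have c: "x \<in> carrier G" "y \<in> carrier G" by (auto intro: G.part_carrier)
    show "c \<odot>\<^bsub>M\<^esub> h (bracket G x y) \<oplus>\<^bsub>M\<^esub> koszul i j \<odot>\<^bsub>M\<^esub>
          (act M y (c \<odot>\<^bsub>M\<^esub> h x) \<oplus>\<^bsub>M\<^esub> act trivial_gmodule x c \<odot>\<^bsub>M\<^esub> h y) =
        act M x (c \<odot>\<^bsub>M\<^esub> h y) \<oplus>\<^bsub>M\<^esub> act trivial_gmodule y c \<odot>\<^bsub>M\<^esub> h x"
      using c by (simp add: Z1D(3)[OF hZ xy] hl M.act_smult_right M.V.smult_simps
          M.V.smult_left_commute[of _ c] M.V.group_simps)
  qed (auto simp: hl M.V.smult_simps M.V.smult_left_commute)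
  interpret E: gmodule G E by (fact gE)
  have E_simps: "carrier E = carrier M \<times> UNIV" "\<zero>\<^bsub>E\<^esub> = (\<zero>\<^bsub>M\<^esub>, 0)"
    "(v, a) \<oplus>\<^bsub>E\<^esub> (v', a') = (v \<oplus>\<^bsub>M\<^esub> v', a + a')" "c \<odot>\<^bsub>E\<^esub> (v, a) = (c \<odot>\<^bsub>M\<^esub> v, c * a)"
    "part E i = part M i \<times> (if i = 0 then UNIV else {0})" "act E x (v, a) = (act M x v \<oplus>\<^bsub>M\<^esub> a \<odot>\<^bsub>M\<^esub> h x, 0)"
    for v a v' a' c i x
    by (simp_all add: E_def)
  \<comment> \<open>From the first application of x on, the vector lies in \<open>M\<close>. For
    \<open>Suc n\<close> equal to p the result is the action of \<open>ppow G x\<close> on (v, a),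
    because \<open>M\<close> is restricted and \<open>hp\<close> rewrites the second
    summand.\<close>
  have pow: "(act E x ^^ Suc n) (v, a) = ((act M x ^^ Suc n) v \<oplus>\<^bsub>M\<^esub> a \<odot>\<^bsub>M\<^esub> (act M x ^^ n) (h x), 0)"
    if "x \<in> carrier G" "v \<in> carrier M" for x v a n
    using that by (induction n) (simp_all add: E_simps hl M.act_add_right M.act_smult_right)
  have rE: "restricted_gmodule G E"
  proof (rule restricted_gmoduleI[OF gE])
    fix x e assume x: "x \<in> part G 0" and e: "e \<in> carrier E"
    obtain v a where va: "e = (v, a)" "v \<in> carrier M" using e by (auto simp: E_simps)
    obtain q where q: "CHAR('k) = Suc q" using char by (metis not0_implies_Suc less_irrefl)
    show "(act E x ^^ CHAR('k)) e = act E (ppow G x) e"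
      using M.act_ppow[OF x va(2)] hp[OF x] pow[of x v q a] va G.part_carrier[OF x] by (simp add: E_simps q)
  qed
  have e: "(\<zero>\<^bsub>M\<^esub>, 1) \<in> carrier E" "(\<zero>\<^bsub>M\<^esub>, 1) \<in> part E 0" by (auto simp: E_simps)
  define g where "g = (\<lambda>u\<in>G.renv_aug. fst (renv_act E u (\<zero>\<^bsub>M\<^esub>, 1)))"
  let ?F = "\<lambda>t. fst (free_act E t (\<zero>\<^bsub>M\<^esub>, 1))"
  have g: "g (renv_class G t) = ?F t" if "t \<in> FP" for t
    using that by (simp add: g_def renv_aug_eq' renv_act_class[OF G rE] e)
  \<comment> \<open>The action on the quotient by \<open>M\<close> is trivial, so a nonempty word
    sends every vector into \<open>M\<close>.\<close>
  have pair: "free_act E t (\<zero>\<^bsub>M\<^esub>, 1) = (?F t, 0)" if t: "t \<in> FP" for t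
  proof -
    have "t \<in> FP \<and> snd (free_act E t (\<zero>\<^bsub>M\<^esub>, 1)) = 0"
    proof (induction t rule: poly_mapping_keys_induct)
      case zero then show ?case by (simp add: E_simps)
    next
      case (single w)
      then have w: "set (letters w) \<subseteq> carrier G" "w \<noteq> 0" using t by (auto simp: free_alg_carrier)
      then obtain x xs where xs: "w = Word (x # xs)" by (metis Word_Nil free_word.exhaust list.exhaust)
      obtain v a where va: "foldr (act E) xs (\<zero>\<^bsub>M\<^esub>, 1) = (v, a)" by fastforce
      have "snd (free_act E (Poly_Mapping.single w (Poly_Mapping.lookup t w)) (\<zero>\<^bsub>M\<^esub>, 1)) = 0"
        using w xs e by (simp add: E.free_act_single va E_simps)
      then show ?case using w by (auto simp: free_alg_carrier)
    next
      case (add a b)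
      obtain v c where "free_act E a (\<zero>\<^bsub>M\<^esub>, 1) = (v, c)" by fastforce
      moreover obtain v' c' where "free_act E b (\<zero>\<^bsub>M\<^esub>, 1) = (v', c')" by fastforce
      ultimately show ?case using add FP_closed(1)[of a b] e by (simp add: E.free_act_add E_simps)
    qed
    then show ?thesis by (metis prod.collapse)
  qed
  have Fc: "?F t \<in> carrier M" if "t \<in> FP" for t
    using E.free_act_closed[of t "(\<zero>\<^bsub>M\<^esub>, 1)"] that e pair[OF that] by (auto simp: E_simps)
  have "g \<in> lin_maps (renv_plus G) M"
  proof (rule lin_mapsI)
    fix u assume "u \<in> carrier (renv_plus G)"
    then obtain s where s: "s \<in> FP" "u = renv_class G s" by (auto simp: G.renv_plus_simps renv_aug_eq')
    show "g u \<in> carrier M" using g s Fc by simp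
    show "g (c \<odot>\<^bsub>renv_plus G\<^esub> u) = c \<odot>\<^bsub>M\<^esub> g u" for c
    proof -
      have m: "Poly_Mapping.single 0 c * s \<in> FP" using FP_closed(2)[of "Poly_Mapping.single 0 c" s] s by simp
      have "free_act E (Poly_Mapping.single 0 c * s) (\<zero>\<^bsub>M\<^esub>, 1) = c \<odot>\<^bsub>E\<^esub> free_act E s (\<zero>\<^bsub>M\<^esub>, 1)"
        using s e by (subst E.free_act_mult) auto
      also have "\<dots> = (c \<odot>\<^bsub>M\<^esub> ?F s, 0)" by (subst pair[OF s(1)]) (simp add: E_simps)
      finally show ?thesis using s g[OF m] g[OF s(1)] by (simp add: G.renv_plus_simps G.renv_class_simps)
    qed
    fix v assume "v \<in> carrier (renv_plus G)"
    then obtain t where t: "t \<in> FP" "v = renv_class G t" by (auto simp: G.renv_plus_simps renv_aug_eq')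
    have "free_act E (s + t) (\<zero>\<^bsub>M\<^esub>, 1) = free_act E s (\<zero>\<^bsub>M\<^esub>, 1) \<oplus>\<^bsub>E\<^esub> free_act E t (\<zero>\<^bsub>M\<^esub>, 1)"
      using s t e by (intro E.free_act_add) auto
    also have "\<dots> = (?F s \<oplus>\<^bsub>M\<^esub> ?F t, 0)" by (subst pair[OF s(1)], subst pair[OF t(1)]) (simp add: E_simps)
    finally show "g (u \<oplus>\<^bsub>renv_plus G\<^esub> v) = g u \<oplus>\<^bsub>M\<^esub> g v"
      using s t g[OF FP_closed(1)[OF s(1) t(1)]] g[OF s(1)] g[OF t(1)]
      by (simp add: G.renv_plus_simps G.renv_class_simps)
  qed (simp add: g_def G.renv_plus_simps)
  then have "g \<in> lin_maps_deg (renv_plus G) M 0"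
  proof (rule lin_maps_degI)
    fix i u assume "u \<in> part (renv_plus G) i"
    then obtain t where t: "t \<in> part (free_alg G) i" "u = renv_class G t" "u \<in> G.renv_aug"
      by (auto simp: G.renv_plus_simps G.renv_class_simps)
    \<comment> \<open>A homogeneous representative of an element of the augmentation ideal may have
      a constant term, so \<open>g\<close> is evaluated by its definition and not by the rule for
      polynomials in \<open>FP\<close>.\<close>
    have "t \<in> carrier (free_alg G)" using t(1) by (simp add: free_alg_def)
    then have "g u = ?F t" using t by (simp add: g_def renv_act_class[OF G rE] e)
    moreover have "free_act E t (\<zero>\<^bsub>M\<^esub>, 1) \<in> part E (i + 0)" by (rule E.free_act_part[OF t(1) e(2)])
    ultimately show "g u \<in> part M (0 + i)" by (auto simp: E_simps)
  qed
  moreover have "g (u \<otimes>\<^bsub>renv_plus G\<^esub> v) = renv_act M u (g v)"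
    if "u \<in> carrier (renv_plus G)" "v \<in> carrier (renv_plus G)" for u v
  proof -
    obtain s t where st: "s \<in> FP" "u = renv_class G s" "t \<in> FP" "v = renv_class G t"
      using \<open>u \<in> _\<close> \<open>v \<in> _\<close> by (auto simp: G.renv_plus_simps renv_aug_eq')
    have st': "s * t \<in> FP" using FP_closed(2)[of s t] st by simp
    \<comment> \<open>The map m \<mapsto> (m, 0) embeds \<open>M\<close> as a submodule of
      \<open>E\<close>, and t . (0, 1) lies in its image.\<close>
    have "(free_act M s (?F t), 0) = free_act E s (?F t, 0)"
      using M.free_act_hom[OF gE, of "\<lambda>m. (m, 0)" s "?F t"] st Fc hl(1)
      by (simp add: E_simps)
    also have "\<dots> = free_act E (s * t) (\<zero>\<^bsub>M\<^esub>, 1)" using st e pair[OF st(3)] by (simp add: E.free_act_mult)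
    finally have "?F (s * t) = free_act M s (?F t)" by (metis fst_conv)
    then show ?thesis
      using st g[OF st'] g[OF st(3)] Fc[OF st(3)]
      by (simp add: G.renv_plus_simps G.renv_class_simps renv_act_class[OF G M])
  qed
  ultimately have gZ: "g \<in> Z1_res G M" by (simp add: Z1_res_def)
  have "res_incl G g = h"
  proof
    fix x show "res_incl G g x = h x"
    proof (cases "x \<in> carrier G")
      case True
      then show ?thesis
        using g[OF FP_closed(3)[OF True]] e hl(1) by (simp add: res_incl_def G.renv_class_simps E_simps)
    qed (simp add: res_incl_def hl(4))
  qed
  with gZ that show thesis by blast
qed

text \<open>The same even \<open>m\<close> defines both coboundaries, so that every coboundary on
  the Lie superalgebra lifts to one on the augmentation ideal.\<close>

lemma B1_res_Z1_res:
  assumes m: "m \<in> part M 0"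
  shows "(\<lambda>u\<in>carrier (renv_plus G). renv_act M u m) \<in> Z1_res G M" (is "?f \<in> _")
    and "res_incl G (\<lambda>u\<in>carrier (renv_plus G). renv_act M u m) = (\<lambda>x\<in>carrier G. act M x m)"
proof -
  have mc: "m \<in> carrier M" using m M.V.part_carrier by blast
  have f: "?f (renv_class G t) = free_act M t m" if "t \<in> FP" for t
    using that mc by (simp add: G.renv_plus_simps renv_aug_eq' renv_act_class[OF G M])
  have "?f \<in> lin_maps (renv_plus G) M"
  proof (rule lin_mapsI)
    fix u assume "u \<in> carrier (renv_plus G)"
    then obtain s where s: "s \<in> FP" "u = renv_class G s" by (auto simp: G.renv_plus_simps renv_aug_eq')
    show "?f u \<in> carrier M" unfolding s(2) f[OF s(1)] using s mc by auto
    show "?f (c \<odot>\<^bsub>renv_plus G\<^esub> u) = c \<odot>\<^bsub>M\<^esub> ?f u" for c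
    proof -
      have mm: "Poly_Mapping.single 0 c * s \<in> FP" using FP_closed(2)[of "Poly_Mapping.single 0 c" s] s by simp
      have "c \<odot>\<^bsub>renv_plus G\<^esub> u = renv_class G (Poly_Mapping.single 0 c * s)"
        using s by (simp add: G.renv_plus_simps G.renv_class_simps)
      then show ?thesis using s mc by (simp only: f[OF mm] f[OF s(1)]) (simp add: M.free_act_mult)
    qed
    fix v assume "v \<in> carrier (renv_plus G)"
    then obtain t where t: "t \<in> FP" "v = renv_class G t" by (auto simp: G.renv_plus_simps renv_aug_eq')
    have "u \<oplus>\<^bsub>renv_plus G\<^esub> v = renv_class G (s + t)"
      using s t by (simp add: G.renv_plus_simps G.renv_class_simps)
    then show "?f (u \<oplus>\<^bsub>renv_plus G\<^esub> v) = ?f u \<oplus>\<^bsub>M\<^esub> ?f v"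
      using s t mc by (simp only: f[OF FP_closed(1)[OF s(1) t(1)]] f[OF s(1)] f[OF t(1)]) (simp add: M.free_act_add)
  qed simp
  then have "?f \<in> lin_maps_deg (renv_plus G) M 0"
  proof (rule lin_maps_degI)
    fix i u assume "u \<in> part (renv_plus G) i"
    then obtain t where t: "t \<in> part (free_alg G) i" "u = renv_class G t" "u \<in> G.renv_aug"
      by (auto simp: G.renv_plus_simps G.renv_class_simps)
    have "t \<in> carrier (free_alg G)" using t(1) by (simp add: free_alg_def)
    then show "?f u \<in> part M (0 + i)"
      using t M.free_act_part[OF t(1) m] mc by (simp add: G.renv_plus_simps renv_act_class[OF G M])
  qed
  moreover have "?f (u \<otimes>\<^bsub>renv_plus G\<^esub> v) = renv_act M u (?f v)"
    if "u \<in> carrier (renv_plus G)" "v \<in> carrier (renv_plus G)" for u v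
  proof -
    obtain s t where st: "s \<in> FP" "u = renv_class G s" "t \<in> FP" "v = renv_class G t"
      using \<open>u \<in> _\<close> \<open>v \<in> _\<close> by (auto simp: G.renv_plus_simps renv_aug_eq')
    have st': "s * t \<in> FP" using FP_closed(2)[of s t] st by simp
    have uv: "u \<otimes>\<^bsub>renv_plus G\<^esub> v = renv_class G (s * t)"
      using st by (simp add: G.renv_plus_simps G.renv_class_simps)
    show ?thesis
      unfolding uv f[OF st'] using st mc
      by (simp only: f[OF st(3)]) (simp add: M.free_act_mult renv_act_class[OF G M])
  qed
  ultimately show "?f \<in> Z1_res G M" by (simp add: Z1_res_def)
  show "res_incl G ?f = (\<lambda>x\<in>carrier G. act M x m)"
  proof
    fix x show "res_incl G ?f x = (\<lambda>x\<in>carrier G. act M x m) x"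
    proof (cases "x \<in> carrier G")
      case True
      then show ?thesis using f[OF FP_closed(3)[OF True]] mc by (simp add: res_incl_def G.renv_class_simps)
    qed (simp add: res_incl_def)
  qed
qed

end


section \<open>Extensions and their cocycles\<close>

text \<open>For even \<open>m\<close> all signs are 1, so \<open>x\<close> need not be homogeneous.
  Differences of sections are maps of this kind, and their coboundaries have to be known on the
  whole carrier of \<open>G\<close>.\<close>

lemma act_hom_gmodule_deg0:
  assumes NK: "gmodule G N" "gmodule G K" and x: "x \<in> carrier G" and m: "m \<in> lin_maps_deg N K 0" and a: "a \<in> carrier N"
  shows "act (hom_gmodule G N K) x m a = act K x (m a) \<ominus>\<^bsub>K\<^esub> m (act N x a)"
proof -
  interpret N: gmodule G N by (fact NK)
  interpret K: gmodule G K by (fact NK)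
  interpret H: superspace "hom_space N K"
    by (rule superspace_hom_space[OF N.V.superspace_axioms K.V.superspace_axioms])
  have mc: "component (hom_space N K) l m = (if 0 = l then m else \<zero>\<^bsub>hom_space N K\<^esub>)" for l
    by (rule H.component_part) (simp add: m)
  note ml = lin_mapsD[OF lin_maps_degD(1)[OF m]]
  have "act N x a = act N (component G 0 x) a \<oplus>\<^bsub>N\<^esub> act N (component G 1 x) a"
    using N.act_add_left[of "component G 0 x" "component G 1 x" a] N.G.component_sum[OF x, of 0] x a by simp
  then have "m (act N x a) = m (act N (component G 0 x) a) \<oplus>\<^bsub>K\<^esub> m (act N (component G 1 x) a)"
    using x a by (simp add: ml)
  then show ?thesis
    using x a by (simp add: act_hom_gmodule[OF NK x lin_maps_degD(1)[OF m] a] mc ml K.V.group_simps)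
qed

lemma extensionsD:
  assumes "(E, \<iota>, \<phi>) \<in> extensions G K N"
  shows "gmodule G E" "\<iota> \<in> lin_maps_deg K E 0" "\<iota> \<in> lin_maps K E" "inj_on \<iota> (carrier K)"
    "\<phi> \<in> lin_maps_deg E N 0" "\<phi> \<in> lin_maps E N" "\<phi> ` carrier E = carrier N"
    "\<iota> ` carrier K = {e \<in> carrier E. \<phi> e = \<zero>\<^bsub>N\<^esub>}"
    "\<And>x k. \<lbrakk>x \<in> carrier G; k \<in> carrier K\<rbrakk> \<Longrightarrow> \<iota> (act K x k) = act E x (\<iota> k)"
    "\<And>x e. \<lbrakk>x \<in> carrier G; e \<in> carrier E\<rbrakk> \<Longrightarrow> \<phi> (act E x e) = act N x (\<phi> e)"
  using assms by (auto simp: extensions_def gmod_homs_def lin_maps_deg_def)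

text \<open>With a section fixed, the cocycle becomes a function determined by the data. The element
  type of \<open>E\<close> is left open, so that twisted sums, fibre products and quotients of these
  can be taken for \<open>E\<close>.\<close>

locale sectioned_extension = K: gmodule G K + N: gmodule G N
  for G :: "('k::field, 'g, 'x) lie_super_scheme" and K :: "('k, 'g, 'v) gmodule" and N :: "('k, 'g, 'w) gmodule" +
  fixes E :: "('k, 'g, 'e) gmodule" and \<iota> \<phi> \<sigma>
  assumes exten: "(E, \<iota>, \<phi>) \<in> extensions G K N" and sec: "\<sigma> \<in> even_sections N (E, \<iota>, \<phi>)"
begin

sublocale E: gmodule G E by (rule extensionsD(1)[OF exten])

sublocale M: gmodule G "hom_gmodule G N K"
  by (rule gmodule_hom_gmodule[OF N.gmodule_axioms K.gmodule_axioms])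

abbreviation M where "M \<equiv> hom_gmodule G N K"
abbreviation f where "f \<equiv> ext_cocycle G K N (E, \<iota>, \<phi>) \<sigma>"

lemmas \<iota> = lin_mapsD(1-3)[OF extensionsD(3)[OF exten]]
lemmas \<phi> = lin_mapsD(1-3)[OF extensionsD(6)[OF exten]]
lemmas \<iota>_minus = lin_maps_minus[OF K.V.superspace_axioms E.V.superspace_axioms extensionsD(3)[OF exten]]
lemmas \<phi>_minus = lin_maps_minus[OF E.V.superspace_axioms N.V.superspace_axioms extensionsD(6)[OF exten]]
lemmas \<iota>_zero = lin_maps_zero[OF K.V.superspace_axioms E.V.superspace_axioms extensionsD(3)[OF exten]]
lemmas \<iota>_act = extensionsD(9)[OF exten]
lemmas \<phi>_act = extensionsD(10)[OF exten]
lemmas \<iota>_part = lin_maps_degD(2)[OF extensionsD(2)[OF exten], simplified]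
lemmas \<phi>_part = lin_maps_degD(2)[OF extensionsD(5)[OF exten], simplified]

lemma \<sigma>_deg: "\<sigma> \<in> lin_maps_deg N E 0" and \<phi>_\<sigma>: "a \<in> carrier N \<Longrightarrow> \<phi> (\<sigma> a) = a"
  using sec by (auto simp: even_sections_def)

lemmas \<sigma> = lin_mapsD(1-3)[OF lin_maps_degD(1)[OF \<sigma>_deg]]
lemmas \<sigma>_minus = lin_maps_minus[OF N.V.superspace_axioms E.V.superspace_axioms lin_maps_degD(1)[OF \<sigma>_deg]]
lemmas \<sigma>_zero = lin_maps_zero[OF N.V.superspace_axioms E.V.superspace_axioms lin_maps_degD(1)[OF \<sigma>_deg]]
lemmas \<sigma>_part = lin_maps_degD(2)[OF \<sigma>_deg, simplified]

text \<open>Identities in \<open>K\<close> are mostly proved below in this way: their images under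
  \<open>\<iota>\<close> are computations in \<open>E\<close>.\<close>

lemma \<iota>_eq_iff: "\<lbrakk>k \<in> carrier K; l \<in> carrier K\<rbrakk> \<Longrightarrow> \<iota> k = \<iota> l \<longleftrightarrow> k = l"
  using extensionsD(4)[OF exten] by (auto simp: inj_on_def)

lemma \<phi>_\<iota>: "k \<in> carrier K \<Longrightarrow> \<phi> (\<iota> k) = \<zero>\<^bsub>N\<^esub>"
  using extensionsD(8)[OF exten] by auto

lemma kernelE:
  assumes "e \<in> carrier E" "\<phi> e = \<zero>\<^bsub>N\<^esub>"
  obtains k where "k \<in> carrier K" "e = \<iota> k"
  using extensionsD(8)[OF exten] assms by blast

text \<open>An even injection also reflects degrees, since it carries the components of
  \<open>k\<close> to those of \<open>\<iota> k\<close>.\<close>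

lemma \<iota>_part_iff: "k \<in> carrier K \<Longrightarrow> \<iota> k \<in> part E i \<longleftrightarrow> k \<in> part K i"
proof
  assume k: "k \<in> carrier K" "\<iota> k \<in> part E i"
  let ?a = "component K i k" and ?b = "component K (i + 1) k"
  have "\<iota> k = \<iota> ?a \<oplus>\<^bsub>E\<^esub> \<iota> ?b" using k \<iota>(2)[of ?a ?b] K.V.component_sum[of k i] by simp
  then have "component E i (\<iota> k) = \<iota> ?a" using k \<iota>_part E.V.component_eqI by simp
  then have "\<iota> k = \<iota> ?a" using E.V.component_part[OF k(2)] by simp
  then have "k = ?a" using k by (simp add: \<iota>_eq_iff)
  then show "k \<in> part K i" using k by (metis K.V.component_in_part)
qed (rule \<iota>_part)

lemma cocycle:
  assumes "x \<in> carrier G" "a \<in> carrier N"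
  shows "f x a \<in> carrier K" "\<iota> (f x a) = act E x (\<sigma> a) \<ominus>\<^bsub>E\<^esub> \<sigma> (act N x a)"
proof -
  let ?e = "act E x (\<sigma> a) \<ominus>\<^bsub>E\<^esub> \<sigma> (act N x a)"
  have "?e \<in> carrier E" "\<phi> ?e = \<zero>\<^bsub>N\<^esub>"
    using assms \<sigma> by (auto simp: \<phi>_minus \<phi>_act \<phi>_\<sigma>)
  then have e: "?e \<in> \<iota> ` carrier K" using extensionsD(8)[OF exten] by auto
  show "f x a \<in> carrier K" "\<iota> (f x a) = ?e"
    using assms inv_into_into[OF e] f_inv_into_f[OF e] by (simp_all add: ext_cocycle_def)
qed

text \<open>\<open>ext_cocycle\<close> is defined by \<open>inv_into\<close>. Here it is
  characterised by the equation that its values satisfy, which is how the cocycles of all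
  constructed extensions are found.\<close>

lemma cocycleI:
  assumes g: "\<And>x a. \<lbrakk>x \<in> carrier G; a \<in> carrier N\<rbrakk> \<Longrightarrow> g x a \<in> carrier K"
      "\<And>x a. \<lbrakk>x \<in> carrier G; a \<in> carrier N\<rbrakk> \<Longrightarrow> \<iota> (g x a) = act E x (\<sigma> a) \<ominus>\<^bsub>E\<^esub> \<sigma> (act N x a)"
    and u: "\<And>x. x \<notin> carrier G \<Longrightarrow> g x = undefined"
      "\<And>x a. x \<in> carrier G \<Longrightarrow> a \<notin> carrier N \<Longrightarrow> g x a = undefined"
  shows "f = g"
proof (intro ext)
  fix x a
  show "f x a = g x a"
  proof (cases "x \<in> carrier G \<and> a \<in> carrier N")
    case True
    then show ?thesis using cocycle[of x a] g[of x a] by (simp flip: \<iota>_eq_iff)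
  next
    case False
    then show ?thesis by (auto simp: ext_cocycle_def u)
  qed
qed

lemma cocycle_lin: assumes x: "x \<in> carrier G" shows "f x \<in> lin_maps N K"
proof (rule lin_mapsI)
  show "f x (a \<oplus>\<^bsub>N\<^esub> b) = f x a \<oplus>\<^bsub>K\<^esub> f x b" if "a \<in> carrier N" "b \<in> carrier N" for a b
    using x that \<sigma>
    by (simp add: cocycle \<iota> N.act_add_right E.act_add_right E.V.group_simps flip: \<iota>_eq_iff)
  show "f x (c \<odot>\<^bsub>N\<^esub> a) = c \<odot>\<^bsub>K\<^esub> f x a" if "a \<in> carrier N" for a c
    using x that \<sigma>
    by (simp add: cocycle \<iota> N.act_smult_right E.act_smult_right E.V.smult_simps flip: \<iota>_eq_iff)
qed (use x in \<open>auto simp: cocycle(1)\<close>, simp add: ext_cocycle_def)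

lemma cocycle_deg: assumes x: "x \<in> part G i" shows "f x \<in> lin_maps_deg N K i"
proof (rule lin_maps_degI)
  have xc: "x \<in> carrier G" using x by (rule K.G.part_carrier)
  show "f x \<in> lin_maps N K" by (rule cocycle_lin[OF xc])
  fix j a assume a: "a \<in> part N j"
  then have ac: "a \<in> carrier N" by (rule N.V.part_carrier)
  have "\<iota> (f x a) \<in> part E (i + j)"
    unfolding cocycle(2)[OF xc ac]
    by (intro E.V.part_closed E.act_part x \<sigma>_part a N.act_part)
  then show "f x a \<in> part K (i + j)" using cocycle(1)[OF xc ac] by (simp add: \<iota>_part_iff)
qed

text \<open>Evaluated at \<open>a\<close> and mapped to \<open>E\<close>, the identity combines the
  bracket relation of \<open>E\<close> at \<open>\<sigma> a\<close> with the image under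
  \<open>\<sigma>\<close> of the bracket relation of \<open>N\<close> at \<open>a\<close>; the mixed
  terms match.\<close>

lemma cocycle_Z1: "f \<in> Z1 G M"
proof -
  have lin: "f \<in> lin_maps G M"
  proof (rule lin_mapsI)
    show "f x \<in> carrier M" if "x \<in> carrier G" for x using cocycle_lin[OF that] by simp
    show "f (x \<oplus>\<^bsub>G\<^esub> y) = f x \<oplus>\<^bsub>M\<^esub> f y" if xy: "x \<in> carrier G" "y \<in> carrier G" for x y
    proof (rule lin_maps_eqI)
      show "f (x \<oplus>\<^bsub>G\<^esub> y) \<in> lin_maps N K" using xy cocycle_lin by simp
      show "f x \<oplus>\<^bsub>M\<^esub> f y \<in> lin_maps N K" using M.V.a_closed[of "f x" "f y"] cocycle_lin xy by simp
      show "f (x \<oplus>\<^bsub>G\<^esub> y) a = (f x \<oplus>\<^bsub>M\<^esub> f y) a" if "a \<in> carrier N" for a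
        using xy that \<sigma>
        by (simp add: cocycle \<iota> N.act_add_left E.act_add_left E.V.group_simps flip: \<iota>_eq_iff)
    qed
    show "f (c \<odot>\<^bsub>G\<^esub> x) = c \<odot>\<^bsub>M\<^esub> f x" if x: "x \<in> carrier G" for c x
    proof (rule lin_maps_eqI)
      show "f (c \<odot>\<^bsub>G\<^esub> x) \<in> lin_maps N K" using x cocycle_lin by simp
      show "c \<odot>\<^bsub>M\<^esub> f x \<in> lin_maps N K" using M.V.smultC[of "f x" c] cocycle_lin x by simp
      show "f (c \<odot>\<^bsub>G\<^esub> x) a = (c \<odot>\<^bsub>M\<^esub> f x) a" if "a \<in> carrier N" for a
        using x that \<sigma>
        by (simp add: cocycle \<iota> N.act_smult_left E.act_smult_left E.V.smult_simps flip: \<iota>_eq_iff)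
    qed
  qed (simp add: ext_cocycle_def)
  have deg: "f \<in> lin_maps_deg G M 0" by (rule lin_maps_degI[OF lin]) (simp add: cocycle_deg)
  have "f (bracket G x y) = act M x (f y) \<ominus>\<^bsub>M\<^esub> koszul i j \<odot>\<^bsub>M\<^esub> act M y (f x)"
    if x: "x \<in> part G i" and y: "y \<in> part G j" for i j x y
  proof -
    have b: "bracket G x y \<in> part G (i + j)" by (rule K.G.bracket_part[OF x y])
    note c = K.G.part_carrier[OF x] K.G.part_carrier[OF y] K.G.part_carrier[OF b]
    have l: "f x \<in> carrier M" "f y \<in> carrier M" "f (bracket G x y) \<in> carrier M" using cocycle_lin c by simp_all
    have "f (bracket G x y) \<oplus>\<^bsub>M\<^esub> koszul i j \<odot>\<^bsub>M\<^esub> act M y (f x) = act M x (f y)"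
    proof (rule lin_maps_eqI)
      show "f (bracket G x y) \<oplus>\<^bsub>M\<^esub> koszul i j \<odot>\<^bsub>M\<^esub> act M y (f x) \<in> lin_maps N K" "act M x (f y) \<in> lin_maps N K"
        using M.V.a_closed[OF l(3) M.V.smultC[OF M.act_closed[OF c(2) l(1)], of "koszul i j"]]
          M.act_closed[OF c(1) l(2)] by simp_all
      fix a assume a: "a \<in> carrier N"
      have e1: "act M x (f y) a = act K x (f y a) \<ominus>\<^bsub>K\<^esub> koszul i j \<odot>\<^bsub>K\<^esub> f y (act N x a)"
        by (rule act_hom_gmodule_homogeneous[OF N.gmodule_axioms K.gmodule_axioms x cocycle_deg[OF y] a])
      have e2: "act M y (f x) a = act K y (f x a) \<ominus>\<^bsub>K\<^esub> koszul j i \<odot>\<^bsub>K\<^esub> f x (act N y a)"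
        by (rule act_hom_gmodule_homogeneous[OF N.gmodule_axioms K.gmodule_axioms y cocycle_deg[OF x] a])
      have cl: "f x a \<in> carrier K" "f y a \<in> carrier K" "f (bracket G x y) a \<in> carrier K"
        "f y (act N x a) \<in> carrier K" "f x (act N y a) \<in> carrier K" using cocycle(1) c a by simp_all
      have "\<iota> (f (bracket G x y) a \<oplus>\<^bsub>K\<^esub> koszul i j \<odot>\<^bsub>K\<^esub> act M y (f x) a) = \<iota> (act M x (f y) a)"
        using c a cl \<sigma> bit_cases[of i] bit_cases[of j]
        by (auto simp: e1 e2 \<iota> \<iota>_minus \<iota>_act cocycle(2) koszul_def E.act_bracket[OF x y] N.act_bracket[OF x y]
            \<sigma>_minus E.V.group_simps)
      moreover have "act M y (f x) a \<in> carrier K" "act M x (f y) a \<in> carrier K"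
        using cl c by (simp_all add: e1 e2)
      ultimately show "(f (bracket G x y) \<oplus>\<^bsub>M\<^esub> koszul i j \<odot>\<^bsub>M\<^esub> act M y (f x)) a = act M x (f y) a"
        using a cl by (simp add: \<iota>_eq_iff)
    qed
    then show ?thesis
      using M.V.group_simps(6)[OF M.act_closed[OF c(1) l(2)] M.V.smultC[OF M.act_closed[OF c(2) l(1)]] l(3)] by blast
  qed
  with deg show ?thesis by (simp add: Z1_def)
qed

text \<open>Coordinates on \<open>E\<close>: an even linear bijection from pairs in \<open>K\<close>
  and \<open>N\<close>, under which the action of \<open>G\<close> is that of the twisted sum by the
  cocycle.\<close>

definition \<theta> where "\<theta> k a = \<iota> k \<oplus>\<^bsub>E\<^esub> \<sigma> a"

lemma \<theta>_simps:
  "\<lbrakk>k \<in> carrier K; a \<in> carrier N\<rbrakk> \<Longrightarrow> \<theta> k a \<in> carrier E"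
  "\<lbrakk>k \<in> carrier K; a \<in> carrier N; l \<in> carrier K; b \<in> carrier N\<rbrakk> \<Longrightarrow>
    \<theta> (k \<oplus>\<^bsub>K\<^esub> l) (a \<oplus>\<^bsub>N\<^esub> b) = \<theta> k a \<oplus>\<^bsub>E\<^esub> \<theta> l b"
  "\<lbrakk>k \<in> carrier K; a \<in> carrier N\<rbrakk> \<Longrightarrow> \<theta> (c \<odot>\<^bsub>K\<^esub> k) (c \<odot>\<^bsub>N\<^esub> a) = c \<odot>\<^bsub>E\<^esub> \<theta> k a"
  "\<lbrakk>x \<in> carrier G; k \<in> carrier K; a \<in> carrier N\<rbrakk> \<Longrightarrow> \<theta> (act K x k \<oplus>\<^bsub>K\<^esub> f x a) (act N x a) = act E x (\<theta> k a)"
  "\<lbrakk>k \<in> carrier K; a \<in> carrier N\<rbrakk> \<Longrightarrow> \<phi> (\<theta> k a) = a"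
  "k \<in> carrier K \<Longrightarrow> \<theta> k \<zero>\<^bsub>N\<^esub> = \<iota> k"
  "\<lbrakk>k \<in> part K i; a \<in> part N i\<rbrakk> \<Longrightarrow> \<theta> k a \<in> part E i"
  using \<iota> \<sigma> \<iota>_part \<sigma>_part
  by (auto simp: \<theta>_def E.V.group_simps E.V.smult_simps E.act_add_right cocycle \<iota>_act \<phi> \<phi>_\<iota> \<phi>_\<sigma> \<sigma>_zero)

lemma \<theta>_surj:
  assumes e: "e \<in> carrier E" obtains k a where "k \<in> carrier K" "a \<in> carrier N" "e = \<theta> k a"
proof -
  have c: "\<phi> e \<in> carrier N" "\<sigma> (\<phi> e) \<in> carrier E" using e \<phi> \<sigma> by simp_all
  then have "\<phi> (e \<ominus>\<^bsub>E\<^esub> \<sigma> (\<phi> e)) = \<zero>\<^bsub>N\<^esub>" using e by (simp add: \<phi>_minus \<phi>_\<sigma>)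
  then obtain k where k: "k \<in> carrier K" "e \<ominus>\<^bsub>E\<^esub> \<sigma> (\<phi> e) = \<iota> k" using kernelE e c by (metis E.V.minus_closed)
  then have "e = \<theta> k (\<phi> e)" using e c \<iota> by (simp add: \<theta>_def E.V.group_simps)
  with k c that show thesis by blast
qed

lemma \<theta>_inj:
  assumes "k \<in> carrier K" "a \<in> carrier N" "l \<in> carrier K" "b \<in> carrier N" "\<theta> k a = \<theta> l b"
  shows "k = l" "a = b"
proof -
  show ab: "a = b" using \<theta>_simps(5)[OF assms(1,2)] \<theta>_simps(5)[OF assms(3,4)] assms(5) by simp
  then show "k = l" using assms \<iota> \<sigma> by (simp add: \<theta>_def \<iota>_eq_iff)
qed

lemma \<theta>_part_iff:
  assumes k: "k \<in> carrier K" and a: "a \<in> carrier N"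
  shows "\<theta> k a \<in> part E i \<longleftrightarrow> k \<in> part K i \<and> a \<in> part N i"
proof
  assume p: "\<theta> k a \<in> part E i"
  then have pa: "a \<in> part N i" using \<phi>_part[OF p] \<theta>_simps(5)[OF k a] by simp
  have "\<theta> k a \<ominus>\<^bsub>E\<^esub> \<sigma> a \<in> part E i" using p \<sigma>_part[OF pa] by blast
  moreover have "\<theta> k a \<ominus>\<^bsub>E\<^esub> \<sigma> a = \<iota> k" using k a \<iota> \<sigma> by (simp add: \<theta>_def E.V.group_simps)
  ultimately show "k \<in> part K i \<and> a \<in> part N i" using pa k by (simp add: \<iota>_part_iff)
qed (simp add: \<theta>_simps)

end

text \<open>The invariant by which extensions are compared. It depends on no choice of section, its
  type does not involve the element type of the extension, and the inner union in
  \<open>F_map\<close> ranges over the cosets of its members.\<close>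

definition cocycles ::
    "('k::field, 'g, 'x) lie_super_scheme \<Rightarrow> ('k, 'g, 'v) gmodule \<Rightarrow> ('k, 'g, 'w) gmodule \<Rightarrow>
     ('k, 'g, 'v, 'w, 'e) extension \<Rightarrow> ('g \<Rightarrow> 'w \<Rightarrow> 'v) set"
  where "cocycles G K N \<xi> = ext_cocycle G K N \<xi> ` even_sections N \<xi>"

section \<open>Change of section\<close>

context sectioned_extension
begin

text \<open>Two sections differ by an even map into the kernel, which is a map \<open>m\<close> into
  \<open>K\<close> followed by \<open>\<iota>\<close>. The cocycle changes by the coboundary of
  \<open>m\<close>.\<close>

lemma change_section:
  assumes \<tau>: "\<tau> \<in> even_sections N (E, \<iota>, \<phi>)"
  shows "\<exists>m\<in>lin_maps_deg N K 0. ext_cocycle G K N (E, \<iota>, \<phi>) \<tau> = (\<lambda>x\<in>carrier G. act M x m \<oplus>\<^bsub>M\<^esub> f x)"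
proof -
  interpret T: sectioned_extension G K N E \<iota> \<phi> \<tau> by unfold_locales (fact exten \<tau>)+
  define m where "m = (\<lambda>a\<in>carrier N. inv_into (carrier K) \<iota> (\<tau> a \<ominus>\<^bsub>E\<^esub> \<sigma> a))"
  have m: "m a \<in> carrier K" "\<iota> (m a) = \<tau> a \<ominus>\<^bsub>E\<^esub> \<sigma> a" if a: "a \<in> carrier N" for a
  proof -
    have "\<tau> a \<ominus>\<^bsub>E\<^esub> \<sigma> a \<in> carrier E" "\<phi> (\<tau> a \<ominus>\<^bsub>E\<^esub> \<sigma> a) = \<zero>\<^bsub>N\<^esub>"
      using a \<sigma> T.\<sigma> by (auto simp: \<phi>_minus \<phi>_\<sigma> T.\<phi>_\<sigma>)
    then have "\<tau> a \<ominus>\<^bsub>E\<^esub> \<sigma> a \<in> \<iota> ` carrier K" using extensionsD(8)[OF exten] by auto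
    then show "m a \<in> carrier K" "\<iota> (m a) = \<tau> a \<ominus>\<^bsub>E\<^esub> \<sigma> a"
      using a by (simp_all add: m_def inv_into_into f_inv_into_f)
  qed
  have ml: "m \<in> lin_maps N K"
  proof (rule lin_mapsI)
    show "m (a \<oplus>\<^bsub>N\<^esub> b) = m a \<oplus>\<^bsub>K\<^esub> m b" if "a \<in> carrier N" "b \<in> carrier N" for a b
      using that \<sigma> T.\<sigma> by (simp add: m \<iota> E.V.group_simps flip: \<iota>_eq_iff)
    show "m (c \<odot>\<^bsub>N\<^esub> a) = c \<odot>\<^bsub>K\<^esub> m a" if "a \<in> carrier N" for c a
      using that \<sigma> T.\<sigma> by (simp add: m \<iota> E.V.smult_simps flip: \<iota>_eq_iff)
  qed (auto simp: m(1), simp add: m_def)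
  have md: "m \<in> lin_maps_deg N K 0"
  proof (rule lin_maps_degI[OF ml])
    fix i a assume a: "a \<in> part N i"
    then have ac: "a \<in> carrier N" by (rule N.V.part_carrier)
    have "\<iota> (m a) \<in> part E i" unfolding m(2)[OF ac] using \<sigma>_part[OF a] T.\<sigma>_part[OF a] by blast
    then show "m a \<in> part K (0 + i)" using m(1)[OF ac] by (simp add: \<iota>_part_iff)
  qed
  have act_m: "act M x m a = act K x (m a) \<ominus>\<^bsub>K\<^esub> m (act N x a)" if "x \<in> carrier G" "a \<in> carrier N" for x a
    by (rule act_hom_gmodule_deg0[OF N.gmodule_axioms K.gmodule_axioms that(1) md that(2)])
  have "ext_cocycle G K N (E, \<iota>, \<phi>) \<tau> = (\<lambda>x\<in>carrier G. act M x m \<oplus>\<^bsub>M\<^esub> f x)"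
  proof (rule T.cocycleI)
    fix x a assume xa: "x \<in> carrier G" "a \<in> carrier N"
    then show "(\<lambda>x\<in>carrier G. act M x m \<oplus>\<^bsub>M\<^esub> f x) x a \<in> carrier K"
      by (simp add: act_m m cocycle(1))
    show "\<iota> ((\<lambda>x\<in>carrier G. act M x m \<oplus>\<^bsub>M\<^esub> f x) x a) = act E x (\<tau> a) \<ominus>\<^bsub>E\<^esub> \<tau> (act N x a)"
      using xa \<sigma> T.\<sigma> by (simp add: act_m m cocycle \<iota> \<iota>_minus \<iota>_act E.V.group_simps)
  qed auto
  with md show ?thesis by blast
qed

text \<open>Adding \<iota> \<circ> m to \<open>\<sigma>\<close> gives another even section. Every
  element of the coset of a cocycle is therefore the cocycle of some section.\<close>

lemma shift_section:
  assumes m: "m \<in> lin_maps_deg N K 0"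
  shows "\<exists>\<tau>\<in>even_sections N (E, \<iota>, \<phi>). ext_cocycle G K N (E, \<iota>, \<phi>) \<tau> = (\<lambda>x\<in>carrier G. act M x m \<oplus>\<^bsub>M\<^esub> f x)"
proof -
  note ml = lin_mapsD[OF lin_maps_degD(1)[OF m]]
  define \<tau> where "\<tau> = (\<lambda>a\<in>carrier N. \<iota> (m a) \<oplus>\<^bsub>E\<^esub> \<sigma> a)"
  have "\<tau> \<in> lin_maps N E"
    by (rule lin_mapsI) (use \<sigma> in \<open>auto simp: \<tau>_def ml \<iota> E.V.smult_simps E.V.group_simps\<close>)
  then have "\<tau> \<in> lin_maps_deg N E 0"
    by (rule lin_maps_degI)
      (use lin_maps_degD(2)[OF m] \<iota>_part \<sigma>_part N.V.part_carrier in \<open>auto simp: \<tau>_def\<close>)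
  moreover have "\<phi> (\<tau> a) = a" if "a \<in> carrier N" for a
    using that \<sigma> by (simp add: \<tau>_def ml \<iota> \<phi> \<phi>_\<iota> \<phi>_\<sigma>)
  ultimately have \<tau>: "\<tau> \<in> even_sections N (E, \<iota>, \<phi>)" by (simp add: even_sections_def)
  interpret T: sectioned_extension G K N E \<iota> \<phi> \<tau> by unfold_locales (fact exten \<tau>)+
  have act_m: "act M x m a = act K x (m a) \<ominus>\<^bsub>K\<^esub> m (act N x a)" if "x \<in> carrier G" "a \<in> carrier N" for x a
    by (rule act_hom_gmodule_deg0[OF N.gmodule_axioms K.gmodule_axioms that(1) m that(2)])
  have "ext_cocycle G K N (E, \<iota>, \<phi>) \<tau> = (\<lambda>x\<in>carrier G. act M x m \<oplus>\<^bsub>M\<^esub> f x)"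
  proof (rule T.cocycleI)
    fix x a assume xa: "x \<in> carrier G" "a \<in> carrier N"
    then show "(\<lambda>x\<in>carrier G. act M x m \<oplus>\<^bsub>M\<^esub> f x) x a \<in> carrier K"
      by (simp add: act_m ml cocycle(1))
    show "\<iota> ((\<lambda>x\<in>carrier G. act M x m \<oplus>\<^bsub>M\<^esub> f x) x a) = act E x (\<tau> a) \<ominus>\<^bsub>E\<^esub> \<tau> (act N x a)"
      using xa \<sigma> by (simp add: \<tau>_def act_m ml cocycle \<iota> \<iota>_minus \<iota>_act E.act_add_right E.V.group_simps)
  qed auto
  with \<tau> show ?thesis by blast
qed

lemma cocycles_eq_coset: "cocycles G K N (E, \<iota>, \<phi>) = B1 G M +>\<^bsub>hom_space G M\<^esub> f"
proof
  show "cocycles G K N (E, \<iota>, \<phi>) \<subseteq> B1 G M +>\<^bsub>hom_space G M\<^esub> f"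
  proof
    fix g assume "g \<in> cocycles G K N (E, \<iota>, \<phi>)"
    then obtain \<tau> where "\<tau> \<in> even_sections N (E, \<iota>, \<phi>)" "g = ext_cocycle G K N (E, \<iota>, \<phi>) \<tau>"
      by (auto simp: cocycles_def)
    then obtain m where "m \<in> lin_maps_deg N K 0" "g = (\<lambda>x\<in>carrier G. act M x m \<oplus>\<^bsub>M\<^esub> f x)"
      using change_section by blast
    then show "g \<in> B1 G M +>\<^bsub>hom_space G M\<^esub> f"
      by (auto simp: a_r_coset_def' B1_def simp del: hom_gmodule_simps(3) intro!: exI[of _ "\<lambda>x\<in>carrier G. act M x m"] exI[of _ m] restrict_ext)
  qed
  show "B1 G M +>\<^bsub>hom_space G M\<^esub> f \<subseteq> cocycles G K N (E, \<iota>, \<phi>)"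
  proof
    fix g assume "g \<in> B1 G M +>\<^bsub>hom_space G M\<^esub> f"
    then obtain m where m: "m \<in> lin_maps_deg N K 0"
      "g = (\<lambda>x\<in>carrier G. (\<lambda>x\<in>carrier G. act M x m) x \<oplus>\<^bsub>M\<^esub> f x)"
      by (auto simp: a_r_coset_def' B1_def simp del: hom_gmodule_simps(3))
    have g: "g = (\<lambda>x\<in>carrier G. act M x m \<oplus>\<^bsub>M\<^esub> f x)" unfolding m(2) by (rule restrict_ext) simp
    show "g \<in> cocycles G K N (E, \<iota>, \<phi>)"
      using shift_section[OF m(1), folded g] by (auto simp: cocycles_def)
  qed
qed

end

lemma extensions_section:
  assumes "gmodule G K" "gmodule G N" "(E, \<iota>, \<phi>) \<in> extensions G K N"
  obtains \<sigma> where "sectioned_extension G K N E \<iota> \<phi> \<sigma>"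
proof -
  interpret E: gmodule G E by (rule extensionsD(1)[OF assms(3)])
  interpret N: gmodule G N by fact
  obtain \<sigma> where "\<sigma> \<in> lin_maps_deg N E 0" "\<And>a. a \<in> carrier N \<Longrightarrow> \<phi> (\<sigma> a) = a"
    using even_section_exists[OF E.V.superspace_axioms N.V.superspace_axioms extensionsD(5,7)[OF assms(3)]] by blast
  then have "sectioned_extension G K N E \<iota> \<phi> \<sigma>"
    by (intro sectioned_extension.intro sectioned_extension_axioms.intro assms) (simp add: even_sections_def)
  then show thesis by (rule that)
qed

text \<open>The isomorphism is \<open>T.\<theta>\<close> after the inverse of
  \<open>S.\<theta>\<close>: in these coordinates both modules are the same twisted sum. The
  coordinates are unique, so the choice in \<open>P\<close> is immaterial.\<close>

lemma ext_equiv_if_same_cocycle: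
  assumes "sectioned_extension G K N E \<iota> \<phi> \<sigma>" "sectioned_extension G K N E' \<iota>' \<phi>' \<sigma>'"
    and eq: "ext_cocycle G K N (E, \<iota>, \<phi>) \<sigma> = ext_cocycle G K N (E', \<iota>', \<phi>') \<sigma>'"
  shows "ext_equiv G K (E, \<iota>, \<phi>) (E', \<iota>', \<phi>')"
proof -
  interpret S: sectioned_extension G K N E \<iota> \<phi> \<sigma> by fact
  interpret T: sectioned_extension G K N E' \<iota>' \<phi>' \<sigma>' by fact
  define P where "P e = (SOME ka. fst ka \<in> carrier K \<and> snd ka \<in> carrier N \<and> e = S.\<theta> (fst ka) (snd ka))" for e
  define \<alpha> where "\<alpha> = (\<lambda>e\<in>carrier E. T.\<theta> (fst (P e)) (snd (P e)))"
  have \<alpha>: "\<alpha> (S.\<theta> k a) = T.\<theta> k a" if ka: "k \<in> carrier K" "a \<in> carrier N" for k a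
  proof -
    have "\<exists>la. fst la \<in> carrier K \<and> snd la \<in> carrier N \<and> S.\<theta> k a = S.\<theta> (fst la) (snd la)"
      by (rule exI[of _ "(k, a)"]) (simp add: ka)
    from someI_ex[OF this] have p: "fst (P (S.\<theta> k a)) \<in> carrier K" "snd (P (S.\<theta> k a)) \<in> carrier N"
      "S.\<theta> k a = S.\<theta> (fst (P (S.\<theta> k a))) (snd (P (S.\<theta> k a)))"
      unfolding P_def by blast+
    show ?thesis
      using S.\<theta>_inj[OF ka p] S.\<theta>_simps(1)[OF ka] by (simp add: \<alpha>_def)
  qed
  have lin: "\<alpha> \<in> lin_maps E E'"
  proof (rule lin_mapsI)
    fix e assume e: "e \<in> carrier E"
    obtain k a where ka: "k \<in> carrier K" "a \<in> carrier N" "e = S.\<theta> k a" using S.\<theta>_surj[OF e] .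
    show "\<alpha> e \<in> carrier E'" using ka \<alpha> T.\<theta>_simps(1) by simp
    show "\<alpha> (c \<odot>\<^bsub>E\<^esub> e) = c \<odot>\<^bsub>E'\<^esub> \<alpha> e" for c
      using ka \<alpha> S.K.V.smultC S.N.V.smultC by (simp flip: S.\<theta>_simps(3) T.\<theta>_simps(3))
    fix e' assume e': "e' \<in> carrier E"
    obtain l b where lb: "l \<in> carrier K" "b \<in> carrier N" "e' = S.\<theta> l b" using S.\<theta>_surj[OF e'] .
    show "\<alpha> (e \<oplus>\<^bsub>E\<^esub> e') = \<alpha> e \<oplus>\<^bsub>E'\<^esub> \<alpha> e'"
      using ka lb \<alpha> by (simp flip: S.\<theta>_simps(2) T.\<theta>_simps(2))
  qed (simp add: \<alpha>_def)
  have "\<alpha> \<in> lin_maps_deg E E' 0"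
  proof (rule lin_maps_degI[OF lin])
    fix i e assume p: "e \<in> part E i"
    obtain k a where ka: "k \<in> carrier K" "a \<in> carrier N" "e = S.\<theta> k a"
      using S.\<theta>_surj[OF S.E.V.part_carrier[OF p]] .
    show "\<alpha> e \<in> part E' (0 + i)" using p S.\<theta>_part_iff T.\<theta>_part_iff ka \<alpha> by simp
  qed
  moreover have "\<alpha> (act E x e) = act E' x (\<alpha> e)" if x: "x \<in> carrier G" and e: "e \<in> carrier E" for x e
  proof -
    obtain k a where ka: "k \<in> carrier K" "a \<in> carrier N" "e = S.\<theta> k a" using S.\<theta>_surj[OF e] .
    have "\<alpha> (act E x e) = T.\<theta> (act K x k \<oplus>\<^bsub>K\<^esub> ext_cocycle G K N (E, \<iota>, \<phi>) \<sigma> x a) (act N x a)"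
      using x ka S.cocycle(1) by (simp add: \<alpha> flip: S.\<theta>_simps(4))
    also have "\<dots> = act E' x (\<alpha> e)" using x ka by (simp only: eq T.\<theta>_simps(4) \<alpha>)
    finally show ?thesis .
  qed
  ultimately have hom: "\<alpha> \<in> gmod_homs G E E'" by (simp add: gmod_homs_def)
  have bij: "bij_betw \<alpha> (carrier E) (carrier E')"
  proof (rule bij_betwI')
    fix e e' assume e: "e \<in> carrier E" "e' \<in> carrier E"
    obtain k a where ka: "k \<in> carrier K" "a \<in> carrier N" "e = S.\<theta> k a" using S.\<theta>_surj[OF e(1)] .
    obtain l b where lb: "l \<in> carrier K" "b \<in> carrier N" "e' = S.\<theta> l b" using S.\<theta>_surj[OF e(2)] .
    have "e = e'" if "\<alpha> e = \<alpha> e'"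
      using T.\<theta>_inj[OF ka(1,2) lb(1,2)] that unfolding ka(3) lb(3) \<alpha>[OF ka(1,2)] \<alpha>[OF lb(1,2)] by simp
    then show "\<alpha> e = \<alpha> e' \<longleftrightarrow> e = e'" by blast
  next
    show "\<alpha> e \<in> carrier E'" if "e \<in> carrier E" for e using lin_mapsD(1)[OF lin that] .
  next
    fix e' assume e': "e' \<in> carrier E'"
    obtain k a where ka: "k \<in> carrier K" "a \<in> carrier N" "e' = T.\<theta> k a" using T.\<theta>_surj[OF e'] .
    then show "\<exists>e\<in>carrier E. e' = \<alpha> e" using \<alpha> S.\<theta>_simps(1) by metis
  qed
  have "\<alpha> (\<iota> k) = \<iota>' k" if "k \<in> carrier K" for k
    using \<alpha>[OF that, of "\<zero>\<^bsub>N\<^esub>"] that by (simp add: S.\<theta>_simps(6) T.\<theta>_simps(6))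
  moreover have "\<phi>' (\<alpha> e) = \<phi> e" if e: "e \<in> carrier E" for e
  proof -
    obtain k a where ka: "k \<in> carrier K" "a \<in> carrier N" "e = S.\<theta> k a" using S.\<theta>_surj[OF e] .
    then show ?thesis using \<alpha> by (simp add: S.\<theta>_simps(5) T.\<theta>_simps(5))
  qed
  ultimately show ?thesis using hom bij by auto
qed

text \<open>An equivalence \<alpha> carries \<open>\<sigma>\<close> to the section \<alpha> \<circ>
  \<sigma>. The cocycle stays the same because \<alpha> respects the action and the two inclusions
  of \<open>K\<close>.\<close>

lemma ext_equiv_transport_section:
  assumes "sectioned_extension G K N E \<iota> \<phi> \<sigma>" "(E', \<iota>', \<phi>') \<in> extensions G K N"
    and equiv: "ext_equiv G K (E, \<iota>, \<phi>) (E', \<iota>', \<phi>')"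
  obtains \<sigma>' where "sectioned_extension G K N E' \<iota>' \<phi>' \<sigma>'"
    "ext_cocycle G K N (E', \<iota>', \<phi>') \<sigma>' = ext_cocycle G K N (E, \<iota>, \<phi>) \<sigma>"
proof -
  interpret S: sectioned_extension G K N E \<iota> \<phi> \<sigma> by fact
  obtain \<alpha> where \<alpha>: "\<alpha> \<in> gmod_homs G E E'" "\<And>a. a \<in> carrier K \<Longrightarrow> \<alpha> (\<iota> a) = \<iota>' a"
    "\<And>e. e \<in> carrier E \<Longrightarrow> \<phi>' (\<alpha> e) = \<phi> e"
    using equiv by auto
  have E': "gmodule G E'" by (rule extensionsD(1)[OF assms(2)])
  then interpret E': gmodule G E' .
  have deg: "\<alpha> \<in> lin_maps_deg E E' 0" and act: "\<And>x v. \<lbrakk>x \<in> carrier G; v \<in> carrier E\<rbrakk> \<Longrightarrow> \<alpha> (act E x v) = act E' x (\<alpha> v)"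
    using \<alpha>(1) by (auto simp: gmod_homs_def)
  note lin = lin_maps_degD(1)[OF deg]
  note l = lin_mapsD[OF lin]
  define \<sigma>' where "\<sigma>' = (\<lambda>a\<in>carrier N. \<alpha> (\<sigma> a))"
  have "\<sigma>' \<in> lin_maps N E'"
    by (rule lin_mapsI) (auto simp: \<sigma>'_def S.\<sigma> l)
  then have "\<sigma>' \<in> lin_maps_deg N E' 0"
    by (rule lin_maps_degI)
      (use lin_maps_degD(2)[OF deg] S.\<sigma>_part S.N.V.part_carrier in \<open>auto simp: \<sigma>'_def\<close>)
  moreover have "\<phi>' (\<sigma>' a) = a" if "a \<in> carrier N" for a
    using that by (simp add: \<sigma>'_def \<alpha>(3) S.\<sigma> S.\<phi>_\<sigma>)
  ultimately have "sectioned_extension G K N E' \<iota>' \<phi>' \<sigma>'"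
    by (intro sectioned_extension.intro sectioned_extension_axioms.intro assms(2)
        S.K.gmodule_axioms S.N.gmodule_axioms) (simp add: even_sections_def)
  then interpret T: sectioned_extension G K N E' \<iota>' \<phi>' \<sigma>' .
  have "ext_cocycle G K N (E', \<iota>', \<phi>') \<sigma>' = ext_cocycle G K N (E, \<iota>, \<phi>) \<sigma>"
  proof (rule T.cocycleI)
    fix x a assume xa: "x \<in> carrier G" "a \<in> carrier N"
    then show c: "ext_cocycle G K N (E, \<iota>, \<phi>) \<sigma> x a \<in> carrier K" by (rule S.cocycle(1))
    have "\<iota>' (ext_cocycle G K N (E, \<iota>, \<phi>) \<sigma> x a) = \<alpha> (\<iota> (ext_cocycle G K N (E, \<iota>, \<phi>) \<sigma> x a))"
      using \<alpha>(2) c by simp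
    also have "\<dots> = act E' x (\<sigma>' a) \<ominus>\<^bsub>E'\<^esub> \<sigma>' (act N x a)"
      using xa S.\<sigma>
      by (simp add: S.cocycle lin_maps_minus(1)[OF S.E.V.superspace_axioms E'.V.superspace_axioms lin] act \<sigma>'_def)
    finally show "\<iota>' (ext_cocycle G K N (E, \<iota>, \<phi>) \<sigma> x a) = act E' x (\<sigma>' a) \<ominus>\<^bsub>E'\<^esub> \<sigma>' (act N x a)" .
  qed (simp_all add: ext_cocycle_def)
  with T.sectioned_extension_axioms that show thesis by blast
qed

lemma cocycles_nonempty:
  assumes "gmodule G K" "gmodule G N" "\<xi> \<in> extensions G K N"
  shows "\<exists>f. f \<in> cocycles G K N \<xi>"
proof -
  obtain E \<iota> \<phi> where \<xi>: "\<xi> = (E, \<iota>, \<phi>)" by (cases \<xi>)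
  obtain \<sigma> where "sectioned_extension G K N E \<iota> \<phi> \<sigma>" using extensions_section[OF assms(1,2)] assms(3) \<xi> by blast
  then show ?thesis using sectioned_extension.sec by (fastforce simp: cocycles_def \<xi>)
qed

lemma cocyclesD:
  assumes "gmodule G K" "gmodule G N" "\<xi> \<in> extensions G K N" "f \<in> cocycles G K N \<xi>"
  shows "f \<in> Z1 G (hom_gmodule G N K)"
    and "cocycles G K N \<xi> = B1 G (hom_gmodule G N K) +>\<^bsub>hom_space G (hom_gmodule G N K)\<^esub> f"
proof -
  obtain E \<iota> \<phi> where \<xi>: "\<xi> = (E, \<iota>, \<phi>)" by (cases \<xi>)
  obtain \<sigma> where s: "\<sigma> \<in> even_sections N \<xi>" "f = ext_cocycle G K N \<xi> \<sigma>" using assms(4) by (auto simp: cocycles_def)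
  have "sectioned_extension G K N E \<iota> \<phi> \<sigma>"
    by (intro sectioned_extension.intro sectioned_extension_axioms.intro assms(1,2)) (use assms(3) s \<xi> in auto)
  then interpret sectioned_extension G K N E \<iota> \<phi> \<sigma> .
  show "f \<in> Z1 G (hom_gmodule G N K)"
    "cocycles G K N \<xi> = B1 G (hom_gmodule G N K) +>\<^bsub>hom_space G (hom_gmodule G N K)\<^esub> f"
    using cocycle_Z1 cocycles_eq_coset by (simp_all add: s \<xi>)
qed

text \<open>This contains both that \<open>F_map\<close> is well defined and that it is injective.
  An equivalence transports a section together with its cocycle, and two extensions with the same
  set of cocycles have sections with a common one.\<close>

lemma ext_equiv_iff_cocycles:
  assumes "gmodule G K" "gmodule G N" "\<xi> \<in> extensions G K N" "\<eta> \<in> extensions G K N"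
  shows "ext_equiv G K \<xi> \<eta> \<longleftrightarrow> cocycles G K N \<xi> = cocycles G K N \<eta>"
proof
  obtain E \<iota> \<phi> where \<xi>: "\<xi> = (E, \<iota>, \<phi>)" by (cases \<xi>)
  obtain E' \<iota>' \<phi>' where \<eta>: "\<eta> = (E', \<iota>', \<phi>')" by (cases \<eta>)
  {
    assume e: "ext_equiv G K \<xi> \<eta>"
    obtain \<sigma> where S: "sectioned_extension G K N E \<iota> \<phi> \<sigma>" using extensions_section[OF assms(1,2)] assms(3) \<xi> by blast
    obtain \<sigma>' where T: "sectioned_extension G K N E' \<iota>' \<phi>' \<sigma>'"
      "ext_cocycle G K N (E', \<iota>', \<phi>') \<sigma>' = ext_cocycle G K N (E, \<iota>, \<phi>) \<sigma>"
      using ext_equiv_transport_section[OF S] assms(4) e unfolding \<xi> \<eta> by blast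
    show "cocycles G K N \<xi> = cocycles G K N \<eta>"
      using sectioned_extension.cocycles_eq_coset[OF S] sectioned_extension.cocycles_eq_coset[OF T(1)] T(2)
      by (simp add: \<xi> \<eta>)
  next
    assume e: "cocycles G K N \<xi> = cocycles G K N \<eta>"
    obtain \<sigma> where S: "sectioned_extension G K N E \<iota> \<phi> \<sigma>" using extensions_section[OF assms(1,2)] assms(3) \<xi> by blast
    then have "ext_cocycle G K N \<xi> \<sigma> \<in> cocycles G K N \<eta>"
      using sectioned_extension.sec[OF S] unfolding e[symmetric] by (simp add: \<xi> cocycles_def)
    then obtain \<tau> where t: "\<tau> \<in> even_sections N \<eta>" "ext_cocycle G K N \<xi> \<sigma> = ext_cocycle G K N \<eta> \<tau>"
      by (auto simp: cocycles_def)
    have T: "sectioned_extension G K N E' \<iota>' \<phi>' \<tau>"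
      by (intro sectioned_extension.intro sectioned_extension_axioms.intro assms(1,2)) (use assms(4) t \<eta> in auto)
    show "ext_equiv G K \<xi> \<eta>" using ext_equiv_if_same_cocycle[OF S T] t by (simp add: \<xi> \<eta>)
  }
qed

text \<open>Applying \<open>act_hom_gmodule_CHAR_power\<close> to the section, as an element of \<open>Hom(N, E)\<close>, compares
  the \<open>p\<close>-th powers on \<open>E\<close> and on \<open>N\<close>.\<close>

lemma restricted_iff_cocycle:
  fixes G :: "('k::field, 'g, 'x) restricted_lie_super_scheme"
  assumes "CHAR('k) > 0" "restricted_lie_superalgebra G" "restricted_gmodule G K" "restricted_gmodule G N"
    and S: "sectioned_extension G K N E \<iota> \<phi> \<sigma>"
  shows "restricted_gmodule G E \<longleftrightarrow>
    ext_cocycle G K N (E, \<iota>, \<phi>) \<sigma> \<in> Z1_ppow G (hom_gmodule G N K)"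
proof -
  interpret G: restricted_lie_superalgebra G by fact
  interpret K: restricted_gmodule G K by fact
  interpret N: restricted_gmodule G N by fact
  interpret S: sectioned_extension G K N E \<iota> \<phi> \<sigma> by fact
  let ?M = "hom_gmodule G N K" and ?H = "hom_gmodule G N E" and ?f = "ext_cocycle G K N (E, \<iota>, \<phi>) \<sigma>"
  obtain q where q: "CHAR('k) = Suc q" using assms(1) by (metis not0_implies_Suc less_irrefl)
  note NE = N.gmodule_axioms S.E.gmodule_axioms and NK = N.gmodule_axioms K.gmodule_axioms
  \<comment> \<open>The first application of x to \<open>\<sigma>\<close> in the maps from
    \<open>N\<close> to \<open>E\<close> gives \<open>\<iota>\<close> composed with
    \<open>?f x\<close>. The remaining q = p - 1 applications then act on \<open>?f x\<close> inside
    the maps from \<open>N\<close> to \<open>K\<close>.\<close>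
  have key: "\<iota> ((act ?M x ^^ q) (?f x) a) = (act E x ^^ CHAR('k)) (\<sigma> a) \<ominus>\<^bsub>E\<^esub> \<sigma> (act N (ppow G x) a)"
    if x: "x \<in> part G 0" and a: "a \<in> carrier N" for x a
  proof -
    have xc: "x \<in> carrier G" using x G.part_carrier by blast
    have \<sigma>l: "\<sigma> \<in> lin_maps N E" by (rule lin_maps_degD(1)[OF S.\<sigma>_deg])
    let ?j = "\<lambda>m. \<lambda>a\<in>carrier N. \<iota> (m a)"
    have jl: "?j m \<in> lin_maps N E" if "m \<in> lin_maps N K" for m
      by (rule lin_mapsI) (use lin_mapsD[OF that] in \<open>auto simp: S.\<iota>\<close>)
    have Hl: "act ?H x m \<in> lin_maps N E" if "m \<in> lin_maps N E" for m
      using gmodule.act_closed[OF gmodule_hom_gmodule[OF NE] xc, of m] that by simp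
    have Ml: "(act ?M x ^^ n) (?f x) \<in> lin_maps N K" for n
      using S.M.act_pow_closed[OF xc, of "?f x" n] S.cocycle_lin[OF xc] by simp
    have 1: "act ?H x \<sigma> = ?j (?f x)"
      by (rule lin_maps_eqI[OF Hl[OF \<sigma>l] jl[OF S.cocycle_lin[OF xc]]])
        (simp add: act_hom_gmodule_even[OF NE x \<sigma>l] S.cocycle[OF xc])
    have 2: "act ?H x (?j m) = ?j (act ?M x m)" if m: "m \<in> lin_maps N K" for m
    proof (rule lin_maps_eqI[OF Hl[OF jl[OF m]]])
      show "?j (act ?M x m) \<in> lin_maps N E" using jl S.M.act_closed[OF xc, of m] m by simp
      show "act ?H x (?j m) b = ?j (act ?M x m) b" if b: "b \<in> carrier N" for b
        using b xc lin_mapsD(1)[OF m]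
        by (simp add: act_hom_gmodule_even[OF NE x jl[OF m]] act_hom_gmodule_even[OF NK x m] S.\<iota>_minus S.\<iota>_act)
    qed
    have "(act ?H x ^^ Suc n) \<sigma> = ?j ((act ?M x ^^ n) (?f x))" for n
    proof (induction n)
      case 0 then show ?case by (simp add: 1)
    next
      case (Suc n)
      have "(act ?H x ^^ Suc (Suc n)) \<sigma> = act ?H x ((act ?H x ^^ Suc n) \<sigma>)" by simp
      also have "\<dots> = ?j ((act ?M x ^^ Suc n) (?f x))" unfolding Suc.IH using 2[OF Ml[of n]] by simp
      finally show ?case .
    qed
    from this[of q] have "(act ?H x ^^ CHAR('k)) \<sigma> = ?j ((act ?M x ^^ q) (?f x))" by (simp only: q)
    then have "\<iota> ((act ?M x ^^ q) (?f x) a) = (act ?H x ^^ CHAR('k)) \<sigma> a" using a by simp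
    also have "\<dots> = (act E x ^^ CHAR('k)) (\<sigma> a) \<ominus>\<^bsub>E\<^esub> \<sigma> (act N (ppow G x) a)"
      using act_hom_gmodule_CHAR_power[OF NE assms(1) x \<sigma>l a] N.act_ppow[OF x a] by simp
    finally show ?thesis .
  qed
  have pc: "x \<in> carrier G" "ppow G x \<in> carrier G" if "x \<in> part G 0" for x
    using that G.ppow_closed G.part_carrier by blast+
  have fl: "(act ?M x ^^ q) (?f x) \<in> lin_maps N K" "?f (ppow G x) \<in> lin_maps N K" if "x \<in> part G 0" for x
    using S.M.act_pow_closed[OF pc(1)[OF that], of "?f x" q] S.cocycle_lin[OF pc(1)[OF that]]
      S.cocycle_lin[OF pc(2)[OF that]] by simp_all
  have iff: "(act E x ^^ CHAR('k)) (\<sigma> a) = act E (ppow G x) (\<sigma> a) \<longleftrightarrow> ?f (ppow G x) a = (act ?M x ^^ q) (?f x) a"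
    if x: "x \<in> part G 0" and a: "a \<in> carrier N" for x a
  proof -
    note c = lin_mapsD(1)[OF fl(1)[OF x] a] lin_mapsD(1)[OF fl(2)[OF x] a]
    have "?f (ppow G x) a = (act ?M x ^^ q) (?f x) a \<longleftrightarrow>
      act E (ppow G x) (\<sigma> a) \<ominus>\<^bsub>E\<^esub> \<sigma> (act N (ppow G x) a) =
      (act E x ^^ CHAR('k)) (\<sigma> a) \<ominus>\<^bsub>E\<^esub> \<sigma> (act N (ppow G x) a)"
      using c by (simp add: key[OF x a] S.cocycle(2)[OF pc(2)[OF x] a] flip: S.\<iota>_eq_iff)
    also have "\<dots> \<longleftrightarrow> act E (ppow G x) (\<sigma> a) = (act E x ^^ CHAR('k)) (\<sigma> a)"
    proof
      assume e: "act E (ppow G x) (\<sigma> a) \<ominus>\<^bsub>E\<^esub> \<sigma> (act N (ppow G x) a) =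
        (act E x ^^ CHAR('k)) (\<sigma> a) \<ominus>\<^bsub>E\<^esub> \<sigma> (act N (ppow G x) a)"
      show "act E (ppow G x) (\<sigma> a) = (act E x ^^ CHAR('k)) (\<sigma> a)"
        using e pc[OF x] a S.\<sigma>(1) by (simp add: a_minus_def del: funpow.simps)
    qed simp
    finally show ?thesis by auto
  qed
  show ?thesis
  proof
    assume "restricted_gmodule G E"
    then interpret E: restricted_gmodule G E .
    have "?f (ppow G x) = (act ?M x ^^ (CHAR('k) - 1)) (?f x)" if x: "x \<in> part G 0" for x
      by (rule lin_maps_eqI[of _ N K]) (use fl[OF x] iff[OF x] E.act_ppow[OF x] S.\<sigma>(1) in \<open>simp_all add: q\<close>)
    then show "?f \<in> Z1_ppow G ?M" using S.cocycle_Z1 by (simp add: Z1_ppow_def)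
  next
    assume f: "?f \<in> Z1_ppow G ?M"
    show "restricted_gmodule G E"
    proof (rule restricted_gmoduleI[OF S.E.gmodule_axioms])
      fix x e assume x: "x \<in> part G 0" and e: "e \<in> carrier E"
      obtain k a where ka: "k \<in> carrier K" "a \<in> carrier N" "e = S.\<theta> k a" using S.\<theta>_surj[OF e] .
      have "?f (ppow G x) = (act ?M x ^^ q) (?f x)" using f x by (simp add: Z1_ppow_def q)
      then have 1: "(act E x ^^ CHAR('k)) (\<sigma> a) = act E (ppow G x) (\<sigma> a)" using iff[OF x ka(2)] by simp
      \<comment> \<open>The summand in the image of \<open>K\<close> satisfies the restriction
        condition because \<open>K\<close> does, and \<open>\<iota>\<close> commutes with the
        action. The condition on the cocycle only concerns the summand
        \<open>\<sigma> a\<close>.\<close>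
      have "(act E x ^^ n) (\<iota> k) = \<iota> ((act K x ^^ n) k)" for n
        by (induction n) (use pc[OF x] ka K.act_pow_closed in \<open>simp_all add: S.\<iota>_act\<close>)
      then have 2: "(act E x ^^ CHAR('k)) (\<iota> k) = act E (ppow G x) (\<iota> k)"
        using K.act_ppow[OF x ka(1)] pc[OF x] ka by (simp add: S.\<iota>_act)
      show "(act E x ^^ CHAR('k)) e = act E (ppow G x) e"
        using ka S.\<iota>(1) S.\<sigma>(1) pc[OF x] 1 2
        by (simp add: S.\<theta>_def S.E.act_pow_simps(1) S.E.act_add_right del: funpow.simps)
    qed
  qed
qed

section \<open>Fibre products, Baer sums and multiples of extensions\<close>

lemma component_direct_sum:
  assumes "superspace V" "superspace W" "superspace (direct_sum V W)" "v \<in> carrier V" "w \<in> carrier W"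
  shows "component (direct_sum V W) i (v, w) = (component V i v, component W i w)"
proof -
  interpret V: superspace V by fact
  interpret W: superspace W by fact
  interpret S: superspace "direct_sum V W" by fact
  have "(v, w) = (component V i v, component W i w) \<oplus>\<^bsub>direct_sum V W\<^esub> (component V (i + 1) v, component W (i + 1) w)"
    using assms V.component_sum W.component_sum by simp
  then show ?thesis using assms by (metis S.component_eqI SigmaI V.component_in_part W.component_in_part direct_sum_simps(5))
qed

lemma lin_maps_deg_component:
  assumes "superspace V" "superspace W" "\<phi> \<in> lin_maps_deg V W 0" "v \<in> carrier V"
  shows "\<phi> (component V i v) = component W i (\<phi> v)"
proof -
  interpret V: superspace V by fact
  interpret W: superspace W by fact
  note l = lin_mapsD[OF lin_maps_degD(1)[OF assms(3)]]
  have "\<phi> v = \<phi> (component V i v) \<oplus>\<^bsub>W\<^esub> \<phi> (component V (i + 1) v)"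
    using l(2)[of "component V i v" "component V (i + 1) v"] V.component_sum[OF assms(4), of i] assms(4) by simp
  then show ?thesis
    using W.component_eqI[of "\<phi> (component V i v)" i "\<phi> (component V (i + 1) v)"] assms(4)
      lin_maps_degD(2)[OF assms(3), of _ i] lin_maps_degD(2)[OF assms(3), of _ "i + 1"] by simp
qed

lemma fibre_product_simps:
  "carrier (fibre_product E \<phi> F \<psi>) = {(a, b). a \<in> carrier E \<and> b \<in> carrier F \<and> \<phi> a = \<psi> b}"
  "\<zero>\<^bsub>fibre_product E \<phi> F \<psi>\<^esub> = (\<zero>\<^bsub>E\<^esub>, \<zero>\<^bsub>F\<^esub>)"
  "(a, b) \<oplus>\<^bsub>fibre_product E \<phi> F \<psi>\<^esub> (a', b') = (a \<oplus>\<^bsub>E\<^esub> a', b \<oplus>\<^bsub>F\<^esub> b')"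
  "c \<odot>\<^bsub>fibre_product E \<phi> F \<psi>\<^esub> (a, b) = (c \<odot>\<^bsub>E\<^esub> a, c \<odot>\<^bsub>F\<^esub> b)"
  "part (fibre_product E \<phi> F \<psi>) i =
    (part E i \<times> part F i) \<inter> {(a, b). a \<in> carrier E \<and> b \<in> carrier F \<and> \<phi> a = \<psi> b}"
  "act (fibre_product E \<phi> F \<psi>) x (a, b) = (act E x a, act F x b)"
  by (simp_all add: fibre_product_def sub_superspace_def direct_sum_def)

context
  fixes G :: "('k::field, 'g, 'x) lie_super_scheme" and E :: "('k, 'g, 'e) gmodule"
    and F :: "('k, 'g, 'f) gmodule" and N :: "('k, 'g, 'w) gmodule" and \<phi> \<psi>
  assumes EFN: "gmodule G E" "gmodule G F" "gmodule G N"
    and \<phi>: "\<phi> \<in> gmod_homs G E N" and \<psi>: "\<psi> \<in> gmod_homs G F N"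
begin

interpretation E: gmodule G E by (fact EFN)
interpretation F: gmodule G F by (fact EFN)
interpretation N: gmodule G N by (fact EFN)

text \<open>The fibre product is a graded subspace of the direct sum because even maps commute with
  taking components.\<close>

lemma gmodule_fibre_product: "gmodule G (fibre_product E \<phi> F \<psi>)"
  and component_fibre_product:
    "(a, b) \<in> carrier (fibre_product E \<phi> F \<psi>) \<Longrightarrow>
      component (fibre_product E \<phi> F \<psi>) i (a, b) = (component E i a, component F i b)"
proof -
  let ?S = "{(a, b). a \<in> carrier E \<and> b \<in> carrier F \<and> \<phi> a = \<psi> b}"
  have d: "\<phi> \<in> lin_maps_deg E N 0" "\<psi> \<in> lin_maps_deg F N 0" using \<phi> \<psi> by (auto simp: gmod_homs_def)
  note l = lin_mapsD[OF lin_maps_degD(1)[OF d(1)]] lin_mapsD[OF lin_maps_degD(1)[OF d(2)]]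
    lin_maps_zero[OF E.V.superspace_axioms N.V.superspace_axioms lin_maps_degD(1)[OF d(1)]]
    lin_maps_zero[OF F.V.superspace_axioms N.V.superspace_axioms lin_maps_degD(1)[OF d(2)]]
  have a: "\<lbrakk>x \<in> carrier G; e \<in> carrier E\<rbrakk> \<Longrightarrow> \<phi> (act E x e) = act N x (\<phi> e)"
    "\<lbrakk>x \<in> carrier G; e' \<in> carrier F\<rbrakk> \<Longrightarrow> \<psi> (act F x e') = act N x (\<psi> e')" for x e e'
    using \<phi> \<psi> by (auto simp: gmod_homs_def)
  have S: "gmodule G (direct_sum E F)" by (rule gmodule_direct_sum[OF EFN(1,2)])
  interpret S: gmodule G "direct_sum E F" by (rule S)
  note comp = component_direct_sum[OF E.V.superspace_axioms F.V.superspace_axioms S.V.superspace_axioms]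
    lin_maps_deg_component[OF E.V.superspace_axioms N.V.superspace_axioms d(1)]
    lin_maps_deg_component[OF F.V.superspace_axioms N.V.superspace_axioms d(2)]
  show g: "gmodule G (fibre_product E \<phi> F \<psi>)"
    unfolding fibre_product_def
    by (rule gmodule_sub_superspace[OF S]) (auto simp: l a comp)
  then interpret P: gmodule G "fibre_product E \<phi> F \<psi>" .
  show "component (fibre_product E \<phi> F \<psi>) i (a, b) = (component E i a, component F i b)"
    if ab: "(a, b) \<in> carrier (fibre_product E \<phi> F \<psi>)"
  proof -
    have h: "a \<in> carrier E" "b \<in> carrier F" "\<phi> a = \<psi> b" using ab by (simp_all add: fibre_product_simps)
    have "(component E j a, component F j b) \<in> part (fibre_product E \<phi> F \<psi>) j" for j
      using h by (simp add: fibre_product_simps comp)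
    then show ?thesis
      using P.V.component_eqI[of "(component E i a, component F i b)" i "(component E (i + 1) a, component F (i + 1) b)"] h
      by (simp add: fibre_product_simps E.V.component_sum F.V.component_sum)
  qed
qed

end

context
  fixes G :: "('k::field, 'g, 'x) lie_super_scheme" and P :: "('k, 'g, 'e) gmodule" and D
  assumes P: "gmodule G P" and D: "D \<subseteq> carrier P" "\<zero>\<^bsub>P\<^esub> \<in> D"
    "\<And>a b. \<lbrakk>a \<in> D; b \<in> D\<rbrakk> \<Longrightarrow> a \<oplus>\<^bsub>P\<^esub> b \<in> D" "\<And>c a. a \<in> D \<Longrightarrow> c \<odot>\<^bsub>P\<^esub> a \<in> D"
    "\<And>x a. \<lbrakk>x \<in> carrier G; a \<in> D\<rbrakk> \<Longrightarrow> act P x a \<in> D" "\<And>i a. a \<in> D \<Longrightarrow> component P i a \<in> D"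
begin

interpretation P: gmodule G P by (fact P)

lemma quot_gmodule_minus: "a \<in> D \<Longrightarrow> \<ominus>\<^bsub>P\<^esub> a \<in> D"
  using D(4)[of a "- 1"] D(1) by auto

interpretation D: abelian_subgroup D P
proof (rule abelian_subgroupI3)
  show "additive_subgroup D P"
    using D quot_gmodule_minus
    by (intro additive_subgroup.intro P.V.add.subgroupI) (auto simp: a_inv_def)
  show "abelian_group P" by unfold_locales
qed

lemma quot_gmodule_class_eq:
  assumes "a \<in> carrier P" "b \<in> carrier P"
  shows "D +>\<^bsub>P\<^esub> a = D +>\<^bsub>P\<^esub> b \<longleftrightarrow> a \<ominus>\<^bsub>P\<^esub> b \<in> D"
  by (rule D.rcos_eq_iff[OF assms])

lemma quot_gmodule_simps:
  "carrier (quot_gmodule P D) = (\<lambda>a. D +>\<^bsub>P\<^esub> a) ` carrier P"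
  "\<zero>\<^bsub>quot_gmodule P D\<^esub> = D +>\<^bsub>P\<^esub> \<zero>\<^bsub>P\<^esub>"
  "part (quot_gmodule P D) i = (\<lambda>a. D +>\<^bsub>P\<^esub> a) ` part P i"
  "\<lbrakk>a \<in> carrier P; b \<in> carrier P\<rbrakk> \<Longrightarrow>
    (D +>\<^bsub>P\<^esub> a) \<oplus>\<^bsub>quot_gmodule P D\<^esub> (D +>\<^bsub>P\<^esub> b) = D +>\<^bsub>P\<^esub> (a \<oplus>\<^bsub>P\<^esub> b)"
  "a \<in> carrier P \<Longrightarrow> c \<odot>\<^bsub>quot_gmodule P D\<^esub> (D +>\<^bsub>P\<^esub> a) = D +>\<^bsub>P\<^esub> (c \<odot>\<^bsub>P\<^esub> a)"
  "\<lbrakk>x \<in> carrier G; a \<in> carrier P\<rbrakk> \<Longrightarrow> act (quot_gmodule P D) x (D +>\<^bsub>P\<^esub> a) = D +>\<^bsub>P\<^esub> act P x a"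
proof -
  note defs = quot_gmodule_def quot_superspace_def quot_module_def gmodule.defs superspace.defs
    module.defs ring.defs FactRing_def
  show "carrier (quot_gmodule P D) = (\<lambda>a. D +>\<^bsub>P\<^esub> a) ` carrier P" by (auto simp: defs A_RCOSETS_def')
  show "part (quot_gmodule P D) i = (\<lambda>a. D +>\<^bsub>P\<^esub> a) ` part P i" by (simp add: defs)
  have "D +>\<^bsub>P\<^esub> \<zero>\<^bsub>P\<^esub> = D" using D(1) by (force simp: a_r_coset_def')
  then show "\<zero>\<^bsub>quot_gmodule P D\<^esub> = D +>\<^bsub>P\<^esub> \<zero>\<^bsub>P\<^esub>" by (simp add: defs)
  show "\<lbrakk>a \<in> carrier P; b \<in> carrier P\<rbrakk> \<Longrightarrow>
    (D +>\<^bsub>P\<^esub> a) \<oplus>\<^bsub>quot_gmodule P D\<^esub> (D +>\<^bsub>P\<^esub> b) = D +>\<^bsub>P\<^esub> (a \<oplus>\<^bsub>P\<^esub> b)"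
    by (simp add: defs D.a_rcos_sum)
  show "a \<in> carrier P \<Longrightarrow> c \<odot>\<^bsub>quot_gmodule P D\<^esub> (D +>\<^bsub>P\<^esub> a) = D +>\<^bsub>P\<^esub> (c \<odot>\<^bsub>P\<^esub> a)"
    by (simp add: defs) (rule D.UN_rcos_map; simp add: P.V.smult_simps D)
  show "\<lbrakk>x \<in> carrier G; a \<in> carrier P\<rbrakk> \<Longrightarrow> act (quot_gmodule P D) x (D +>\<^bsub>P\<^esub> a) = D +>\<^bsub>P\<^esub> act P x a"
    by (simp add: defs) (rule D.UN_rcos_map; simp add: P.act_add_right D)
qed

lemma gmodule_quot_gmodule: "gmodule G (quot_gmodule P D)"
proof (rule gmodule_surj_image[OF P, where q = "\<lambda>a. D +>\<^bsub>P\<^esub> a"])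
  fix v assume v: "v \<in> carrier P" "D +>\<^bsub>P\<^esub> v = D +>\<^bsub>P\<^esub> \<zero>\<^bsub>P\<^esub>"
  then have "v \<in> D" using quot_gmodule_class_eq[of v "\<zero>\<^bsub>P\<^esub>"] by simp
  then show "D +>\<^bsub>P\<^esub> component P 0 v = D +>\<^bsub>P\<^esub> \<zero>\<^bsub>P\<^esub>"
    using D(6) v by (simp add: quot_gmodule_class_eq)
qed (simp_all add: quot_gmodule_simps)

end

lemma sectioned_extensionI:
  assumes "gmodule G K" "gmodule G N" "gmodule G E"
    and \<iota>: "\<iota> \<in> lin_maps_deg K E 0" "\<And>x k. \<lbrakk>x \<in> carrier G; k \<in> carrier K\<rbrakk> \<Longrightarrow> \<iota> (act K x k) = act E x (\<iota> k)"
      "inj_on \<iota> (carrier K)"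
    and \<phi>: "\<phi> \<in> lin_maps_deg E N 0" "\<And>x e. \<lbrakk>x \<in> carrier G; e \<in> carrier E\<rbrakk> \<Longrightarrow> \<phi> (act E x e) = act N x (\<phi> e)"
    and exact: "\<And>k. k \<in> carrier K \<Longrightarrow> \<phi> (\<iota> k) = \<zero>\<^bsub>N\<^esub>"
      "\<And>e. \<lbrakk>e \<in> carrier E; \<phi> e = \<zero>\<^bsub>N\<^esub>\<rbrakk> \<Longrightarrow> e \<in> \<iota> ` carrier K"
    and \<sigma>: "\<sigma> \<in> lin_maps_deg N E 0" "\<And>a. a \<in> carrier N \<Longrightarrow> \<phi> (\<sigma> a) = a"
  shows "sectioned_extension G K N E \<iota> \<phi> \<sigma>"
proof -
  note \<iota>l = lin_mapsD[OF lin_maps_degD(1)[OF \<iota>(1)]] and \<phi>l = lin_mapsD[OF lin_maps_degD(1)[OF \<phi>(1)]]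
    and \<sigma>l = lin_mapsD[OF lin_maps_degD(1)[OF \<sigma>(1)]]
  have "\<phi> ` carrier E = carrier N" using \<phi>l(1) \<sigma>l(1) \<sigma>(2) by (auto intro!: image_eqI[of _ \<phi> "\<sigma> _"])
  moreover have "\<iota> ` carrier K = {e \<in> carrier E. \<phi> e = \<zero>\<^bsub>N\<^esub>}" using \<iota>l(1) exact by auto
  ultimately have "(E, \<iota>, \<phi>) \<in> extensions G K N" using assms by (simp add: extensions_def gmod_homs_def)
  then show ?thesis
    using \<sigma> by (intro sectioned_extension.intro sectioned_extension_axioms.intro assms(1,2)) (simp_all add: even_sections_def)
qed

text \<open>The section sends \<open>a\<close> to the class of the pair of its lifts, so that its
  cocycle is the class of the pair of the two images of the cocycles. Modulo the antidiagonal such a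
  pair equals \<open>\<iota>\<close> of the sum.\<close>

lemma baer_sum_sectioned:
  fixes G :: "('k::field, 'g, 'x) lie_super_scheme" and K :: "('k, 'g, 'v) gmodule" and N :: "('k, 'g, 'w) gmodule"
    and E\<^sub>1 E\<^sub>2 :: "('k, 'g, 'e) gmodule"
  assumes "sectioned_extension G K N E\<^sub>1 \<iota>\<^sub>1 \<phi>\<^sub>1 \<sigma>\<^sub>1" "sectioned_extension G K N E\<^sub>2 \<iota>\<^sub>2 \<phi>\<^sub>2 \<sigma>\<^sub>2"
  obtains E \<iota> \<phi> \<sigma> where "baer_sum K (E\<^sub>1, \<iota>\<^sub>1, \<phi>\<^sub>1) (E\<^sub>2, \<iota>\<^sub>2, \<phi>\<^sub>2) = (E, \<iota>, \<phi>)"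
    "sectioned_extension G K N E \<iota> \<phi> \<sigma>"
    "ext_cocycle G K N (E, \<iota>, \<phi>) \<sigma> = ext_cocycle G K N (E\<^sub>1, \<iota>\<^sub>1, \<phi>\<^sub>1) \<sigma>\<^sub>1
      \<oplus>\<^bsub>hom_space G (hom_gmodule G N K)\<^esub> ext_cocycle G K N (E\<^sub>2, \<iota>\<^sub>2, \<phi>\<^sub>2) \<sigma>\<^sub>2"
proof -
  interpret S: sectioned_extension G K N E\<^sub>1 \<iota>\<^sub>1 \<phi>\<^sub>1 \<sigma>\<^sub>1 by fact
  interpret T: sectioned_extension G K N E\<^sub>2 \<iota>\<^sub>2 \<phi>\<^sub>2 \<sigma>\<^sub>2 by fact
  define P where "P = fibre_product E\<^sub>1 \<phi>\<^sub>1 E\<^sub>2 \<phi>\<^sub>2"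
  define D where "D = (\<lambda>a. (\<iota>\<^sub>1 a, \<ominus>\<^bsub>E\<^sub>2\<^esub> \<iota>\<^sub>2 a)) ` carrier K"
  define E where "E = quot_gmodule P D"
  define \<iota> where "\<iota> = (\<lambda>a\<in>carrier K. D +>\<^bsub>P\<^esub> (\<iota>\<^sub>1 a, \<zero>\<^bsub>E\<^sub>2\<^esub>))"
  define \<phi> where "\<phi> = (\<lambda>A\<in>carrier E. the_elem ((\<lambda>e. \<phi>\<^sub>1 (fst e)) ` A))"
  define \<sigma> where "\<sigma> = (\<lambda>a\<in>carrier N. D +>\<^bsub>P\<^esub> (\<sigma>\<^sub>1 a, \<sigma>\<^sub>2 a))"
  have baer: "baer_sum K (E\<^sub>1, \<iota>\<^sub>1, \<phi>\<^sub>1) (E\<^sub>2, \<iota>\<^sub>2, \<phi>\<^sub>2) = (E, \<iota>, \<phi>)"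
    by (simp add: Let_def P_def D_def E_def \<iota>_def \<phi>_def)
  have hom: "\<phi>\<^sub>1 \<in> gmod_homs G E\<^sub>1 N" "\<phi>\<^sub>2 \<in> gmod_homs G E\<^sub>2 N"
    using S.exten T.exten by (auto simp: extensions_def)
  have gP: "gmodule G P"
    unfolding P_def by (rule gmodule_fibre_product[OF S.E.gmodule_axioms T.E.gmodule_axioms S.N.gmodule_axioms hom])
  interpret P: gmodule G P by (rule gP)
  note P_comp = component_fibre_product[OF S.E.gmodule_axioms T.E.gmodule_axioms S.N.gmodule_axioms hom, folded P_def]
  note P_simps = fibre_product_simps[of E\<^sub>1 \<phi>\<^sub>1 E\<^sub>2 \<phi>\<^sub>2, folded P_def]
  have P_minus: "(a, b) \<ominus>\<^bsub>P\<^esub> (a', b') = (a \<ominus>\<^bsub>E\<^sub>1\<^esub> a', b \<ominus>\<^bsub>E\<^sub>2\<^esub> b')"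
    if "(a, b) \<in> carrier P" "(a', b') \<in> carrier P" for a b a' b'
  proof -
    have c: "(a \<ominus>\<^bsub>E\<^sub>1\<^esub> a', b \<ominus>\<^bsub>E\<^sub>2\<^esub> b') \<in> carrier P"
      using that by (simp add: P_simps S.\<phi>_minus T.\<phi>_minus)
    have "(a, b) = (a \<ominus>\<^bsub>E\<^sub>1\<^esub> a', b \<ominus>\<^bsub>E\<^sub>2\<^esub> b') \<oplus>\<^bsub>P\<^esub> (a', b')"
      using that by (auto simp: P_simps S.E.V.group_simps T.E.V.group_simps)
    then show ?thesis using P.V.group_simps(5)[OF that c] by simp
  qed
  have DI: "(\<iota>\<^sub>1 k, \<ominus>\<^bsub>E\<^sub>2\<^esub> \<iota>\<^sub>2 k) \<in> D" if "k \<in> carrier K" for k using that by (auto simp: D_def)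
  have DP: "D \<subseteq> carrier P"
    using S.\<iota> T.\<iota> lin_maps_minus(2)[OF T.E.V.superspace_axioms S.N.V.superspace_axioms extensionsD(6)[OF T.exten]]
    by (auto simp: D_def P_simps S.\<phi>_\<iota> T.\<phi>_\<iota>)
  have cDm: "component E\<^sub>2 i (\<ominus>\<^bsub>E\<^sub>2\<^esub> \<iota>\<^sub>2 k) = \<ominus>\<^bsub>E\<^sub>2\<^esub> \<iota>\<^sub>2 (component K i k)" if "k \<in> carrier K" for i k
    using that T.\<iota>(1) T.E.V.component_smult[of "\<iota>\<^sub>2 k" i "- 1"]
      lin_maps_deg_component[OF S.K.V.superspace_axioms T.E.V.superspace_axioms extensionsD(2)[OF T.exten], of k i] by simp
  have D: "\<zero>\<^bsub>P\<^esub> \<in> D" "\<And>a b. \<lbrakk>a \<in> D; b \<in> D\<rbrakk> \<Longrightarrow> a \<oplus>\<^bsub>P\<^esub> b \<in> D" "\<And>c a. a \<in> D \<Longrightarrow> c \<odot>\<^bsub>P\<^esub> a \<in> D"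
    "\<And>x a. \<lbrakk>x \<in> carrier G; a \<in> D\<rbrakk> \<Longrightarrow> act P x a \<in> D" "\<And>i a. a \<in> D \<Longrightarrow> component P i a \<in> D"
  proof -
    show "\<zero>\<^bsub>P\<^esub> \<in> D" using DI[of "\<zero>\<^bsub>K\<^esub>"] by (simp add: P_simps S.\<iota>_zero T.\<iota>_zero)
  next
    fix a b assume "a \<in> D" "b \<in> D"
    then obtain k l where kl: "k \<in> carrier K" "l \<in> carrier K" "a = (\<iota>\<^sub>1 k, \<ominus>\<^bsub>E\<^sub>2\<^esub> \<iota>\<^sub>2 k)" "b = (\<iota>\<^sub>1 l, \<ominus>\<^bsub>E\<^sub>2\<^esub> \<iota>\<^sub>2 l)"
      by (auto simp: D_def)
    then show "a \<oplus>\<^bsub>P\<^esub> b \<in> D" using DI[of "k \<oplus>\<^bsub>K\<^esub> l"] T.\<iota>(1) by (simp add: P_simps S.\<iota> T.\<iota> T.E.V.minus_add)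
  next
    fix a c x i assume "a \<in> D"
    then obtain k where k: "k \<in> carrier K" "a = (\<iota>\<^sub>1 k, \<ominus>\<^bsub>E\<^sub>2\<^esub> \<iota>\<^sub>2 k)" by (auto simp: D_def)
    show "c \<odot>\<^bsub>P\<^esub> a \<in> D" using k DI[of "c \<odot>\<^bsub>K\<^esub> k"] T.\<iota>(1) by (simp add: P_simps S.\<iota> T.\<iota> T.E.V.smult_simps)
    show "act P x a \<in> D" if "x \<in> carrier G"
      using that k DI[of "act K x k"] T.\<iota>(1) by (simp add: P_simps S.\<iota>_act T.\<iota>_act)
    have "component P i a = (\<iota>\<^sub>1 (component K i k), \<ominus>\<^bsub>E\<^sub>2\<^esub> \<iota>\<^sub>2 (component K i k))"
      using k DI[OF k(1)] DP S.\<iota>(1) T.\<iota>(1)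
        lin_maps_deg_component[OF S.K.V.superspace_axioms S.E.V.superspace_axioms extensionsD(2)[OF S.exten], of k i]
      by (auto simp: P_comp cDm)
    then show "component P i a \<in> D" using DI[of "component K i k"] k by simp
  qed
  have gE: "gmodule G E" unfolding E_def by (rule gmodule_quot_gmodule[OF gP DP D])
  then interpret E: gmodule G E .
  note E_simps = quot_gmodule_simps[OF gP DP D, folded E_def]
  note E_eq = quot_gmodule_class_eq[OF gP DP D]
  have Pc: "(\<iota>\<^sub>1 k, \<zero>\<^bsub>E\<^sub>2\<^esub>) \<in> carrier P" "(\<iota>\<^sub>1 k, \<iota>\<^sub>2 k) \<in> carrier P" if "k \<in> carrier K" for k
    using that S.\<iota>(1) T.\<iota>(1) T.\<phi>_\<iota>[of "\<zero>\<^bsub>K\<^esub>"] by (simp_all add: P_simps S.\<phi>_\<iota> T.\<phi>_\<iota> T.\<iota>_zero)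
  have Ps: "(\<sigma>\<^sub>1 a, \<sigma>\<^sub>2 a) \<in> carrier P" if "a \<in> carrier N" for a
    using that S.\<sigma>(1) T.\<sigma>(1) by (simp add: P_simps S.\<phi>_\<sigma> T.\<phi>_\<sigma>)
  \<comment> \<open>The first coordinates of \<open>D\<close> lie in the kernel of the first
    projection, so \<open>the_elem\<close> is applied to a singleton.\<close>
  have \<phi>_class: "\<phi> (D +>\<^bsub>P\<^esub> (a, b)) = \<phi>\<^sub>1 a" if ab: "(a, b) \<in> carrier P" for a b
  proof -
    have "\<phi>\<^sub>1 (fst e) = \<phi>\<^sub>1 a" if e: "e \<in> D +>\<^bsub>P\<^esub> (a, b)" for e
    proof -
      obtain h where h: "h \<in> D" "e = h \<oplus>\<^bsub>P\<^esub> (a, b)" using e by (auto simp: a_r_coset_def')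
      then obtain k where "k \<in> carrier K" "h = (\<iota>\<^sub>1 k, \<ominus>\<^bsub>E\<^sub>2\<^esub> \<iota>\<^sub>2 k)" by (auto simp: D_def)
      then show ?thesis using h ab S.\<iota>(1) S.\<phi>(1) T.\<phi>(1) by (simp add: P_simps S.\<phi> S.\<phi>_\<iota>)
    qed
    moreover have "D +>\<^bsub>P\<^esub> (a, b) \<noteq> {}" using D(1) unfolding a_r_coset_def' by blast
    ultimately show ?thesis
      using ab by (simp add: \<phi>_def E_simps the_elem_image_constant)
  qed
  \<comment> \<open>Moving \<open>l\<close> to the first coordinate changes the pair by the image of
    \<open>l\<close> under the two inclusions with opposite signs, which is an element of
    \<open>D\<close>.\<close>
  have diag: "D +>\<^bsub>P\<^esub> (\<iota>\<^sub>1 k, \<iota>\<^sub>2 l) = \<iota> (k \<oplus>\<^bsub>K\<^esub> l)" if kl: "k \<in> carrier K" "l \<in> carrier K" for k l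
  proof -
    have c: "(\<iota>\<^sub>1 k, \<iota>\<^sub>2 l) \<in> carrier P" using kl S.\<iota>(1) T.\<iota>(1) by (simp add: P_simps S.\<phi>_\<iota> T.\<phi>_\<iota>)
    have "(\<iota>\<^sub>1 (k \<oplus>\<^bsub>K\<^esub> l), \<zero>\<^bsub>E\<^sub>2\<^esub>) \<ominus>\<^bsub>P\<^esub> (\<iota>\<^sub>1 k, \<iota>\<^sub>2 l) = (\<iota>\<^sub>1 l, \<ominus>\<^bsub>E\<^sub>2\<^esub> \<iota>\<^sub>2 l)"
      using kl Pc(1)[of "k \<oplus>\<^bsub>K\<^esub> l"] S.\<iota>(1) T.\<iota>(1)
      by (subst P_minus[OF _ c]) (simp_all add: S.\<iota>(2) S.E.V.group_simps a_minus_def[of E\<^sub>2])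
    then have "D +>\<^bsub>P\<^esub> (\<iota>\<^sub>1 (k \<oplus>\<^bsub>K\<^esub> l), \<zero>\<^bsub>E\<^sub>2\<^esub>) = D +>\<^bsub>P\<^esub> (\<iota>\<^sub>1 k, \<iota>\<^sub>2 l)"
      using DI[OF kl(2)] c Pc kl by (simp add: E_eq)
    then show ?thesis using kl by (simp add: \<iota>_def)
  qed
  have sec: "sectioned_extension G K N E \<iota> \<phi> \<sigma>"
  proof (rule sectioned_extensionI[OF S.K.gmodule_axioms S.N.gmodule_axioms gE])
    have "\<iota> \<in> lin_maps K E"
      by (rule lin_mapsI) (use Pc in \<open>auto simp: \<iota>_def E_simps P_simps(3,4) S.\<iota>\<close>)
    then show "\<iota> \<in> lin_maps_deg K E 0"
    proof (rule lin_maps_degI)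
      fix i k assume k: "k \<in> part K i"
      then show "\<iota> k \<in> part E (0 + i)"
        using S.K.V.part_carrier[OF k] Pc(1) S.\<iota>_part[OF k] by (auto simp: \<iota>_def E_simps P_simps)
    qed
    show "\<iota> (act K x k) = act E x (\<iota> k)" if "x \<in> carrier G" "k \<in> carrier K" for x k
      using that Pc(1) by (simp add: \<iota>_def E_simps P_simps(6) S.\<iota>_act)
    show "inj_on \<iota> (carrier K)"
    proof (rule inj_onI)
      fix k l assume kl: "k \<in> carrier K" "l \<in> carrier K" "\<iota> k = \<iota> l"
      then have "(\<iota>\<^sub>1 k, \<zero>\<^bsub>E\<^sub>2\<^esub>) \<ominus>\<^bsub>P\<^esub> (\<iota>\<^sub>1 l, \<zero>\<^bsub>E\<^sub>2\<^esub>) \<in> D" using Pc by (simp add: \<iota>_def E_eq)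
      then obtain m where m: "m \<in> carrier K" "\<iota>\<^sub>1 k \<ominus>\<^bsub>E\<^sub>1\<^esub> \<iota>\<^sub>1 l = \<iota>\<^sub>1 m" "\<zero>\<^bsub>E\<^sub>2\<^esub> = \<ominus>\<^bsub>E\<^sub>2\<^esub> \<iota>\<^sub>2 m"
        using kl Pc by (auto simp: P_minus D_def)
      then have "\<iota>\<^sub>2 m = \<iota>\<^sub>2 \<zero>\<^bsub>K\<^esub>" using T.\<iota>(1) by (metis T.E.V.minus_minus T.E.V.neg_zero T.\<iota>_zero)
      then have "m = \<zero>\<^bsub>K\<^esub>" using m by (simp add: T.\<iota>_eq_iff)
      then have "\<iota>\<^sub>1 k = \<iota>\<^sub>1 l" using m kl S.\<iota>(1) by (simp add: S.\<iota>_zero S.E.V.minus_eq_zero_iff)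
      then show "k = l" using kl by (simp add: S.\<iota>_eq_iff)
    qed
    have "\<phi> \<in> lin_maps E N"
    proof (rule lin_mapsI)
      fix A assume "A \<in> carrier E"
      then obtain a b where ab: "(a, b) \<in> carrier P" "A = D +>\<^bsub>P\<^esub> (a, b)" by (auto simp: E_simps)
      then have c: "a \<in> carrier E\<^sub>1" by (simp add: P_simps)
      show "\<phi> A \<in> carrier N" using ab c S.\<phi>(1) by (simp add: \<phi>_class)
      show "\<phi> (c \<odot>\<^bsub>E\<^esub> A) = c \<odot>\<^bsub>N\<^esub> \<phi> A" for c
        using ab c P.V.smultC[OF ab(1), of c] by (simp add: E_simps P_simps(4) \<phi>_class S.\<phi>)
      fix B assume "B \<in> carrier E"
      then obtain a' b' where ab': "(a', b') \<in> carrier P" "B = D +>\<^bsub>P\<^esub> (a', b')" by (auto simp: E_simps)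
      then have c': "a' \<in> carrier E\<^sub>1" by (simp add: P_simps)
      show "\<phi> (A \<oplus>\<^bsub>E\<^esub> B) = \<phi> A \<oplus>\<^bsub>N\<^esub> \<phi> B"
        using ab ab' c c' P.V.a_closed[OF ab(1) ab'(1)] by (simp add: E_simps P_simps(3) \<phi>_class S.\<phi>)
    qed (simp add: \<phi>_def)
    then show "\<phi> \<in> lin_maps_deg E N 0"
    proof (rule lin_maps_degI)
      fix i A assume "A \<in> part E i"
      then obtain a b where ab: "(a, b) \<in> part P i" "A = D +>\<^bsub>P\<^esub> (a, b)" by (auto simp: E_simps)
      then show "\<phi> A \<in> part N (0 + i)"
        using P.V.part_carrier[OF ab(1)] S.\<phi>_part T.\<phi>_part by (auto simp: \<phi>_class P_simps)
    qed
    show "\<phi> (act E x A) = act N x (\<phi> A)" if h: "x \<in> carrier G" "A \<in> carrier E" for x A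
    proof -
      obtain a b where ab: "(a, b) \<in> carrier P" "A = D +>\<^bsub>P\<^esub> (a, b)" using h by (auto simp: E_simps)
      then have "a \<in> carrier E\<^sub>1" by (simp add: P_simps)
      then show ?thesis
        using h ab P.act_closed[OF h(1) ab(1)] by (simp add: E_simps P_simps(6) \<phi>_class S.\<phi>_act)
    qed
    show "\<phi> (\<iota> k) = \<zero>\<^bsub>N\<^esub>" if "k \<in> carrier K" for k
      using that Pc(1) by (simp add: \<iota>_def \<phi>_class S.\<phi>_\<iota>)
    show "A \<in> \<iota> ` carrier K" if A: "A \<in> carrier E" "\<phi> A = \<zero>\<^bsub>N\<^esub>" for A
    proof -
      obtain a b where ab: "(a, b) \<in> carrier P" "A = D +>\<^bsub>P\<^esub> (a, b)" using A by (auto simp: E_simps)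
      then have "a \<in> carrier E\<^sub>1" "b \<in> carrier E\<^sub>2" "\<phi>\<^sub>1 a = \<zero>\<^bsub>N\<^esub>" "\<phi>\<^sub>2 b = \<zero>\<^bsub>N\<^esub>"
        using A(2) by (auto simp: \<phi>_class P_simps)
      then obtain k l where "k \<in> carrier K" "l \<in> carrier K" "a = \<iota>\<^sub>1 k" "b = \<iota>\<^sub>2 l"
        using S.kernelE[of a] T.kernelE[of b] by metis
      then show ?thesis using ab diag by auto
    qed
    have "\<sigma> \<in> lin_maps N E"
      by (rule lin_mapsI) (use Ps in \<open>auto simp: \<sigma>_def E_simps P_simps(3,4) S.\<sigma> T.\<sigma>\<close>)
    then show "\<sigma> \<in> lin_maps_deg N E 0"
    proof (rule lin_maps_degI)
      fix i a assume a: "a \<in> part N i"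
      then show "\<sigma> a \<in> part E (0 + i)"
        using S.N.V.part_carrier[OF a] Ps S.\<sigma>_part[OF a] T.\<sigma>_part[OF a] by (auto simp: \<sigma>_def E_simps P_simps)
    qed
    show "\<phi> (\<sigma> a) = a" if "a \<in> carrier N" for a using that Ps by (simp add: \<sigma>_def \<phi>_class S.\<phi>_\<sigma>)
  qed
  then interpret B: sectioned_extension G K N E \<iota> \<phi> \<sigma> .
  have "ext_cocycle G K N (E, \<iota>, \<phi>) \<sigma> = S.f \<oplus>\<^bsub>hom_space G (hom_gmodule G N K)\<^esub> T.f"
  proof (rule B.cocycleI)
    fix x a assume xa: "x \<in> carrier G" "a \<in> carrier N"
    note c = S.cocycle[OF xa] T.cocycle[OF xa]
    show "(S.f \<oplus>\<^bsub>hom_space G (hom_gmodule G N K)\<^esub> T.f) x a \<in> carrier K" using xa c(1,3) by simp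
    have n: "act N x a \<in> carrier N" using xa by simp
    have "act E x (\<sigma> a) \<ominus>\<^bsub>E\<^esub> \<sigma> (act N x a) = D +>\<^bsub>P\<^esub> (\<iota>\<^sub>1 (S.f x a), \<iota>\<^sub>2 (T.f x a))"
    proof -
      have p: "(\<iota>\<^sub>1 (S.f x a), \<iota>\<^sub>2 (T.f x a)) \<in> carrier P"
        using S.\<iota>(1)[OF c(1)] T.\<iota>(1)[OF c(3)] S.\<phi>_\<iota>[OF c(1)] T.\<phi>_\<iota>[OF c(3)] by (simp add: P_simps(1))
      have e: "\<iota>\<^sub>1 (S.f x a) \<oplus>\<^bsub>E\<^sub>1\<^esub> \<sigma>\<^sub>1 (act N x a) = act E\<^sub>1 x (\<sigma>\<^sub>1 a)"
        "\<iota>\<^sub>2 (T.f x a) \<oplus>\<^bsub>E\<^sub>2\<^esub> \<sigma>\<^sub>2 (act N x a) = act E\<^sub>2 x (\<sigma>\<^sub>2 a)"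
        using c(2,4) xa n S.\<iota>(1)[OF c(1)] T.\<iota>(1)[OF c(3)] S.\<sigma>(1) T.\<sigma>(1)
        by (simp_all add: S.E.V.group_simps T.E.V.group_simps)
      have "act E x (\<sigma> a) = D +>\<^bsub>P\<^esub> (act E\<^sub>1 x (\<sigma>\<^sub>1 a), act E\<^sub>2 x (\<sigma>\<^sub>2 a))"
        using xa Ps by (simp add: \<sigma>_def E_simps P_simps(6))
      also have "\<dots> = (D +>\<^bsub>P\<^esub> (\<iota>\<^sub>1 (S.f x a), \<iota>\<^sub>2 (T.f x a))) \<oplus>\<^bsub>E\<^esub> \<sigma> (act N x a)"
        using n Ps[OF n] p by (simp add: \<sigma>_def E_simps(4) P_simps(3) e)
      finally have "act E x (\<sigma> a) = (D +>\<^bsub>P\<^esub> (\<iota>\<^sub>1 (S.f x a), \<iota>\<^sub>2 (T.f x a))) \<oplus>\<^bsub>E\<^esub> \<sigma> (act N x a)" .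
      moreover have "D +>\<^bsub>P\<^esub> (\<iota>\<^sub>1 (S.f x a), \<iota>\<^sub>2 (T.f x a)) \<in> carrier E" using p by (simp add: E_simps(1))
      ultimately show ?thesis
        using E.V.group_simps(5)[OF E.act_closed[OF xa(1) B.\<sigma>(1)[OF xa(2)]] B.\<sigma>(1)[OF n]] by blast
    qed
    then show "\<iota> ((S.f \<oplus>\<^bsub>hom_space G (hom_gmodule G N K)\<^esub> T.f) x a) = act E x (\<sigma> a) \<ominus>\<^bsub>E\<^esub> \<sigma> (act N x a)"
      using xa diag[OF c(1,3)] by simp
  qed simp_all
  with baer sec that show thesis by blast
qed

text \<open>The second coordinate of the section is the old section at the multiple of
  \<open>a\<close> by \<open>c\<close>; by linearity its failure to commute with \<open>x\<close> is
  \<open>c\<close> times the old one, while the first coordinate commutes with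
  \<open>x\<close>.\<close>

lemma scale_ext_sectioned:
  fixes G :: "('k::field, 'g, 'x) lie_super_scheme" and K :: "('k, 'g, 'v) gmodule" and N :: "('k, 'g, 'w) gmodule"
  assumes "sectioned_extension G K N E\<^sub>1 \<iota>\<^sub>1 \<phi>\<^sub>1 \<sigma>\<^sub>1"
  obtains E \<iota> \<phi> \<sigma> where "scale_ext K N c (E\<^sub>1, \<iota>\<^sub>1, \<phi>\<^sub>1) = (E, \<iota>, \<phi>)"
    "sectioned_extension G K N E \<iota> \<phi> \<sigma>"
    "ext_cocycle G K N (E, \<iota>, \<phi>) \<sigma> =
      c \<odot>\<^bsub>hom_space G (hom_gmodule G N K)\<^esub> ext_cocycle G K N (E\<^sub>1, \<iota>\<^sub>1, \<phi>\<^sub>1) \<sigma>\<^sub>1"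
proof -
  interpret S: sectioned_extension G K N E\<^sub>1 \<iota>\<^sub>1 \<phi>\<^sub>1 \<sigma>\<^sub>1 by fact
  define E where "E = fibre_product N (\<lambda>b. c \<odot>\<^bsub>N\<^esub> b) E\<^sub>1 \<phi>\<^sub>1"
  define \<iota> where "\<iota> = (\<lambda>a\<in>carrier K. (\<zero>\<^bsub>N\<^esub>, \<iota>\<^sub>1 a))"
  define \<phi> where "\<phi> = (\<lambda>e\<in>carrier E. fst e)"
  define \<sigma> where "\<sigma> = (\<lambda>a\<in>carrier N. (a, \<sigma>\<^sub>1 (c \<odot>\<^bsub>N\<^esub> a)))"
  let ?c = "\<lambda>b\<in>carrier N. c \<odot>\<^bsub>N\<^esub> b"
  have scale: "scale_ext K N c (E\<^sub>1, \<iota>\<^sub>1, \<phi>\<^sub>1) = (E, \<iota>, \<phi>)"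
    by (simp add: Let_def E_def \<iota>_def \<phi>_def)
  have "?c \<in> lin_maps N N"
    by (rule lin_mapsI) (auto simp: S.N.V.smult_simps S.N.V.smult_left_commute)
  then have "?c \<in> lin_maps_deg N N 0"
    by (rule lin_maps_degI) (use S.N.V.part_carrier in auto)
  then have hom: "?c \<in> gmod_homs G N N" "\<phi>\<^sub>1 \<in> gmod_homs G E\<^sub>1 N"
    using S.exten by (auto simp: gmod_homs_def extensions_def S.N.act_smult_right)
  \<comment> \<open>Elements of \<open>gmod_homs\<close> are undefined outside the carrier. The
    fibre product only uses the values on the carrier of \<open>N\<close>, so multiplication by
    \<open>c\<close> may be restricted to it.\<close>
  have E': "E = fibre_product N ?c E\<^sub>1 \<phi>\<^sub>1"
    by (simp add: E_def fibre_product_def cong: conj_cong)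
  have gE: "gmodule G E"
    unfolding E' by (rule gmodule_fibre_product[OF S.N.gmodule_axioms S.E.gmodule_axioms S.N.gmodule_axioms hom])
  then interpret E: gmodule G E .
  note E_simps = fibre_product_simps[of N "\<lambda>b. c \<odot>\<^bsub>N\<^esub> b" E\<^sub>1 \<phi>\<^sub>1, folded E_def]
  have Pc: "(\<zero>\<^bsub>N\<^esub>, \<iota>\<^sub>1 k) \<in> carrier E" if "k \<in> carrier K" for k
    using that S.\<iota>(1) by (simp add: E_simps S.\<phi>_\<iota>)
  have Ps: "(a, \<sigma>\<^sub>1 (c \<odot>\<^bsub>N\<^esub> a)) \<in> carrier E" if "a \<in> carrier N" for a
    using that S.\<sigma>(1) by (simp add: E_simps S.\<phi>_\<sigma>)
  have sec: "sectioned_extension G K N E \<iota> \<phi> \<sigma>"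
  proof (rule sectioned_extensionI[OF S.K.gmodule_axioms S.N.gmodule_axioms gE])
    have "\<iota> \<in> lin_maps K E"
      by (rule lin_mapsI) (use Pc in \<open>auto simp: \<iota>_def E_simps(3,4) S.\<iota>\<close>)
    then show "\<iota> \<in> lin_maps_deg K E 0"
    proof (rule lin_maps_degI)
      fix i k assume k: "k \<in> part K i"
      then show "\<iota> k \<in> part E (0 + i)"
        using S.K.V.part_carrier[OF k] S.\<iota>(1) S.\<iota>_part[OF k] by (simp add: \<iota>_def E_simps(5) S.\<phi>_\<iota>)
    qed
    show "\<iota> (act K x k) = act E x (\<iota> k)" if "x \<in> carrier G" "k \<in> carrier K" for x k
      using that by (simp add: \<iota>_def E_simps(6) S.\<iota>_act)
    show "inj_on \<iota> (carrier K)" by (rule inj_onI) (simp add: \<iota>_def S.\<iota>_eq_iff)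
    have "\<phi> \<in> lin_maps E N"
      by (rule lin_mapsI) (auto simp: \<phi>_def E_simps S.\<phi> S.N.V.smult_simps S.N.V.smult_left_commute)
    then show "\<phi> \<in> lin_maps_deg E N 0"
      by (rule lin_maps_degI) (auto simp: \<phi>_def E_simps)
    show "\<phi> (act E x A) = act N x (\<phi> A)" if "x \<in> carrier G" "A \<in> carrier E" for x A
      using that E.act_closed[OF that] by (cases A) (simp add: \<phi>_def E_simps(6))
    show "\<phi> (\<iota> k) = \<zero>\<^bsub>N\<^esub>" if "k \<in> carrier K" for k using that Pc by (simp add: \<iota>_def \<phi>_def)
    show "A \<in> \<iota> ` carrier K" if A: "A \<in> carrier E" "\<phi> A = \<zero>\<^bsub>N\<^esub>" for A
    proof -
      obtain b e where be: "A = (b, e)" by (cases A)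
      then have "b = \<zero>\<^bsub>N\<^esub>" "e \<in> carrier E\<^sub>1" "\<phi>\<^sub>1 e = \<zero>\<^bsub>N\<^esub>" using A by (auto simp: \<phi>_def E_simps)
      then show ?thesis using be S.kernelE[of e] by (auto simp: \<iota>_def)
    qed
    have "\<sigma> \<in> lin_maps N E"
      by (rule lin_mapsI) (use Ps in \<open>auto simp: \<sigma>_def E_simps(3,4) S.\<sigma> S.N.V.smult_simps
          S.N.V.smult_left_commute[of _ c]\<close>)
    then show "\<sigma> \<in> lin_maps_deg N E 0"
    proof (rule lin_maps_degI)
      fix i a assume a: "a \<in> part N i"
      then show "\<sigma> a \<in> part E (0 + i)"
        using S.N.V.part_carrier[OF a] Ps S.\<sigma>_part[of "c \<odot>\<^bsub>N\<^esub> a" i] by (auto simp: \<sigma>_def E_simps)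
    qed
    show "\<phi> (\<sigma> a) = a" if "a \<in> carrier N" for a using that Ps by (simp add: \<sigma>_def \<phi>_def)
  qed
  then interpret B: sectioned_extension G K N E \<iota> \<phi> \<sigma> .
  have "ext_cocycle G K N (E, \<iota>, \<phi>) \<sigma> = c \<odot>\<^bsub>hom_space G (hom_gmodule G N K)\<^esub> S.f"
  proof (rule B.cocycleI)
    fix x a assume xa: "x \<in> carrier G" "a \<in> carrier N"
    note k = S.cocycle[OF xa]
    show "(c \<odot>\<^bsub>hom_space G (hom_gmodule G N K)\<^esub> S.f) x a \<in> carrier K" using xa k by simp
    have n: "act N x a \<in> carrier N" using xa by simp
    have e: "act E\<^sub>1 x (\<sigma>\<^sub>1 a) = \<sigma>\<^sub>1 (act N x a) \<oplus>\<^bsub>E\<^sub>1\<^esub> \<iota>\<^sub>1 (S.f x a)"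
      using xa n k(1) S.\<sigma>(1) S.\<iota>(1) by (simp add: k(2) S.E.V.group_simps)
    have "act E x (\<sigma> a) = \<iota> (c \<odot>\<^bsub>K\<^esub> S.f x a) \<oplus>\<^bsub>E\<^esub> \<sigma> (act N x a)"
      using xa n k(1) S.\<sigma>(1) S.\<iota>(1)
      by (simp add: e \<sigma>_def \<iota>_def E_simps(3,6) S.\<iota> S.\<sigma> S.N.act_smult_right S.E.act_smult_right
          S.E.V.smult_simps S.E.V.group_simps)
    then show "\<iota> ((c \<odot>\<^bsub>hom_space G (hom_gmodule G N K)\<^esub> S.f) x a) = act E x (\<sigma> a) \<ominus>\<^bsub>E\<^esub> \<sigma> (act N x a)"
      using xa k B.\<sigma>(1)[OF n] B.\<sigma>(1)[OF xa(2)] B.\<iota>(1)[of "c \<odot>\<^bsub>K\<^esub> S.f x a"]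
      by (simp add: E.V.group_simps)
  qed simp_all
  with scale sec that show thesis by blast
qed

text \<open>The extension is the twisted sum by \<open>f\<close> with the section a \<mapsto> (0,
  a). Its elements are pairs, so the structure is transported along \<open>h\<close> to the
  prescribed element type.\<close>

lemma sectioned_extension_exists:
  fixes G :: "('k::field, 'g, 'x) lie_super_scheme" and K :: "('k, 'g, 'v) gmodule" and N :: "('k, 'g, 'w) gmodule"
    and h :: "'v \<times> 'w \<Rightarrow> 'e"
  assumes KN: "gmodule G K" "gmodule G N" and f: "f \<in> Z1 G (hom_gmodule G N K)"
    and h: "inj_on h (carrier K \<times> carrier N)"
  obtains E :: "('k, 'g, 'e) gmodule" and \<iota> \<phi> \<sigma> where
    "sectioned_extension G K N E \<iota> \<phi> \<sigma>" "ext_cocycle G K N (E, \<iota>, \<phi>) \<sigma> = f"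
proof -
  interpret K: gmodule G K by fact
  interpret N: gmodule G N by fact
  interpret M: gmodule G "hom_gmodule G N K" by (rule gmodule_hom_gmodule[OF KN(2,1)])
  let ?M = "hom_gmodule G N K"
  note fl = lin_mapsD[OF Z1D(2)[OF f], simplified]
  note fx = lin_mapsD[OF fl(1)]
  have fd: "f x \<in> lin_maps_deg N K i" if "x \<in> part G i" for x i
    using lin_maps_degD(2)[OF Z1D(1)[OF f] that] by simp
  define T where "T = twisted_sum K N f"
  have gT: "gmodule G T"
    unfolding T_def
  proof (rule gmodule_twisted_sum[OF KN])
    show "f x a \<in> part K (i + j)" if "x \<in> part G i" "a \<in> part N j" for i j x a
      using lin_maps_degD(2)[OF fd[OF that(1)] that(2)] .
    show "f (bracket G x y) a \<oplus>\<^bsub>K\<^esub> koszul i j \<odot>\<^bsub>K\<^esub> (act K y (f x a) \<oplus>\<^bsub>K\<^esub> f y (act N x a)) =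
        act K x (f y a) \<oplus>\<^bsub>K\<^esub> f x (act N y a)"
      if x: "x \<in> part G i" and y: "y \<in> part G j" and "a \<in> part N l" for i j l x y a
    proof -
      have a: "a \<in> carrier N" using that N.V.part_carrier by blast
      note c = K.G.part_carrier[OF x] K.G.part_carrier[OF y] K.G.part_carrier[OF K.G.bracket_part[OF x y]]
      have l: "f x \<in> carrier ?M" "f y \<in> carrier ?M" "f (bracket G x y) \<in> carrier ?M"
        using fl(1) c by simp_all
      have m: "f (bracket G x y) \<oplus>\<^bsub>?M\<^esub> koszul i j \<odot>\<^bsub>?M\<^esub> act ?M y (f x) = act ?M x (f y)"
        using M.V.group_simps(6)[OF M.act_closed[OF c(1) l(2)] M.V.smultC[OF M.act_closed[OF c(2) l(1)]] l(3)]
          Z1D(3)[OF f x y] by blast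
      have e1: "act ?M x (f y) a = act K x (f y a) \<ominus>\<^bsub>K\<^esub> koszul i j \<odot>\<^bsub>K\<^esub> f y (act N x a)"
        by (rule act_hom_gmodule_homogeneous[OF KN(2,1) x fd[OF y] a])
      have e2: "act ?M y (f x) a = act K y (f x a) \<ominus>\<^bsub>K\<^esub> koszul j i \<odot>\<^bsub>K\<^esub> f x (act N y a)"
        by (rule act_hom_gmodule_homogeneous[OF KN(2,1) y fd[OF x] a])
      have cl: "f x a \<in> carrier K" "f y a \<in> carrier K" "f (bracket G x y) a \<in> carrier K"
        "f y (act N x a) \<in> carrier K" "f x (act N y a) \<in> carrier K" using fx(1) c a by simp_all
      have "f (bracket G x y) a \<oplus>\<^bsub>K\<^esub> koszul i j \<odot>\<^bsub>K\<^esub> act ?M y (f x) a = act ?M x (f y) a"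
        using fun_cong[OF m, of a] a by simp
      then show ?thesis
        using cl c bit_cases[of i] bit_cases[of j]
        by (auto simp: e1 e2 koszul_def K.V.group_simps)
    qed
  qed (auto simp: fl fx)
  interpret T: gmodule G T by (rule gT)
  have T_simps: "carrier T = carrier K \<times> carrier N" "\<zero>\<^bsub>T\<^esub> = (\<zero>\<^bsub>K\<^esub>, \<zero>\<^bsub>N\<^esub>)"
    "(v, w) \<oplus>\<^bsub>T\<^esub> (v', w') = (v \<oplus>\<^bsub>K\<^esub> v', w \<oplus>\<^bsub>N\<^esub> w')" "c \<odot>\<^bsub>T\<^esub> (v, w) = (c \<odot>\<^bsub>K\<^esub> v, c \<odot>\<^bsub>N\<^esub> w)"
    "part T i = part K i \<times> part N i" "act T x (v, w) = (act K x v \<oplus>\<^bsub>K\<^esub> f x w, act N x w)" for v w v' w' c i x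
    by (simp_all add: T_def)
  define j where "j = inv_into (carrier T) h"
  have j: "j (h t) = t" if "t \<in> carrier T" for t
    using inv_into_f_f[of h "carrier T" t] h that by (simp add: j_def T_simps)
  define E :: "('k, 'g, 'e) gmodule" where "E =
    \<lparr>carrier = h ` carrier T, monoid.mult = undefined, one = undefined, zero = h \<zero>\<^bsub>T\<^esub>,
     add = (\<lambda>d e. h (j d \<oplus>\<^bsub>T\<^esub> j e)), module.smult = (\<lambda>c e. h (c \<odot>\<^bsub>T\<^esub> j e)),
     part = (\<lambda>i. h ` part T i), act = (\<lambda>x e. h (act T x (j e)))\<rparr>"
  have E_simps: "carrier E = h ` carrier T" "\<zero>\<^bsub>E\<^esub> = h \<zero>\<^bsub>T\<^esub>" "part E i = h ` part T i"
    "\<lbrakk>s \<in> carrier T; t \<in> carrier T\<rbrakk> \<Longrightarrow> h s \<oplus>\<^bsub>E\<^esub> h t = h (s \<oplus>\<^bsub>T\<^esub> t)"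
    "s \<in> carrier T \<Longrightarrow> c \<odot>\<^bsub>E\<^esub> h s = h (c \<odot>\<^bsub>T\<^esub> s)"
    "s \<in> carrier T \<Longrightarrow> act E x (h s) = h (act T x s)" for i s t c x
    by (simp_all add: E_def j)
  have gE: "gmodule G E"
  proof (rule gmodule_surj_image[OF gT, where q = h])
    show "h (component T 0 v) = h \<zero>\<^bsub>T\<^esub>" if "v \<in> carrier T" "h v = h \<zero>\<^bsub>T\<^esub>" for v
    proof -
      have "v = j (h \<zero>\<^bsub>T\<^esub>)" using j[OF that(1)] unfolding that(2) by (rule sym)
      then have "v = \<zero>\<^bsub>T\<^esub>" unfolding j[OF T.V.zero_closed] .
      then show ?thesis by simp
    qed
  qed (simp_all add: E_simps)
  then interpret E: gmodule G E .
  define \<iota> where "\<iota> = (\<lambda>k\<in>carrier K. h (k, \<zero>\<^bsub>N\<^esub>))"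
  define \<phi> where "\<phi> = (\<lambda>e\<in>carrier E. snd (j e))"
  define \<sigma> where "\<sigma> = (\<lambda>a\<in>carrier N. h (\<zero>\<^bsub>K\<^esub>, a))"
  have \<phi>h: "\<phi> (h t) = snd t" if "t \<in> carrier T" for t using that by (simp add: \<phi>_def E_simps j)
  have f0: "f x \<zero>\<^bsub>N\<^esub> = \<zero>\<^bsub>K\<^esub>" if "x \<in> carrier G" for x
    using lin_maps_zero[OF N.V.superspace_axioms K.V.superspace_axioms fl(1)[OF that]] .
  have sec: "sectioned_extension G K N E \<iota> \<phi> \<sigma>"
  proof (rule sectioned_extensionI[OF KN gE])
    have "\<iota> \<in> lin_maps K E"
      by (rule lin_mapsI) (auto simp: \<iota>_def E_simps T_simps)
    then show "\<iota> \<in> lin_maps_deg K E 0"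
      by (rule lin_maps_degI) (use K.V.part_carrier in \<open>auto simp: \<iota>_def E_simps T_simps\<close>)
    show "\<iota> (act K x k) = act E x (\<iota> k)" if "x \<in> carrier G" "k \<in> carrier K" for x k
      using that by (simp add: \<iota>_def E_simps T_simps f0)
    show "inj_on \<iota> (carrier K)"
      by (rule inj_onI) (auto simp: \<iota>_def dest: inj_onD[OF h])
    have "\<phi> \<in> lin_maps E N"
    proof (rule lin_mapsI)
      fix d assume "d \<in> carrier E"
      then obtain v w where d: "d = h (v, w)" "v \<in> carrier K" "w \<in> carrier N" by (auto simp: E_simps T_simps)
      show "\<phi> d \<in> carrier N" using d by (simp add: \<phi>h T_simps)
      show "\<phi> (c \<odot>\<^bsub>E\<^esub> d) = c \<odot>\<^bsub>N\<^esub> \<phi> d" for c using d by (simp add: \<phi>h E_simps T_simps)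
      fix e assume "e \<in> carrier E"
      then obtain v' w' where e: "e = h (v', w')" "v' \<in> carrier K" "w' \<in> carrier N" by (auto simp: E_simps T_simps)
      show "\<phi> (d \<oplus>\<^bsub>E\<^esub> e) = \<phi> d \<oplus>\<^bsub>N\<^esub> \<phi> e" using d e by (simp add: \<phi>h E_simps T_simps)
    qed (simp add: \<phi>_def)
    then show "\<phi> \<in> lin_maps_deg E N 0"
      by (rule lin_maps_degI)
        (use K.V.part_carrier N.V.part_carrier in \<open>auto simp: E_simps(3) T_simps \<phi>h\<close>)
    show "\<phi> (act E x e) = act N x (\<phi> e)" if xe: "x \<in> carrier G" "e \<in> carrier E" for x e
    proof -
      obtain v w where e: "e = h (v, w)" "v \<in> carrier K" "w \<in> carrier N"
        using xe by (auto simp: E_simps T_simps)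
      then show ?thesis using xe(1) by (simp add: \<phi>h E_simps T_simps fx)
    qed
    show "\<phi> (\<iota> k) = \<zero>\<^bsub>N\<^esub>" if "k \<in> carrier K" for k using that by (simp add: \<iota>_def \<phi>h T_simps)
    show "e \<in> \<iota> ` carrier K" if \<phi>e: "e \<in> carrier E" "\<phi> e = \<zero>\<^bsub>N\<^esub>" for e
    proof -
      obtain v w where e: "e = h (v, w)" "v \<in> carrier K" "w \<in> carrier N"
        using \<phi>e by (auto simp: E_simps T_simps)
      then show ?thesis using \<phi>e(2) by (auto simp: \<phi>h T_simps \<iota>_def)
    qed
    have "\<sigma> \<in> lin_maps N E"
      by (rule lin_mapsI) (auto simp: \<sigma>_def E_simps T_simps)
    then show "\<sigma> \<in> lin_maps_deg N E 0"
      by (rule lin_maps_degI) (use N.V.part_carrier in \<open>auto simp: \<sigma>_def E_simps T_simps\<close>)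
    show "\<phi> (\<sigma> a) = a" if "a \<in> carrier N" for a using that by (simp add: \<sigma>_def \<phi>h T_simps)
  qed
  then interpret S: sectioned_extension G K N E \<iota> \<phi> \<sigma> .
  have "ext_cocycle G K N (E, \<iota>, \<phi>) \<sigma> = f"
  proof (rule S.cocycleI)
    fix x a assume xa: "x \<in> carrier G" "a \<in> carrier N"
    show "f x a \<in> carrier K" using xa fx(1) by simp
    have n: "act N x a \<in> carrier N" using xa by simp
    have "act E x (\<sigma> a) = \<iota> (f x a) \<oplus>\<^bsub>E\<^esub> \<sigma> (act N x a)"
      using xa n fx(1) by (simp add: \<sigma>_def \<iota>_def E_simps T_simps)
    then show "\<iota> (f x a) = act E x (\<sigma> a) \<ominus>\<^bsub>E\<^esub> \<sigma> (act N x a)"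
      using xa S.\<sigma>(1)[OF n] S.\<sigma>(1)[OF xa(2)] S.\<iota>(1)[of "f x a"] fx(1) by (simp add: E.V.group_simps)
  qed (use fl(4) fx(4) in auto)
  with sec that show thesis by blast
qed

section \<open>Restricted cohomology classes\<close>

context
  fixes G :: "('k::field, 'g, 'x) restricted_lie_super_scheme" and M :: "('k, 'g, 'm, 'z) gmodule_scheme"
  assumes G: "restricted_lie_superalgebra G" and M: "restricted_gmodule G M" and char: "CHAR('k) > 0"
begin

interpretation G: restricted_lie_superalgebra G by (fact G)
interpretation M: restricted_gmodule G M by (fact M)

abbreviation (input) Z where "Z \<equiv> (hom_space (renv_plus G) M)\<lparr>carrier := Z1_res G M\<rparr>"

lemma renv_plus_closed:
  "u \<in> carrier (renv_plus G) \<Longrightarrow> v \<in> carrier (renv_plus G) \<Longrightarrow> u \<oplus>\<^bsub>renv_plus G\<^esub> v \<in> carrier (renv_plus G)"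
  "u \<in> carrier (renv_plus G) \<Longrightarrow> v \<in> carrier (renv_plus G) \<Longrightarrow> u \<otimes>\<^bsub>renv_plus G\<^esub> v \<in> carrier (renv_plus G)"
  "u \<in> carrier (renv_plus G) \<Longrightarrow> c \<odot>\<^bsub>renv_plus G\<^esub> u \<in> carrier (renv_plus G)"
  "u \<in> part (renv_plus G) i \<Longrightarrow> u \<in> carrier (renv_plus G)"
proof -
  let ?P = "{t \<in> carrier (free_alg G). 0 \<notin> Poly_Mapping.keys t}"
  have c: "carrier (renv_plus G) = renv_class G ` ?P"
    by (simp add: G.renv_plus_simps G.renv_aug_eq)
  show "u \<oplus>\<^bsub>renv_plus G\<^esub> v \<in> carrier (renv_plus G)" "u \<otimes>\<^bsub>renv_plus G\<^esub> v \<in> carrier (renv_plus G)"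
    if uv: "u \<in> carrier (renv_plus G)" "v \<in> carrier (renv_plus G)"
  proof -
    obtain s t where st: "s \<in> ?P" "t \<in> ?P" "u = renv_class G s" "v = renv_class G t" using uv unfolding c by blast
    then have "u \<oplus>\<^bsub>renv_plus G\<^esub> v = renv_class G (s + t)" "u \<otimes>\<^bsub>renv_plus G\<^esub> v = renv_class G (s * t)"
      by (simp_all add: G.renv_plus_simps G.renv_class_simps)
    moreover have "s + t \<in> ?P" "s * t \<in> ?P"
      using FP_closed(1)[OF G M char st(1,2)] FP_closed(2)[OF G M char _ st(2), of s] st(1) by simp_all
    ultimately show "u \<oplus>\<^bsub>renv_plus G\<^esub> v \<in> carrier (renv_plus G)" "u \<otimes>\<^bsub>renv_plus G\<^esub> v \<in> carrier (renv_plus G)"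
      unfolding c by blast+
  qed
  show "c \<odot>\<^bsub>renv_plus G\<^esub> u \<in> carrier (renv_plus G)" if u: "u \<in> carrier (renv_plus G)" for c
  proof -
    obtain t where t: "t \<in> ?P" "u = renv_class G t" using u unfolding \<open>carrier (renv_plus G) = _\<close> by blast
    then have "c \<odot>\<^bsub>renv_plus G\<^esub> u = renv_class G (Poly_Mapping.single 0 c * t)"
      by (simp add: G.renv_plus_simps G.renv_class_simps)
    moreover have "Poly_Mapping.single 0 c * t \<in> ?P"
      using FP_closed(2)[OF G M char _ t(1), of "Poly_Mapping.single 0 c"] by simp
    ultimately show ?thesis unfolding \<open>carrier (renv_plus G) = _\<close> by blast
  qed
qed (simp add: G.renv_plus_simps)

lemma renv_act_linear:
  assumes u: "u \<in> carrier (renv_plus G)" and m: "m \<in> carrier M"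
  shows "renv_act M u m \<in> carrier M"
    and "n \<in> carrier M \<Longrightarrow> renv_act M u (m \<oplus>\<^bsub>M\<^esub> n) = renv_act M u m \<oplus>\<^bsub>M\<^esub> renv_act M u n"
    and "renv_act M u (c \<odot>\<^bsub>M\<^esub> m) = c \<odot>\<^bsub>M\<^esub> renv_act M u m"
proof -
  obtain t where t: "t \<in> carrier (free_alg G)" "u = renv_class G t"
    using u by (auto simp: G.renv_plus_simps G.renv_aug_eq)
  show "renv_act M u m \<in> carrier M" "renv_act M u (c \<odot>\<^bsub>M\<^esub> m) = c \<odot>\<^bsub>M\<^esub> renv_act M u m"
    using t m by (simp_all add: renv_act_class[OF G M] M.free_act_smult_right)
  show "n \<in> carrier M \<Longrightarrow> renv_act M u (m \<oplus>\<^bsub>M\<^esub> n) = renv_act M u m \<oplus>\<^bsub>M\<^esub> renv_act M u n"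
    using t m by (simp add: renv_act_class[OF G M] M.free_act_add_right)
qed

lemma Z1_resD:
  assumes "f \<in> Z1_res G M"
  shows "f \<in> lin_maps_deg (renv_plus G) M 0" "f \<in> lin_maps (renv_plus G) M"
    "\<lbrakk>u \<in> carrier (renv_plus G); v \<in> carrier (renv_plus G)\<rbrakk> \<Longrightarrow> f (u \<otimes>\<^bsub>renv_plus G\<^esub> v) = renv_act M u (f v)"
  using assms by (auto simp: Z1_res_def dest: lin_maps_degD)

lemma Z1_res_add:
  assumes f: "f \<in> Z1_res G M" and g: "g \<in> Z1_res G M"
  shows "f \<oplus>\<^bsub>hom_space (renv_plus G) M\<^esub> g \<in> Z1_res G M"
proof -
  note F = Z1_resD[OF f] lin_mapsD[OF Z1_resD(2)[OF f]] and H = Z1_resD[OF g] lin_mapsD[OF Z1_resD(2)[OF g]]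
  let ?h = "\<lambda>a\<in>carrier (renv_plus G). f a \<oplus>\<^bsub>M\<^esub> g a"
  have "?h \<in> lin_maps (renv_plus G) M"
    by (rule lin_mapsI) (auto simp: F H renv_plus_closed M.V.smult_simps M.V.group_simps)
  then have "?h \<in> lin_maps_deg (renv_plus G) M 0"
    by (rule lin_maps_degI)
      (use lin_maps_degD(2)[OF F(1)] lin_maps_degD(2)[OF H(1)] renv_plus_closed(4) in auto)
  then show ?thesis by (simp add: Z1_res_def renv_plus_closed renv_act_linear F H)
qed

lemma Z1_res_smult:
  assumes f: "f \<in> Z1_res G M"
  shows "c \<odot>\<^bsub>hom_space (renv_plus G) M\<^esub> f \<in> Z1_res G M"
proof -
  note F = Z1_resD[OF f] lin_mapsD[OF Z1_resD(2)[OF f]]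
  let ?h = "\<lambda>a\<in>carrier (renv_plus G). c \<odot>\<^bsub>M\<^esub> f a"
  have "?h \<in> lin_maps (renv_plus G) M"
    by (rule lin_mapsI) (auto simp: F renv_plus_closed M.V.smult_simps M.V.smult_left_commute)
  then have "?h \<in> lin_maps_deg (renv_plus G) M 0"
    by (rule lin_maps_degI) (use lin_maps_degD(2)[OF F(1)] renv_plus_closed(4) in auto)
  then show ?thesis by (simp add: Z1_res_def renv_plus_closed renv_act_linear F)
qed

lemma res_incl_linear:
  "f \<in> Z1_res G M \<Longrightarrow> g \<in> Z1_res G M \<Longrightarrow>
    res_incl G (f \<oplus>\<^bsub>hom_space (renv_plus G) M\<^esub> g) = res_incl G f \<oplus>\<^bsub>hom_space G M\<^esub> res_incl G g"
  "f \<in> Z1_res G M \<Longrightarrow>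
    res_incl G (c \<odot>\<^bsub>hom_space (renv_plus G) M\<^esub> f) = c \<odot>\<^bsub>hom_space G M\<^esub> res_incl G f"
  by (auto simp: res_incl_def fun_eq_iff G.renv_plus_simps G.renv_class_simps G.renv_incl_aug)

lemma B1_resE:
  assumes "b \<in> B1_res G M"
  obtains m where "m \<in> part M 0" "m \<in> carrier M" "b = (\<lambda>u\<in>carrier (renv_plus G). renv_act M u m)"
  using assms M.V.part_carrier by (auto simp: B1_res_def)

lemma B1_res_subset: "B1_res G M \<subseteq> Z1_res G M"
  using B1_res_Z1_res(1)[OF G M char] by (auto simp: B1_res_def)

text \<open>The general result on \<open>hom_space\<close> would require \<open>renv_plus G\<close>
  to be a superspace, in particular that its two parts meet trivially. Checking the group axioms on
  the cocycles themselves avoids that question.\<close>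

lemma abelian_group_Z: "abelian_group Z"
proof (rule abelian_groupI)
  fix f g h assume f: "f \<in> carrier Z" and g: "g \<in> carrier Z" and h: "h \<in> carrier Z"
  note c = lin_mapsD[OF Z1_resD(2)]
  show "f \<oplus>\<^bsub>Z\<^esub> g \<in> carrier Z" using f g Z1_res_add by simp
  show "f \<oplus>\<^bsub>Z\<^esub> g \<oplus>\<^bsub>Z\<^esub> h = f \<oplus>\<^bsub>Z\<^esub> (g \<oplus>\<^bsub>Z\<^esub> h)" "f \<oplus>\<^bsub>Z\<^esub> g = g \<oplus>\<^bsub>Z\<^esub> f"
    using c(1)[of f] c(1)[of g] c(1)[of h] f g h by (auto simp: fun_eq_iff M.V.group_simps)
  show "\<zero>\<^bsub>Z\<^esub> \<oplus>\<^bsub>Z\<^esub> f = f" using c[of f] f by (auto simp: fun_eq_iff)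
  show "\<exists>f'\<in>carrier Z. f' \<oplus>\<^bsub>Z\<^esub> f = \<zero>\<^bsub>Z\<^esub>"
    using Z1_res_smult[of f "- 1"] f c(1)[of f]
    by (intro bexI[of _ "(- 1) \<odot>\<^bsub>hom_space (renv_plus G) M\<^esub> f"]) (auto simp: fun_eq_iff M.V.l_neg)
next
  \<comment> \<open>The zero map is a cocycle because it is the coboundary of 0.\<close>
  have "(\<lambda>u\<in>carrier (renv_plus G). renv_act M u \<zero>\<^bsub>M\<^esub>) = \<zero>\<^bsub>Z\<^esub>"
    using renv_act_linear(3)[of _ "\<zero>\<^bsub>M\<^esub>" 0] renv_act_linear(1)[of _ "\<zero>\<^bsub>M\<^esub>"] by (auto simp: fun_eq_iff)
  then show "\<zero>\<^bsub>Z\<^esub> \<in> carrier Z" using B1_res_Z1_res(1)[OF G M char, of "\<zero>\<^bsub>M\<^esub>"] by simp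
qed

lemma abelian_subgroup_B1_res: "abelian_subgroup (B1_res G M) Z"
proof (rule abelian_subgroupI3[OF _ abelian_group_Z], rule additive_subgroup.intro)
  interpret Z: abelian_group Z by (rule abelian_group_Z)
  show "subgroup (B1_res G M) (add_monoid Z)"
  proof (rule Z.add.subgroupI)
    show "B1_res G M \<subseteq> carrier Z" using B1_res_subset by simp
    show "B1_res G M \<noteq> {}" using M.V.part_closed(5) by (auto simp: B1_res_def)
  next
    fix a assume a: "a \<in> B1_res G M"
    then obtain m where m: "m \<in> part M 0" "m \<in> carrier M" "a = (\<lambda>u\<in>carrier (renv_plus G). renv_act M u m)"
      by (rule B1_resE)
    have n: "(- 1) \<odot>\<^bsub>hom_space (renv_plus G) M\<^esub> a = (\<lambda>u\<in>carrier (renv_plus G). renv_act M u ((- 1) \<odot>\<^bsub>M\<^esub> m))"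
      using m renv_act_linear by (auto simp: fun_eq_iff simp del: M.V.smult_consts)
    have aZ: "a \<in> Z1_res G M" using a B1_res_subset by auto
    have "((- 1) \<odot>\<^bsub>hom_space (renv_plus G) M\<^esub> a) \<oplus>\<^bsub>Z\<^esub> a = \<zero>\<^bsub>Z\<^esub>"
      using lin_mapsD(1)[OF Z1_resD(2)[OF aZ]] by (auto simp: fun_eq_iff M.V.l_neg)
    then have "\<ominus>\<^bsub>Z\<^esub> a = (- 1) \<odot>\<^bsub>hom_space (renv_plus G) M\<^esub> a"
      using Z.minus_equality[of "(- 1) \<odot>\<^bsub>hom_space (renv_plus G) M\<^esub> a" a] aZ Z1_res_smult[OF aZ, of "- 1"] by simp
    also have "\<dots> \<in> B1_res G M" unfolding n B1_res_def using m M.V.part_closed(2)[of m 0 "- 1"] by blast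
    finally show "\<ominus>\<^bsub>Z\<^esub> a \<in> B1_res G M" .
  next
    fix a b assume "a \<in> B1_res G M" "b \<in> B1_res G M"
    then obtain m n where m: "m \<in> part M 0" "m \<in> carrier M" "a = (\<lambda>u\<in>carrier (renv_plus G). renv_act M u m)"
      and n: "n \<in> part M 0" "n \<in> carrier M" "b = (\<lambda>u\<in>carrier (renv_plus G). renv_act M u n)"
      by (auto elim!: B1_resE)
    have "a \<oplus>\<^bsub>Z\<^esub> b = (\<lambda>u\<in>carrier (renv_plus G). renv_act M u (m \<oplus>\<^bsub>M\<^esub> n))"
      using m n renv_act_linear by (auto simp: fun_eq_iff)
    then show "a \<oplus>\<^bsub>Z\<^esub> b \<in> B1_res G M"
      unfolding B1_res_def using M.V.part_closed(1)[OF m(1) n(1)] by blast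
  qed
qed

lemma B1_res_smult: "b \<in> B1_res G M \<Longrightarrow> c \<odot>\<^bsub>hom_space (renv_plus G) M\<^esub> b \<in> B1_res G M"
proof -
  assume "b \<in> B1_res G M"
  then obtain m where m: "m \<in> part M 0" "m \<in> carrier M" "b = (\<lambda>u\<in>carrier (renv_plus G). renv_act M u m)"
    by (rule B1_resE)
  have "c \<odot>\<^bsub>hom_space (renv_plus G) M\<^esub> b = (\<lambda>u\<in>carrier (renv_plus G). renv_act M u (c \<odot>\<^bsub>M\<^esub> m))"
    using m renv_act_linear by (auto simp: fun_eq_iff)
  then show ?thesis unfolding B1_res_def using M.V.part_closed(2)[OF m(1)] by blast
qed

abbreviation (input) coset where "coset f \<equiv> B1_res G M +>\<^bsub>hom_space (renv_plus G) M\<^esub> f"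

lemma H1_res_simps:
  "carrier (H1_res G M) = coset ` Z1_res G M"
  "\<lbrakk>f \<in> Z1_res G M; g \<in> Z1_res G M\<rbrakk> \<Longrightarrow>
    coset f \<oplus>\<^bsub>H1_res G M\<^esub> coset g = coset (f \<oplus>\<^bsub>hom_space (renv_plus G) M\<^esub> g)"
  "f \<in> Z1_res G M \<Longrightarrow> c \<odot>\<^bsub>H1_res G M\<^esub> coset f = coset (c \<odot>\<^bsub>hom_space (renv_plus G) M\<^esub> f)"
proof -
  interpret B: abelian_subgroup "B1_res G M" Z by (rule abelian_subgroup_B1_res)
  have Z: "B1_res G M +>\<^bsub>Z\<^esub> f = coset f" for f by (simp add: a_r_coset_def')
  note defs = H1_res_def quot_module_def module.defs ring.defs FactRing_def
  show "carrier (H1_res G M) = coset ` Z1_res G M" by (auto simp: defs A_RCOSETS_def' Z[simplified])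
  show "coset f \<oplus>\<^bsub>H1_res G M\<^esub> coset g = coset (f \<oplus>\<^bsub>hom_space (renv_plus G) M\<^esub> g)"
    if "f \<in> Z1_res G M" "g \<in> Z1_res G M"
    using B.a_rcos_sum[of f g] that by (simp add: defs Z[simplified])
  show "c \<odot>\<^bsub>H1_res G M\<^esub> coset f = coset (c \<odot>\<^bsub>hom_space (renv_plus G) M\<^esub> f)" if f: "f \<in> Z1_res G M"
  proof -
    have "(\<Union>a\<in>B1_res G M +>\<^bsub>Z\<^esub> f. B1_res G M +>\<^bsub>Z\<^esub> (c \<odot>\<^bsub>hom_space (renv_plus G) M\<^esub> a)) =
      B1_res G M +>\<^bsub>Z\<^esub> (c \<odot>\<^bsub>hom_space (renv_plus G) M\<^esub> f)"
    proof (rule B.UN_rcos_map)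
      fix a b assume "a \<in> carrier Z" "b \<in> carrier Z"
      then show "c \<odot>\<^bsub>hom_space (renv_plus G) M\<^esub> (a \<oplus>\<^bsub>Z\<^esub> b) =
        (c \<odot>\<^bsub>hom_space (renv_plus G) M\<^esub> a) \<oplus>\<^bsub>Z\<^esub> (c \<odot>\<^bsub>hom_space (renv_plus G) M\<^esub> b)"
        using lin_mapsD(1)[OF Z1_resD(2)] by (auto simp: fun_eq_iff M.V.smult_simps)
    qed (use f B1_res_smult Z1_res_smult in \<open>auto simp del: hom_space_simps\<close>)
    then show ?thesis by (simp add: defs Z[simplified])
  qed
qed

text \<open>A restricted class consists of all restricted cocycles above one ordinary class, so
  nothing is lost on passing to the Lie superalgebra. For the converse inclusion an ordinary
  coboundary is lifted with the same \<open>m\<close>, and \<open>res_incl_inj\<close> identifies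
  the cocycles.\<close>

lemma coset_eq_res_incl:
  assumes g: "g \<in> Z1_res G M"
  shows "coset g = {f \<in> Z1_res G M. res_incl G f \<in> B1 G M +>\<^bsub>hom_space G M\<^esub> res_incl G g}"
proof
  show "coset g \<subseteq> {f \<in> Z1_res G M. res_incl G f \<in> B1 G M +>\<^bsub>hom_space G M\<^esub> res_incl G g}"
  proof
    fix f assume "f \<in> coset g"
    then obtain b where b: "b \<in> B1_res G M" "f = b \<oplus>\<^bsub>hom_space (renv_plus G) M\<^esub> g"
      by (auto simp: a_r_coset_def' simp del: hom_space_simps)
    then have bZ: "b \<in> Z1_res G M" using B1_res_subset by auto
    obtain m where m: "m \<in> part M 0" "b = (\<lambda>u\<in>carrier (renv_plus G). renv_act M u m)"
      using b(1) by (rule B1_resE)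
    have "res_incl G b \<in> B1 G M" unfolding m(2) B1_res_Z1_res(2)[OF G M char m(1)] using m by (auto simp: B1_def)
    moreover have "res_incl G f = res_incl G b \<oplus>\<^bsub>hom_space G M\<^esub> res_incl G g"
      unfolding b(2) by (rule res_incl_linear(1)[OF bZ g])
    ultimately have "res_incl G f \<in> B1 G M +>\<^bsub>hom_space G M\<^esub> res_incl G g"
      unfolding a_r_coset_def' by blast
    then show "f \<in> {f \<in> Z1_res G M. res_incl G f \<in> B1 G M +>\<^bsub>hom_space G M\<^esub> res_incl G g}"
      using Z1_res_add[OF bZ g] b(2) by simp
  qed
  show "{f \<in> Z1_res G M. res_incl G f \<in> B1 G M +>\<^bsub>hom_space G M\<^esub> res_incl G g} \<subseteq> coset g"
  proof
    fix f assume f: "f \<in> {f \<in> Z1_res G M. res_incl G f \<in> B1 G M +>\<^bsub>hom_space G M\<^esub> res_incl G g}"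
    then obtain b where b: "b \<in> B1 G M" "res_incl G f = b \<oplus>\<^bsub>hom_space G M\<^esub> res_incl G g"
      by (auto simp: a_r_coset_def' simp del: hom_space_simps)
    then obtain m where m: "m \<in> part M 0" "b = (\<lambda>x\<in>carrier G. act M x m)" by (auto simp: B1_def)
    define b' where "b' = (\<lambda>u\<in>carrier (renv_plus G). renv_act M u m)"
    have b': "b' \<in> Z1_res G M" "res_incl G b' = b" "b' \<in> B1_res G M"
      using B1_res_Z1_res[OF G M char m(1)] m by (auto simp: b'_def B1_res_def)
    have "res_incl G f = res_incl G (b' \<oplus>\<^bsub>hom_space (renv_plus G) M\<^esub> g)"
      unfolding b(2) res_incl_linear(1)[OF b'(1) g] b'(2) ..
    then have "f = b' \<oplus>\<^bsub>hom_space (renv_plus G) M\<^esub> g"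
      by (intro res_incl_inj[OF G M char]) (use f Z1_res_add[OF b'(1) g] in auto)
    then show "f \<in> coset g" unfolding a_r_coset_def' using b'(3) by blast
  qed
qed

end


section \<open>The comparison isomorphism\<close>

theorem proposition3p2:
  fixes G :: "('k::field, 'g) restricted_lie_super"
    and K :: "('k, 'g, 'v) gmodule"
    and N :: "('k, 'g, 'w) gmodule"
  assumes "CHAR('k) > 2"
    and "restricted_lie_superalgebra G"
    and "restricted_gmodule G K"
    and "restricted_gmodule G N"
    and "\<exists>h :: 'v \<times> 'w \<Rightarrow> 'e. inj_on h (carrier K \<times> carrier N)"
  shows "\<exists>F\<^sub>r \<in> lin_isos
      (Ext_res G K N :: ('k, ('k, 'g, 'v, 'w, 'e) extension set) module)
      (H1_res G (hom_gmodule G N K)).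
    \<forall>C \<in> carrier (Ext_res G K N).
      i1 G (hom_gmodule G N K) (F\<^sub>r C) = F_map G K N (i2 G K N C)"
proof -
  interpret K: restricted_gmodule G K by fact
  interpret N: restricted_gmodule G N by fact
  let ?M = "hom_gmodule G N K"
  let ?S = "res_extensions G K N :: ('k, 'g, 'v, 'w, 'e) extension set"
  let ?X = "extensions G K N :: ('k, 'g, 'v, 'w, 'e) extension set"
  let ?cc = "cocycles G K N :: ('k, 'g, 'v, 'w, 'e) extension \<Rightarrow> _"
  let ?E = "Ext_res G K N :: ('k, ('k, 'g, 'v, 'w, 'e) extension set) module"
  let ?HG = "hom_space G ?M" and ?HP = "hom_space (renv_plus G) ?M"
  have char: "CHAR('k) > 0" using assms(1) by simp
  have M: "restricted_gmodule G ?M" by (rule restricted_gmodule_hom_gmodule[OF char assms(2,4,3)])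
  note KN = K.gmodule_axioms N.gmodule_axioms
  note GM = assms(2) M char
  obtain h :: "'v \<times> 'w \<Rightarrow> 'e" where h: "inj_on h (carrier K \<times> carrier N)" using assms(5) by blast

  have SX: "\<xi> \<in> ?X" if "\<xi> \<in> ?S" for \<xi> using that by (auto simp: res_extensions_def)
  have cc_coset: "?cc \<xi> = B1 G ?M +>\<^bsub>?HG\<^esub> f" if "\<xi> \<in> ?X" "f \<in> ?cc \<xi>" for \<xi> f
    using cocyclesD(2)[OF KN that] .
  have cc_section: "\<exists>E \<iota> \<phi> \<sigma>. \<xi> = (E, \<iota>, \<phi>) \<and> sectioned_extension G K N E \<iota> \<phi> \<sigma> \<and> ext_cocycle G K N (E, \<iota>, \<phi>) \<sigma> = f"
    if "\<xi> \<in> ?X" "f \<in> ?cc \<xi>" for \<xi> f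
  proof -
    obtain E \<iota> \<phi> where \<xi>: "\<xi> = (E, \<iota>, \<phi>)" by (cases \<xi>)
    obtain \<sigma> where \<sigma>: "\<sigma> \<in> even_sections N \<xi>" "f = ext_cocycle G K N \<xi> \<sigma>"
      using \<open>f \<in> _\<close> by (auto simp: cocycles_def)
    have "sectioned_extension G K N E \<iota> \<phi> \<sigma>"
      by (intro sectioned_extension.intro sectioned_extension_axioms.intro KN)
        (use \<open>\<xi> \<in> _\<close> \<sigma> \<xi> in auto)
    then show ?thesis using \<xi> \<sigma> by blast
  qed
  \<comment> \<open>Stated for extensions of any element type, since it is also applied to Baer sums
    and multiples.\<close>
  have section_cc: "f \<in> cocycles G K N (E, \<iota>, \<phi>)" "(E, \<iota>, \<phi>) \<in> extensions G K N"
    if "sectioned_extension G K N E \<iota> \<phi> \<sigma>" "ext_cocycle G K N (E, \<iota>, \<phi>) \<sigma> = f"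
    for E :: "('k, 'g, 'x) gmodule" and \<iota> \<phi> \<sigma> f
    using sectioned_extension.sec[OF that(1)] sectioned_extension.exten[OF that(1)] that(2)
    by (auto simp: cocycles_def)
  have cc_ppow: "f \<in> Z1_ppow G ?M" if \<xi>: "\<xi> \<in> ?S" and f: "f \<in> ?cc \<xi>" for \<xi> f
  proof -
    obtain E \<iota> \<phi> \<sigma> where s: "\<xi> = (E, \<iota>, \<phi>)" "sectioned_extension G K N E \<iota> \<phi> \<sigma>" "ext_cocycle G K N (E, \<iota>, \<phi>) \<sigma> = f"
      using cc_section[OF SX[OF \<xi>] f] by blast
    have "restricted_gmodule G E" using \<xi> s(1) by (simp add: res_extensions_def)
    then show ?thesis using restricted_iff_cocycle[OF char assms(2-4) s(2)] s(3) by simp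
  qed
  have exists: "\<exists>\<xi>\<in>?S. f \<in> ?cc \<xi>" if f: "f \<in> Z1_ppow G ?M" for f
  proof -
    have "f \<in> Z1 G ?M" using f by (simp add: Z1_ppow_def)
    then obtain E :: "('k, 'g, 'e) gmodule" and \<iota> \<phi> \<sigma> where s: "sectioned_extension G K N E \<iota> \<phi> \<sigma>"
      "ext_cocycle G K N (E, \<iota>, \<phi>) \<sigma> = f"
      using sectioned_extension_exists[OF KN _ h] by blast
    have "restricted_gmodule G E" using restricted_iff_cocycle[OF char assms(2-4) s(1)] s(2) f by simp
    then have "(E, \<iota>, \<phi>) \<in> ?S" using section_cc(2)[OF s] by (simp add: res_extensions_def)
    then show ?thesis using section_cc(1)[OF s] by blast
  qed

  \<comment> \<open>Extensions are equivalent iff they have the same cocycles, so an equivalence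
    class can be described without mentioning equivalences.\<close>
  let ?class = "\<lambda>\<xi>. {\<eta> \<in> ?S. ?cc \<eta> = ?cc \<xi>}"
  have rel: "(\<xi>, \<eta>) \<in> ext_rel G K S \<longleftrightarrow> \<xi> \<in> S \<and> \<eta> \<in> S \<and> ?cc \<xi> = ?cc \<eta>" if "S \<subseteq> ?X" for S \<xi> \<eta>
    using ext_equiv_iff_cocycles[OF KN, of \<xi> \<eta>] that unfolding ext_rel_def by blast
  have SX': "?S \<subseteq> ?X" using SX by blast
  have carrier_Ext: "carrier ?E = ?class ` ?S"
  proof -
    have "ext_rel G K ?S `` {\<xi>} = ?class \<xi>" if "\<xi> \<in> ?S" for \<xi>
      by (intro Set.set_eqI) (use that in \<open>simp add: Image_singleton_iff rel[OF SX'] eq_commute\<close>)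
    then have "(\<Union>\<xi>\<in>?S. {ext_rel G K ?S `` {\<xi>}}) = (\<Union>\<xi>\<in>?S. {?class \<xi>})" by (intro SUP_cong refl) simp
    then show ?thesis by (simp add: Ext_res_def ext_space_def quotient_def Setcompr_eq_image UNION_singleton_eq_range)
  qed
  have class_eqI: "C = ?class \<xi>" if "C \<in> carrier ?E" "\<xi> \<in> C" for C \<xi>
    using that by (auto simp: carrier_Ext)
  have carrierE: "\<exists>\<xi> g. \<xi> \<in> ?S \<and> C = ?class \<xi> \<and> g \<in> Z1_res G ?M \<and> res_incl G g \<in> ?cc \<xi>"
    if C: "C \<in> carrier ?E" for C
  proof -
    obtain \<xi> where \<xi>: "\<xi> \<in> ?S" "C = ?class \<xi>" using C unfolding carrier_Ext by blast
    obtain f where f: "f \<in> ?cc \<xi>" using cocycles_nonempty[OF KN SX[OF \<xi>(1)]] by blast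
    obtain g where "g \<in> Z1_res G ?M" "res_incl G g = f" by (rule res_incl_surj[OF GM cc_ppow[OF \<xi>(1) f]])
    then show ?thesis using \<xi> f by blast
  qed
  have class_carrier: "{\<xi> \<in> ?S. ?cc \<xi> = B1 G ?M +>\<^bsub>?HG\<^esub> res_incl G g} \<in> carrier ?E"
    "\<exists>\<xi>\<in>?S. {\<xi> \<in> ?S. ?cc \<xi> = B1 G ?M +>\<^bsub>?HG\<^esub> res_incl G g} = ?class \<xi> \<and> res_incl G g \<in> ?cc \<xi>"
    if g: "g \<in> Z1_res G ?M" for g
  proof -
    obtain \<xi> where \<xi>: "\<xi> \<in> ?S" "res_incl G g \<in> ?cc \<xi>" using exists[OF res_incl_Z1_ppow[OF GM g]] by blast
    then have "{\<xi> \<in> ?S. ?cc \<xi> = B1 G ?M +>\<^bsub>?HG\<^esub> res_incl G g} = ?class \<xi>" using cc_coset[OF SX] by simp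
    with \<xi> show "\<exists>\<xi>\<in>?S. {\<xi> \<in> ?S. ?cc \<xi> = B1 G ?M +>\<^bsub>?HG\<^esub> res_incl G g} = ?class \<xi> \<and> res_incl G g \<in> ?cc \<xi>"
      "{\<xi> \<in> ?S. ?cc \<xi> = B1 G ?M +>\<^bsub>?HG\<^esub> res_incl G g} \<in> carrier ?E" by (auto simp: carrier_Ext)
  qed

  \<comment> \<open>The required identity dictates the definition: the value at a class is the
    preimage under \<open>res_incl\<close> of the set of cocycles of its members.\<close>
  define Fr where "Fr = (\<lambda>C\<in>carrier ?E. {g \<in> Z1_res G ?M. \<exists>\<xi>\<in>C. res_incl G g \<in> ?cc \<xi>})"
  have Fr_class: "Fr (?class \<xi>) = {f \<in> Z1_res G ?M. res_incl G f \<in> ?cc \<xi>}" if \<xi>: "\<xi> \<in> ?S" for \<xi>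
  proof -
    have "?class \<xi> \<in> carrier ?E" unfolding carrier_Ext using \<xi> by blast
    then have "Fr (?class \<xi>) = {f \<in> Z1_res G ?M. \<exists>\<eta>\<in>?class \<xi>. res_incl G f \<in> ?cc \<eta>}" unfolding Fr_def by (rule restrict_apply')
    also have "\<dots> = {f \<in> Z1_res G ?M. res_incl G f \<in> ?cc \<xi>}" using \<xi> by blast
    finally show ?thesis .
  qed
  have Fr: "Fr (?class \<xi>) = B1_res G ?M +>\<^bsub>?HP\<^esub> g"
    if \<xi>: "\<xi> \<in> ?S" and g: "g \<in> Z1_res G ?M" "res_incl G g \<in> ?cc \<xi>" for \<xi> g
  proof -
    show ?thesis
      using coset_eq_res_incl[OF GM g(1)] cc_coset[OF SX[OF \<xi>] g(2)] Fr_class[OF \<xi>] by simp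
  qed
  have Fr': "Fr {\<xi> \<in> ?S. ?cc \<xi> = B1 G ?M +>\<^bsub>?HG\<^esub> res_incl G g} = B1_res G ?M +>\<^bsub>?HP\<^esub> g"
    if g: "g \<in> Z1_res G ?M" for g
    using class_carrier(2)[OF g] Fr[OF _ g] by auto

  \<comment> \<open>Compatibility with Baer sums and scalar multiples\<close>
  have add: "C \<oplus>\<^bsub>?E\<^esub> D = {\<xi> \<in> ?S. ?cc \<xi> = B1 G ?M +>\<^bsub>?HG\<^esub> res_incl G (g \<oplus>\<^bsub>?HP\<^esub> g')}"
    if C: "\<xi> \<in> ?S" "C = ?class \<xi>" "g \<in> Z1_res G ?M" "res_incl G g \<in> ?cc \<xi>"
      and D: "\<xi>' \<in> ?S" "D = ?class \<xi>'" "g' \<in> Z1_res G ?M" "res_incl G g' \<in> ?cc \<xi>'"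
    for C D \<xi> \<xi>' g g'
  proof -
    have "ext_equiv G K \<zeta> (baer_sum K \<eta> \<eta>') \<longleftrightarrow> ?cc \<zeta> = B1 G ?M +>\<^bsub>?HG\<^esub> res_incl G (g \<oplus>\<^bsub>?HP\<^esub> g')"
      if \<zeta>: "\<zeta> \<in> ?S" and \<eta>: "\<eta> \<in> C" "\<eta>' \<in> D" for \<zeta> \<eta> \<eta>'
    proof -
      have \<eta>_cc: "\<eta> \<in> ?X" "res_incl G g \<in> ?cc \<eta>" "\<eta>' \<in> ?X" "res_incl G g' \<in> ?cc \<eta>'"
        using \<eta> C D SX by auto
      from cc_section[OF \<eta>_cc(1,2)] obtain E\<^sub>1 \<iota>\<^sub>1 \<phi>\<^sub>1 \<sigma>\<^sub>1 where
        s: "\<eta> = (E\<^sub>1, \<iota>\<^sub>1, \<phi>\<^sub>1)" "sectioned_extension G K N E\<^sub>1 \<iota>\<^sub>1 \<phi>\<^sub>1 \<sigma>\<^sub>1" "ext_cocycle G K N (E\<^sub>1, \<iota>\<^sub>1, \<phi>\<^sub>1) \<sigma>\<^sub>1 = res_incl G g"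
        by blast
      from cc_section[OF \<eta>_cc(3,4)] obtain E\<^sub>2 \<iota>\<^sub>2 \<phi>\<^sub>2 \<sigma>\<^sub>2 where
        s': "\<eta>' = (E\<^sub>2, \<iota>\<^sub>2, \<phi>\<^sub>2)" "sectioned_extension G K N E\<^sub>2 \<iota>\<^sub>2 \<phi>\<^sub>2 \<sigma>\<^sub>2" "ext_cocycle G K N (E\<^sub>2, \<iota>\<^sub>2, \<phi>\<^sub>2) \<sigma>\<^sub>2 = res_incl G g'"
        by blast
      obtain E \<iota> \<phi> \<sigma> where b: "baer_sum K \<eta> \<eta>' = (E, \<iota>, \<phi>)" "sectioned_extension G K N E \<iota> \<phi> \<sigma>"
        "ext_cocycle G K N (E, \<iota>, \<phi>) \<sigma> = res_incl G (g \<oplus>\<^bsub>?HP\<^esub> g')"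
        by (rule baer_sum_sectioned[OF s(2) s'(2), unfolded s(3) s'(3)])
          (simp only: s(1) s'(1) res_incl_linear(1)[OF GM C(3) D(3)])
      note c = section_cc[OF b(2,3)]
      show ?thesis
        using ext_equiv_iff_cocycles[OF KN SX[OF \<zeta>] c(2)] cocyclesD(2)[OF KN c(2,1)] b(1) by simp
    qed
    moreover have "C \<oplus>\<^bsub>?E\<^esub> D = {\<zeta> \<in> ?S. \<exists>\<eta>\<in>C. \<exists>\<eta>'\<in>D. ext_equiv G K \<zeta> (baer_sum K \<eta> \<eta>')}"
      by (simp add: Ext_res_def ext_space_def)
    moreover have "\<xi> \<in> C" "\<xi>' \<in> D" using C D by simp_all
    ultimately show ?thesis by blast
  qed
  have smult: "c \<odot>\<^bsub>?E\<^esub> C = {\<xi> \<in> ?S. ?cc \<xi> = B1 G ?M +>\<^bsub>?HG\<^esub> res_incl G (c \<odot>\<^bsub>?HP\<^esub> g)}"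
    if C: "\<xi> \<in> ?S" "C = ?class \<xi>" "g \<in> Z1_res G ?M" "res_incl G g \<in> ?cc \<xi>" for c C \<xi> g
  proof -
    have "ext_equiv G K \<zeta> (scale_ext K N c \<eta>) \<longleftrightarrow> ?cc \<zeta> = B1 G ?M +>\<^bsub>?HG\<^esub> res_incl G (c \<odot>\<^bsub>?HP\<^esub> g)"
      if \<zeta>: "\<zeta> \<in> ?S" and \<eta>: "\<eta> \<in> C" for \<zeta> \<eta>
    proof -
      have \<eta>_cc: "\<eta> \<in> ?X" "res_incl G g \<in> ?cc \<eta>" using \<eta> C SX by auto
      from cc_section[OF this] obtain E\<^sub>1 \<iota>\<^sub>1 \<phi>\<^sub>1 \<sigma>\<^sub>1 where
        s: "\<eta> = (E\<^sub>1, \<iota>\<^sub>1, \<phi>\<^sub>1)" "sectioned_extension G K N E\<^sub>1 \<iota>\<^sub>1 \<phi>\<^sub>1 \<sigma>\<^sub>1" "ext_cocycle G K N (E\<^sub>1, \<iota>\<^sub>1, \<phi>\<^sub>1) \<sigma>\<^sub>1 = res_incl G g"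
        by blast
      obtain E \<iota> \<phi> \<sigma> where b: "scale_ext K N c \<eta> = (E, \<iota>, \<phi>)" "sectioned_extension G K N E \<iota> \<phi> \<sigma>"
        "ext_cocycle G K N (E, \<iota>, \<phi>) \<sigma> = res_incl G (c \<odot>\<^bsub>?HP\<^esub> g)"
        by (rule scale_ext_sectioned[OF s(2), of c, unfolded s(3)])
          (simp only: s(1) res_incl_linear(2)[OF GM C(3)])
      note c = section_cc[OF b(2,3)]
      show ?thesis
        using ext_equiv_iff_cocycles[OF KN SX[OF \<zeta>] c(2)] cocyclesD(2)[OF KN c(2,1)] b(1) by simp
    qed
    moreover have "c \<odot>\<^bsub>?E\<^esub> C = {\<zeta> \<in> ?S. \<exists>\<eta>\<in>C. ext_equiv G K \<zeta> (scale_ext K N c \<eta>)}"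
      by (simp add: Ext_res_def ext_space_def)
    moreover have "\<xi> \<in> C" using C by simp
    ultimately show ?thesis by blast
  qed

  \<comment> \<open>Linearity and bijectivity\<close>
  have "Fr \<in> lin_maps ?E (H1_res G ?M)"
  proof (rule lin_mapsI)
    fix C assume "C \<in> carrier ?E"
    then obtain \<xi> g where C: "\<xi> \<in> ?S" "C = ?class \<xi>" "g \<in> Z1_res G ?M" "res_incl G g \<in> ?cc \<xi>"
      using carrierE by blast
    have FC: "Fr C = B1_res G ?M +>\<^bsub>?HP\<^esub> g" using Fr[OF C(1,3,4)] C(2) by simp
    then show "Fr C \<in> carrier (H1_res G ?M)" using C(3) by (simp add: H1_res_simps[OF GM])
    show "Fr (c \<odot>\<^bsub>?E\<^esub> C) = c \<odot>\<^bsub>H1_res G ?M\<^esub> Fr C" for c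
      unfolding smult[OF C] FC H1_res_simps(3)[OF GM C(3)] by (rule Fr'[OF Z1_res_smult[OF GM C(3)]])
    fix D assume "D \<in> carrier ?E"
    then obtain \<xi>' g' where D: "\<xi>' \<in> ?S" "D = ?class \<xi>'" "g' \<in> Z1_res G ?M" "res_incl G g' \<in> ?cc \<xi>'"
      using carrierE by blast
    have FD: "Fr D = B1_res G ?M +>\<^bsub>?HP\<^esub> g'" using Fr[OF D(1,3,4)] D(2) by simp
    show "Fr (C \<oplus>\<^bsub>?E\<^esub> D) = Fr C \<oplus>\<^bsub>H1_res G ?M\<^esub> Fr D"
      unfolding add[OF C D] FC FD H1_res_simps(2)[OF GM C(3) D(3)] by (rule Fr'[OF Z1_res_add[OF GM C(3) D(3)]])
  qed (simp add: Fr_def)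
  moreover have "bij_betw Fr (carrier ?E) (carrier (H1_res G ?M))"
  proof (rule bij_betw_imageI)
    show "inj_on Fr (carrier ?E)"
    proof (rule inj_onI)
      fix C D assume CD: "C \<in> carrier ?E" "D \<in> carrier ?E" "Fr C = Fr D"
      obtain \<xi> g where C: "\<xi> \<in> ?S" "C = ?class \<xi>" "g \<in> Z1_res G ?M" "res_incl G g \<in> ?cc \<xi>"
        using carrierE[OF CD(1)] by blast
      \<comment> \<open>A common element of the two values restricts to a cocycle of a member of
        \<open>C\<close> and of a member of \<open>D\<close>. As sets of cocycles are cosets, the
        two sets coincide.\<close>
      have "g \<in> Fr D" unfolding CD(3)[symmetric] C(2) Fr_class[OF C(1)] using C by simp
      then obtain \<xi>' where \<xi>': "\<xi>' \<in> D" "res_incl G g \<in> ?cc \<xi>'"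
        unfolding Fr_def restrict_apply'[OF CD(2)] by blast
      have D: "D = ?class \<xi>'" by (rule class_eqI[OF CD(2) \<xi>'(1)])
      have "\<xi>' \<in> ?S" using D \<xi>'(1) by blast
      then have "?cc \<xi> = ?cc \<xi>'" using cc_coset[OF SX[OF C(1)] C(4)] cc_coset[OF SX \<xi>'(2)] by simp
      then show "C = D" using C(2) D by simp
    qed
    show "Fr ` carrier ?E = carrier (H1_res G ?M)"
    proof
      show "Fr ` carrier ?E \<subseteq> carrier (H1_res G ?M)"
        using lin_mapsD(1)[OF \<open>Fr \<in> _\<close>] by blast
      show "carrier (H1_res G ?M) \<subseteq> Fr ` carrier ?E"
      proof
        fix A assume "A \<in> carrier (H1_res G ?M)"
        then obtain g where g: "g \<in> Z1_res G ?M" "A = B1_res G ?M +>\<^bsub>?HP\<^esub> g"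
          by (auto simp: H1_res_simps[OF GM] simp del: hom_space_simps)
        show "A \<in> Fr ` carrier ?E" unfolding g(2) Fr'[OF g(1), symmetric] using class_carrier(1)[OF g(1)] by blast
      qed
    qed
  qed
  ultimately have iso: "Fr \<in> lin_isos ?E (H1_res G ?M)" by (simp add: lin_isos_def)

  \<comment> \<open>Commutativity of the square\<close>
  have "i1 G ?M (Fr C) = F_map G K N (i2 G K N C)" if C: "C \<in> carrier ?E" for C
  proof -
    obtain \<xi> g where \<xi>: "\<xi> \<in> ?S" "C = ?class \<xi>" "g \<in> Z1_res G ?M" "res_incl G g \<in> ?cc \<xi>"
      using carrierE[OF C] by blast
    have FC: "Fr C = {f \<in> Z1_res G ?M. res_incl G f \<in> ?cc \<xi>}"
      unfolding \<xi>(2) by (rule Fr_class[OF \<xi>(1)])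
    have "i1 G ?M (Fr C) = (\<Union>f\<in>Fr C. B1 G ?M +>\<^bsub>?HG\<^esub> res_incl G f)" by (simp add: i1_def res_incl_def)
    also have "\<dots> = (\<Union>f\<in>Fr C. ?cc \<xi>)"
      by (intro SUP_cong refl) (use FC cc_coset[OF SX[OF \<xi>(1)]] in auto)
    also have "\<dots> = ?cc \<xi>" using \<xi>(3,4) by (auto simp: FC)
    finally have 1: "i1 G ?M (Fr C) = ?cc \<xi>" .
    have i2: "i2 G K N C = {\<eta> \<in> ?X. ?cc \<eta> = ?cc \<xi>}"
    proof (intro Set.set_eqI)
      fix \<eta>
      have "\<eta> \<in> i2 G K N C \<longleftrightarrow> (\<exists>\<zeta>\<in>C. \<zeta> \<in> ?X \<and> \<eta> \<in> ?X \<and> ?cc \<zeta> = ?cc \<eta>)"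
        unfolding i2_def Image_iff using rel[OF order_refl] by blast
      also have "\<dots> \<longleftrightarrow> \<eta> \<in> ?X \<and> ?cc \<eta> = ?cc \<xi>"
        unfolding \<xi>(2) using \<xi>(1) SX by blast
      finally show "\<eta> \<in> i2 G K N C \<longleftrightarrow> \<eta> \<in> {\<eta> \<in> ?X. ?cc \<eta> = ?cc \<xi>}" by simp
    qed
    have "F_map G K N (i2 G K N C) = (\<Union>\<eta>\<in>i2 G K N C. \<Union>f\<in>?cc \<eta>. B1 G ?M +>\<^bsub>?HG\<^esub> f)"
      by (simp add: F_map_def Let_def cocycles_def)
    also have "\<dots> = (\<Union>\<eta>\<in>i2 G K N C. \<Union>f\<in>?cc \<eta>. ?cc \<xi>)"
      by (intro SUP_cong refl) (use i2 cc_coset in auto)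
    also have "\<dots> = ?cc \<xi>" unfolding i2 using \<xi>(1,4) SX by blast
    finally show ?thesis using 1 by simp
  qed
  with iso show ?thesis by blast
qed

end
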